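(* For every $s\in(0,1)$, $H^{s,2}(\mathbb{R}^n)=W^{s,2}(\mathbb{R}^n)$ with equivalence of norms.
   Context: $\mathfrak{F}$ is the Fourier transform on tempered distributions $\mathcal{S}'(\mathbb{R}^n)$, normalized by $\mathfrak{F}f(\xi)=\int_{\mathbb{R}^n}f(x)e^{-2\pi i x\cdot\xi}\,dx$. For $s\in\mathbb{C}$ the Bessel potential is $\Lambda_s f=\mathfrak{F}^{-1}\big((1+4\pi^2|\xi|^2)^{-s/2}\mathfrak{F}f(\xi)\big)$, $f\in\mathcal{S}'(\mathbb{R}^n)$. For $s\in\mathbb{R}$ and $1<p<\infty$, the Bessel potential space is $H^{s,p}(\mathbb{R}^n)=\{f\in\mathcal{S}'(\mathbb{R}^n):\Lambda_{-s}f\in L^p(\mathbb{R}^n)\}$ with norm $\|f\|_{H^{s,p}}=\|\Lambda_{-s}f\|_{L^p}$ (considered up to equivalence of norms). For $s\in(0,1)$, $1\le p<\infty$, the Gagliardo space $W^{s,p}(\mathbb{R}^n)$ is the set of $u\in L^p(\mathbb{R}^n)$ with $[u]_{W^{s,p}}:=\left(\int_{\mathbb{R}^n}\int_{\mathbb{R}^n}\frac{|u(x)-u(y)|^p}{|x-y|^{n+sp}}\,dx\,dy\right)^{1/p}<\infty$, with norm $\|u\|_{L^p}+[u]_{W^{s,p}}$. *)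

theory Defs
  imports "HOL-Analysis.Analysis"
begin

section \<open>Schwartz functions\<close>

definition partial_deriv :: "'n \<Rightarrow> (real^'n \<Rightarrow> complex) \<Rightarrow> real^'n \<Rightarrow> complex" where
  "partial_deriv i f = (\<lambda>x. frechet_derivative f (at x) (axis i 1))"

text \<open>A multi-index is given as a list of coordinate directions. Since the partial derivatives of a
  smooth function commute, only the multiplicities in the list matter.\<close>

definition iter_partial_deriv :: "'n list \<Rightarrow> (real^'n \<Rightarrow> complex) \<Rightarrow> real^'n \<Rightarrow> complex" where
  "iter_partial_deriv \<alpha> f = foldr partial_deriv \<alpha> f"

definition smooth :: "(real^'n \<Rightarrow> complex) \<Rightarrow> bool" where
  "smooth f \<longleftrightarrow> (\<forall>\<alpha> x. iter_partial_deriv \<alpha> f differentiable (at x))"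

definition schwartz :: "(real^'n \<Rightarrow> complex) set" where
  "schwartz = {\<phi>. smooth \<phi> \<and>
     (\<forall>k \<alpha>. bounded (range (\<lambda>x. norm x ^ k *\<^sub>R iter_partial_deriv \<alpha> \<phi> x)))}"

definition schwartz_seminorm :: "nat \<Rightarrow> 'n list \<Rightarrow> (real^'n \<Rightarrow> complex) \<Rightarrow> real" where
  "schwartz_seminorm k \<alpha> \<phi> = (SUP x. norm x ^ k * cmod (iter_partial_deriv \<alpha> \<phi> x))"

text \<open>The locally convex topology of the Schwartz space, generated by the balls of all seminorms.\<close>

definition schwartz_topology :: "(real^'n \<Rightarrow> complex) topology" where
  "schwartz_topology = topology_generated_by
     {{\<psi> \<in> schwartz. schwartz_seminorm k \<alpha> (\<lambda>x. \<psi> x - \<phi> x) < \<epsilon>} | \<phi> k \<alpha> \<epsilon>. \<phi> \<in> schwartz \<and> \<epsilon> > 0}"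

section \<open>Tempered distributions\<close>

text \<open>Functionals are \<open>undefined\<close> outside the Schwartz space, so that two distributions are equal
  in HOL iff they agree on all Schwartz functions.\<close>

definition tempered_distributions :: "((real^'n \<Rightarrow> complex) \<Rightarrow> complex) set" where
  "tempered_distributions = {T \<in> extensional schwartz.
     (\<forall>\<phi>\<in>schwartz. \<forall>\<psi>\<in>schwartz. \<forall>a b. T (\<lambda>x. a * \<phi> x + b * \<psi> x) = a * T \<phi> + b * T \<psi>) \<and>
     continuous_map schwartz_topology euclidean T}"

definition regular_dist :: "(real^'n \<Rightarrow> complex) \<Rightarrow> (real^'n \<Rightarrow> complex) \<Rightarrow> complex" where
  "regular_dist u = (\<lambda>\<phi>\<in>schwartz. LINT x|lborel. u x * \<phi> x)"

definition mult_dist ::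
    "(real^'n \<Rightarrow> complex) \<Rightarrow> ((real^'n \<Rightarrow> complex) \<Rightarrow> complex) \<Rightarrow> (real^'n \<Rightarrow> complex) \<Rightarrow> complex" where
  "mult_dist m T = (\<lambda>\<phi>\<in>schwartz. T (\<lambda>x. m x * \<phi> x))"

section \<open>Fourier transform and Bessel potentials\<close>

definition fourier :: "(real^'n \<Rightarrow> complex) \<Rightarrow> real^'n \<Rightarrow> complex" where
  "fourier f \<xi> = (LINT x|lborel. f x * exp (- 2 * of_real pi * \<i> * of_real (x \<bullet> \<xi>)))"

definition inv_fourier :: "(real^'n \<Rightarrow> complex) \<Rightarrow> real^'n \<Rightarrow> complex" where
  "inv_fourier f x = (LINT \<xi>|lborel. f \<xi> * exp (2 * of_real pi * \<i> * of_real (x \<bullet> \<xi>)))"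

definition fourier_dist ::
    "((real^'n \<Rightarrow> complex) \<Rightarrow> complex) \<Rightarrow> (real^'n \<Rightarrow> complex) \<Rightarrow> complex" where
  "fourier_dist T = (\<lambda>\<phi>\<in>schwartz. T (fourier \<phi>))"

definition inv_fourier_dist ::
    "((real^'n \<Rightarrow> complex) \<Rightarrow> complex) \<Rightarrow> (real^'n \<Rightarrow> complex) \<Rightarrow> complex" where
  "inv_fourier_dist T = (\<lambda>\<phi>\<in>schwartz. T (inv_fourier \<phi>))"

definition bessel_potential ::
    "complex \<Rightarrow> ((real^'n \<Rightarrow> complex) \<Rightarrow> complex) \<Rightarrow> (real^'n \<Rightarrow> complex) \<Rightarrow> complex" where
  "bessel_potential s T =
     inv_fourier_dist
       (mult_dist (\<lambda>\<xi>. complex_of_real (1 + 4 * pi\<^sup>2 * (norm \<xi>)\<^sup>2) powr (- s / 2))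
         (fourier_dist T))"

section \<open>Lebesgue, Bessel potential and Gagliardo spaces\<close>

text \<open>Elements are functions, not classes modulo null sets. Every class has a Borel representative,
  and \<open>regular_dist\<close> identifies functions that agree almost everywhere.\<close>

definition Lp_space :: "real \<Rightarrow> (real^'n \<Rightarrow> complex) set" where
  "Lp_space p = {f \<in> borel_measurable lborel. integrable lborel (\<lambda>x. cmod (f x) powr p)}"

definition Lp_norm :: "real \<Rightarrow> (real^'n \<Rightarrow> complex) \<Rightarrow> real" where
  "Lp_norm p f = (LINT x|lborel. cmod (f x) powr p) powr (1 / p)"

definition bessel_space :: "real \<Rightarrow> real \<Rightarrow> ((real^'n \<Rightarrow> complex) \<Rightarrow> complex) set" where
  "bessel_space s p = {T \<in> tempered_distributions.
     bessel_potential (- complex_of_real s) T \<in> regular_dist ` Lp_space p}"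

text \<open>The norm does not depend on the representing function picked by \<open>inv_into\<close>, since that
  function is unique up to null sets.\<close>

definition bessel_norm :: "real \<Rightarrow> real \<Rightarrow> ((real^'n \<Rightarrow> complex) \<Rightarrow> complex) \<Rightarrow> real" where
  "bessel_norm s p T =
     Lp_norm p (inv_into (Lp_space p) regular_dist (bessel_potential (- complex_of_real s) T))"

text \<open>On the diagonal the integrand is \<open>0 / 0 = 0\<close>; the diagonal is a null set.\<close>

definition gagliardo_energy :: "real \<Rightarrow> real \<Rightarrow> (real^'n \<Rightarrow> complex) \<Rightarrow> ennreal" where
  "gagliardo_energy s p u = (\<integral>\<^sup>+ y. \<integral>\<^sup>+ x.
     ennreal (cmod (u x - u y) powr p / norm (x - y) powr (real CARD('n) + s * p)) \<partial>lborel \<partial>lborel)"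

definition gagliardo_space :: "real \<Rightarrow> real \<Rightarrow> (real^'n \<Rightarrow> complex) set" where
  "gagliardo_space s p = {u \<in> Lp_space p. gagliardo_energy s p u < \<infinity>}"

definition gagliardo_seminorm :: "real \<Rightarrow> real \<Rightarrow> (real^'n \<Rightarrow> complex) \<Rightarrow> real" where
  "gagliardo_seminorm s p u = enn2real (gagliardo_energy s p u) powr (1 / p)"

definition gagliardo_norm :: "real \<Rightarrow> real \<Rightarrow> (real^'n \<Rightarrow> complex) \<Rightarrow> real" where
  "gagliardo_norm s p u = Lp_norm p u + gagliardo_seminorm s p u"

end

theory Submission
  imports Defs "HOL-Probability.Probability"
begin

text \<open>
  For \<open>p = 2\<close> both spaces are described by the size of the Fourier transform, and the theorem is a comparison
  of two weights. Let \<open>v\<close> be the Fourier transform of \<open>u\<close>. By definition and by Plancherel's theorem the Bessel norm of \<open>u\<close> is the norm of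
  \<open>(1 + 4 \<pi>\<^sup>2 \<bar>\<xi>\<bar>\<^sup>2)\<^bsup>s / 2\<^esup> v\<close>. In the Gagliardo energy one substitutes \<open>x = y + h\<close>, applies Plancherel's theorem to
  the difference of \<open>u\<close> and its translate for each \<open>h\<close> separately, and exchanges the integrals. The result is
  the integral of \<open>\<bar>v\<bar>\<^sup>2 K\<close>, where the symbol
  \<open>K \<xi> = \<integral> \<bar>exp (2 \<pi> \<i> h \<bullet> \<xi>) - 1\<bar>\<^sup>2 / \<bar>h\<bar>\<^bsup>n + 2 s\<^esup> dh\<close>
  is of the order \<open>\<bar>\<xi>\<bar>\<^bsup>2 s\<^esup>\<close>: the upper bound holds because the integrand is at most quadratic in \<open>\<bar>h\<bar> \<bar>\<xi>\<bar>\<close>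
  near the origin and bounded elsewhere, which uses \<open>0 < s < 1\<close>; the lower bound comes from a single ball on
  which the phase \<open>h \<bullet> \<xi>\<close> stays between 1/4 and 3/4. So \<open>1 + K\<close> and \<open>(1 + 4 \<pi>\<^sup>2 \<bar>\<xi>\<bar>\<^sup>2)\<^sup>s\<close> are comparable. These steps are
  \<open>gagliardo_energy_fourier\<close>, \<open>symbol_energy_upper\<close>, \<open>symbol_energy_lower\<close> and
  \<open>bessel_gagliardo_equivalence\<close>.

  The bulk of the work is the Fourier transform itself. On the Schwartz space, membership is always shown by
  coinduction on a set of functions stable under derivatives (\<open>schwartz_coinduct\<close>); the transform preserves
  the space (\<open>schwartz_fourier\<close>), and inversion follows by Gaussian regularization
  (\<open>inv_fourier_fourier\<close>). On square-integrable functions the transform is introduced as a relation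
  \<open>l2_fourier\<close> through its pairing with Schwartz functions, which is exactly how it acts on distributions.
  The same regularization together with Schur's test shows that the transform of an
  integrable function is no larger than the function in the square norm (\<open>fourier_contraction\<close>), so that it extends by completeness. As the inverse transform
  is a contraction for the same reason, both are isometries (\<open>plancherel\<close>). Uniqueness rests on the fact that
  Schwartz functions separate square-integrable functions (\<open>L2_zero_of_schwartz_tests\<close>).

  With this calculus the Bessel potential of a square-integrable function is computed by multiplying its
  transform by the weight. Conversely a distribution whose potential is square-integrable is itself
  square-integrable, since dividing by the weight, which is at least 1, recovers its transform
  (\<open>bessel_space_regular\<close>). This identifies the two spaces, and the comparison of the weights gives the
  equivalence of the norms.
\<close>

section \<open>Changes of variables for Lebesgue measure\<close>

lemma nn_integral_lborel_translate:
  fixes f :: "'a::euclidean_space \<Rightarrow> ennreal"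
  assumes [measurable]: "f \<in> borel_measurable borel"
  shows "(\<integral>\<^sup>+x. f (a + x) \<partial>lborel) = (\<integral>\<^sup>+x. f x \<partial>lborel)"
proof -
  have "(\<integral>\<^sup>+x. f x \<partial>lborel) = (\<integral>\<^sup>+x. f x \<partial>distr lborel borel ((+) a))"
    by (simp add: lborel_distr_plus)
  also have "\<dots> = (\<integral>\<^sup>+x. f (a + x) \<partial>lborel)"
    by (subst nn_integral_distr) auto
  finally show ?thesis by simp
qed

lemma integral_lborel_translate:
  fixes f :: "'a::euclidean_space \<Rightarrow> 'b::{banach, second_countable_topology}"
  assumes [measurable]: "f \<in> borel_measurable borel"
  shows "(LINT x|lborel. f (a + x)) = (LINT x|lborel. f x)"
proof -
  have "(LINT x|lborel. f x) = (LINT x|distr lborel borel ((+) a). f x)"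
    by (simp add: lborel_distr_plus)
  also have "\<dots> = (LINT x|lborel. f (a + x))"
    by (subst integral_distr) auto
  finally show ?thesis by simp
qed

lemma integrable_lborel_translate:
  fixes f :: "'a::euclidean_space \<Rightarrow> 'b::{banach, second_countable_topology}"
  assumes "integrable lborel f"
  shows "integrable lborel (\<lambda>x. f (a + x))"
proof -
  have "integrable (distr lborel borel ((+) a)) f"
    using assms by (simp add: lborel_distr_plus)
  then show ?thesis
    by (subst (asm) integrable_distr_eq) (use assms in auto)
qed

lemma lborel_distr_scaleR:
  fixes c :: real
  assumes "c \<noteq> 0"
  shows "(lborel :: 'a::euclidean_space measure) = density (distr lborel borel ((*\<^sub>R) c)) (\<lambda>_. ennreal (\<bar>c\<bar> ^ DIM('a)))"
  using lborel_affine[OF assms, of "0::'a"] by (simp add: prod_constant)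

lemma nn_integral_lborel_scaleR:
  fixes f :: "'a::euclidean_space \<Rightarrow> ennreal"
  assumes [measurable]: "f \<in> borel_measurable borel" and "c \<noteq> 0"
  shows "(\<integral>\<^sup>+x. f x \<partial>lborel) = ennreal (\<bar>c\<bar> ^ DIM('a)) * (\<integral>\<^sup>+x. f (c *\<^sub>R x) \<partial>lborel)"
  by (subst lborel_distr_scaleR[OF \<open>c \<noteq> 0\<close>], subst nn_integral_density)
     (auto simp: nn_integral_distr nn_integral_cmult)

lemma integral_lborel_scaleR:
  fixes f :: "'a::euclidean_space \<Rightarrow> 'b::{banach, second_countable_topology}"
  assumes [measurable]: "f \<in> borel_measurable borel" and "c \<noteq> 0"
  shows "(LINT x|lborel. f x) = (\<bar>c\<bar> ^ DIM('a)) *\<^sub>R (LINT x|lborel. f (c *\<^sub>R x))"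
  by (subst lborel_distr_scaleR[OF \<open>c \<noteq> 0\<close>], subst integral_density)
     (auto simp: integral_distr)

lemma integral_lborel_reflect:
  fixes f :: "'a::euclidean_space \<Rightarrow> 'b::{banach, second_countable_topology}"
  assumes [measurable]: "f \<in> borel_measurable borel"
  shows "(LINT x|lborel. f (- x)) = (LINT x|lborel. f x)"
  using integral_lborel_scaleR[OF assms, of "-1"] by simp

lemma nn_integral_lborel_reflect:
  fixes f :: "'a::euclidean_space \<Rightarrow> ennreal"
  assumes [measurable]: "f \<in> borel_measurable borel"
  shows "(\<integral>\<^sup>+x. f (- x) \<partial>lborel) = (\<integral>\<^sup>+x. f x \<partial>lborel)"
  using nn_integral_lborel_scaleR[OF assms, of "-1"] by simp

lemma integrable_lborel_scaleR:
  fixes f :: "'a::euclidean_space \<Rightarrow> 'b::{banach, second_countable_topology}"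
  assumes "integrable lborel f" "c \<noteq> 0"
  shows "integrable lborel (\<lambda>x. f (c *\<^sub>R x))"
proof -
  have "integrable (density (distr lborel borel ((*\<^sub>R) c)) (\<lambda>_. ennreal (\<bar>c\<bar> ^ DIM('a)))) f"
    using assms by (simp add: lborel_distr_scaleR[symmetric])
  then have "integrable lborel (\<lambda>x. (\<bar>c\<bar> ^ DIM('a)) *\<^sub>R f (c *\<^sub>R x))"
    by (subst (asm) integrable_density) (use assms in \<open>auto simp: integrable_distr_eq\<close>)
  then have "integrable lborel (\<lambda>x. inverse (\<bar>c\<bar> ^ DIM('a)) *\<^sub>R ((\<bar>c\<bar> ^ DIM('a)) *\<^sub>R f (c *\<^sub>R x)))"
    by (rule integrable_scaleR_right)
  then show ?thesis using assms by simp
qed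

section \<open>Square-integrable functions\<close>

text \<open>The squared norm takes extended values, so that the theorems of Tonelli, Fatou and Plancherel can be
  stated for it as they stand. Finiteness is asked for only where a function has to be in the space.\<close>

definition l2sq :: "('a::euclidean_space \<Rightarrow> complex) \<Rightarrow> ennreal" where
  "l2sq f = (\<integral>\<^sup>+x. ennreal ((cmod (f x))\<^sup>2) \<partial>lborel)"

lemma Lp_space_2_iff: "f \<in> Lp_space 2 \<longleftrightarrow> f \<in> borel_measurable borel \<and> l2sq f < \<infinity>"
  unfolding Lp_space_def l2sq_def by (auto simp: integrable_iff_bounded)

lemma Lp_space_2_measurable [measurable_dest]: "f \<in> Lp_space 2 \<Longrightarrow> f \<in> borel_measurable borel"
  by (simp add: Lp_space_2_iff)

lemma integrable_cmod_sq: "f \<in> Lp_space 2 \<Longrightarrow> integrable lborel (\<lambda>x. (cmod (f x))\<^sup>2)"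
  unfolding Lp_space_def by simp

lemma l2sq_eq: "f \<in> Lp_space 2 \<Longrightarrow> l2sq f = ennreal (LINT x|lborel. (cmod (f x))\<^sup>2)"
  unfolding l2sq_def by (intro nn_integral_eq_integral integrable_cmod_sq) auto

lemma Lp_norm_2:
  assumes "f \<in> Lp_space 2"
  shows "Lp_norm 2 f = sqrt (enn2real (l2sq f))"
  using l2sq_eq[OF assms] unfolding Lp_norm_def
  by (simp add: powr_half_sqrt)

lemma l2sq_add_le:
  assumes [measurable]: "f \<in> borel_measurable borel" "g \<in> borel_measurable borel"
  shows "l2sq (\<lambda>x. f x + g x) \<le> 2 * l2sq f + 2 * l2sq g"
proof -
  have "(cmod (f x + g x))\<^sup>2 \<le> 2 * (cmod (f x))\<^sup>2 + 2 * (cmod (g x))\<^sup>2" for x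
  proof -
    have "(cmod (f x + g x))\<^sup>2 \<le> (cmod (f x) + cmod (g x))\<^sup>2"
      by (intro power_mono norm_triangle_ineq) auto
    also have "\<dots> \<le> 2 * (cmod (f x))\<^sup>2 + 2 * (cmod (g x))\<^sup>2"
      using sum_squares_bound[of "cmod (f x)" "cmod (g x)"] by (simp add: power2_sum)
    finally show ?thesis .
  qed
  then have "l2sq (\<lambda>x. f x + g x) \<le> (\<integral>\<^sup>+x. 2 * ennreal ((cmod (f x))\<^sup>2) + 2 * ennreal ((cmod (g x))\<^sup>2) \<partial>lborel)"
    unfolding l2sq_def
    by (intro nn_integral_mono)
       (simp add: ennreal_mult[symmetric] ennreal_plus[symmetric] ennreal_leI flip: ennreal_numeral del: ennreal_plus)
  also have "\<dots> = 2 * l2sq f + 2 * l2sq g"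
    unfolding l2sq_def by (simp add: nn_integral_add nn_integral_cmult)
  finally show ?thesis .
qed

lemma l2sq_cmult: "f \<in> borel_measurable borel \<Longrightarrow> l2sq (\<lambda>x. c * f x) = ennreal ((cmod c)\<^sup>2) * l2sq f"
  unfolding l2sq_def by (simp add: norm_mult power_mult_distrib ennreal_mult nn_integral_cmult)

text \<open>The factor 2 comes from \<open>(a + b)\<^sup>2 \<le> 2 a\<^sup>2 + 2 b\<^sup>2\<close>. It takes the place of Minkowski's
  inequality where only finiteness or the Cauchy property is at stake.\<close>

lemma l2sq_diff_le:
  assumes [measurable]: "f \<in> borel_measurable borel" "g \<in> borel_measurable borel"
  shows "l2sq (\<lambda>x. f x - g x) \<le> 2 * l2sq f + 2 * l2sq g"
  using l2sq_add_le[of f "\<lambda>x. - g x"] by (simp add: l2sq_def)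

lemma Lp_space_2_diff: "f \<in> Lp_space 2 \<Longrightarrow> g \<in> Lp_space 2 \<Longrightarrow> (\<lambda>x. f x - g x) \<in> Lp_space 2"
  unfolding Lp_space_2_iff
  by (intro conjI borel_measurable_diff) (auto intro!: le_less_trans[OF l2sq_diff_le] simp: ennreal_mult_less_top)

lemma l2sq_mono:
  assumes "\<And>x. cmod (f x) \<le> cmod (g x)"
  shows "l2sq f \<le> l2sq g"
  unfolding l2sq_def by (intro nn_integral_mono ennreal_leI power_mono assms) auto

lemma l2sq_cong_AE: "AE x in lborel. f x = g x \<Longrightarrow> l2sq f = l2sq g"
  unfolding l2sq_def by (intro nn_integral_cong_AE) auto

lemma Lp_space_2_bounded_mult:
  fixes f m :: "real^'n \<Rightarrow> complex"
  assumes f: "f \<in> Lp_space 2" and m: "m \<in> borel_measurable borel" and b: "\<And>x. cmod (m x) \<le> B"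
  shows "(\<lambda>x. m x * f x) \<in> Lp_space 2"
proof -
  have "l2sq (\<lambda>x. m x * f x) \<le> l2sq (\<lambda>x. complex_of_real B * f x)"
    by (rule l2sq_mono) (smt (verit) b mult_right_mono norm_ge_zero norm_mult norm_of_real)
  also have "\<dots> < \<infinity>"
    using f by (auto simp: l2sq_cmult Lp_space_2_iff ennreal_mult_less_top)
  finally show ?thesis using f m by (auto simp: Lp_space_2_iff)
qed

lemma integrable_mult_L2:
  assumes "f \<in> Lp_space 2" "g \<in> Lp_space 2"
  shows "integrable lborel (\<lambda>x. f x * g x)"
proof (rule Bochner_Integration.integrable_bound)
  show "integrable lborel (\<lambda>x. (cmod (f x))\<^sup>2 + (cmod (g x))\<^sup>2)"
    by (intro Bochner_Integration.integrable_add integrable_cmod_sq assms)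
  show "(\<lambda>x. f x * g x) \<in> borel_measurable lborel"
    using assms by (auto simp: Lp_space_2_iff)
  have "a * b \<le> a\<^sup>2 + b\<^sup>2" if "a \<ge> 0" "b \<ge> 0" for a b :: real
    using sum_squares_bound[of a b] mult_nonneg_nonneg[OF that] by linarith
  then show "AE x in lborel. norm (f x * g x) \<le> norm ((cmod (f x))\<^sup>2 + (cmod (g x))\<^sup>2)"
    by (auto simp: norm_mult)
qed

lemma integral_diff_mult_L2:
  assumes "f \<in> Lp_space 2" "g \<in> Lp_space 2" "h \<in> Lp_space 2"
  shows "(LINT x|lborel. (f x - g x) * h x) = (LINT x|lborel. f x * h x) - (LINT x|lborel. g x * h x)"
  using Bochner_Integration.integral_diff[OF integrable_mult_L2[OF assms(1,3)] integrable_mult_L2[OF assms(2,3)]]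
  by (simp add: left_diff_distrib)

text \<open>The Cauchy--Schwarz inequality for the bilinear pairing by which functions act as distributions.\<close>

lemma integral_mult_L2_le:
  assumes f: "f \<in> Lp_space 2" and g: "g \<in> Lp_space 2"
  shows "cmod (LINT x|lborel. f x * g x) \<le> sqrt (enn2real (l2sq f)) * sqrt (enn2real (l2sq g))"
proof -
  note [measurable] = Lp_space_2_measurable[OF f] Lp_space_2_measurable[OF g]
  have fin: "l2sq f < \<infinity>" "l2sq g < \<infinity>" using f g by (auto simp: Lp_space_2_iff)
  have "ennreal (cmod (LINT x|lborel. f x * g x)) \<le> (\<integral>\<^sup>+x. norm (f x * g x) \<partial>lborel)"
    by (intro integral_norm_bound_ennreal integrable_mult_L2 f g)
  then have "ennreal ((cmod (LINT x|lborel. f x * g x))\<^sup>2) \<le> (\<integral>\<^sup>+x. norm (f x * g x) \<partial>lborel)\<^sup>2"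
    by (simp add: ennreal_power[symmetric] power_mono)
  also have "(\<integral>\<^sup>+x. norm (f x * g x) \<partial>lborel) = (\<integral>\<^sup>+x. ennreal (cmod (f x)) * ennreal (cmod (g x)) \<partial>lborel)"
    by (simp add: norm_mult ennreal_mult)
  also have "\<dots>\<^sup>2 \<le> (\<integral>\<^sup>+x. ennreal (cmod (f x)) ^ 2 \<partial>lborel) * (\<integral>\<^sup>+x. ennreal (cmod (g x)) ^ 2 \<partial>lborel)"
    by (rule Cauchy_Schwarz_nn_integral) auto
  also have "\<dots> = l2sq f * l2sq g"
    by (simp add: l2sq_def ennreal_power)
  also have "\<dots> = ennreal (enn2real (l2sq f) * enn2real (l2sq g))"
    using fin by (simp add: ennreal_mult)
  finally have "(cmod (LINT x|lborel. f x * g x))\<^sup>2 \<le> enn2real (l2sq f) * enn2real (l2sq g)"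
    by (subst (asm) ennreal_le_iff) auto
  then show ?thesis
    by (simp add: real_sqrt_mult[symmetric] real_le_rsqrt)
qed

lemma ennreal_term_le_suminf: "f j \<le> (\<Sum>j. f j)" for f :: "nat \<Rightarrow> ennreal"
  using sum_le_suminf[of f "{j}"] by simp

lemma l2sq_Fatou:
  fixes v :: "nat \<Rightarrow> 'a::euclidean_space \<Rightarrow> complex"
  assumes [measurable]: "\<And>i. v i \<in> borel_measurable borel"
    and lim: "AE x in lborel. (\<lambda>i. v i x) \<longlonglongrightarrow> w x"
    and le: "\<And>i. l2sq (v i) \<le> B"
  shows "l2sq w \<le> B"
proof -
  have "l2sq w \<le> (\<integral>\<^sup>+x. liminf (\<lambda>i. ennreal ((cmod (v i x))\<^sup>2)) \<partial>lborel)"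
    unfolding l2sq_def
  proof (intro nn_integral_mono_AE, use lim in eventually_elim)
    case (elim x)
    then have "(\<lambda>i. ennreal ((cmod (v i x))\<^sup>2)) \<longlonglongrightarrow> ennreal ((cmod (w x))\<^sup>2)"
      by (intro tendsto_intros tendsto_ennrealI)
    then show ?case by (simp only: lim_imp_Liminf[OF sequentially_bot] order_refl)
  qed
  also have "\<dots> \<le> liminf (\<lambda>i. l2sq (v i))"
    unfolding l2sq_def by (rule nn_integral_liminf) auto
  also have "\<dots> \<le> liminf (\<lambda>i::nat. B)"
    by (intro Liminf_mono always_eventually allI le)
  also have "\<dots> = B" by (simp add: Liminf_const)
  finally show ?thesis .
qed

text \<open>Completeness of the space of square-integrable functions, for sequences of a fixed geometric rate. The
  increments have squared norms of order \<open>8\<^sup>-\<^sup>j\<close>, so the function \<open>S = \<Sum>j. 2\<^sup>j \<bar>v\<^sub>j\<^sub>+\<^sub>1 - v\<^sub>j\<bar>\<^sup>2\<close> is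
  integrable. Wherever it is finite the increments are of order \<open>2\<^sup>-\<^sup>j\<^sup>/\<^sup>2\<close>, hence summable, and the
  sequence converges pointwise; Fatou's lemma carries the distances over to the limit.\<close>

lemma L2_limit_exists:
  fixes v :: "nat \<Rightarrow> 'a::euclidean_space \<Rightarrow> complex"
  assumes [measurable]: "\<And>j. v j \<in> borel_measurable borel"
    and dist: "\<And>i j. j \<le> i \<Longrightarrow> l2sq (\<lambda>x. v i x - v j x) \<le> ennreal (C * (1/8) ^ j)"
  obtains w where "w \<in> borel_measurable borel" "AE x in lborel. (\<lambda>j. v j x) \<longlonglongrightarrow> w x"
    "\<And>j. l2sq (\<lambda>x. w x - v j x) \<le> ennreal (C * (1/8) ^ j)"
proof
  let ?w = "\<lambda>x. lim (\<lambda>j. v j x)"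
  show meas[measurable]: "?w \<in> borel_measurable borel" by measurable
  define S where "S x = (\<Sum>j. ennreal (2 ^ j * (cmod (v (Suc j) x - v j x))\<^sup>2))" for x
  have [measurable]: "S \<in> borel_measurable borel" unfolding S_def by measurable
  have "(\<integral>\<^sup>+x. S x \<partial>lborel) = (\<Sum>j. \<integral>\<^sup>+x. ennreal (2 ^ j * (cmod (v (Suc j) x - v j x))\<^sup>2) \<partial>lborel)"
    unfolding S_def by (rule nn_integral_suminf) auto
  also have "\<dots> \<le> (\<Sum>j. ennreal (\<bar>C\<bar> * (1/4) ^ j))"
  proof (intro suminf_le allI)
    fix j
    have "(\<integral>\<^sup>+x. ennreal (2 ^ j * (cmod (v (Suc j) x - v j x))\<^sup>2) \<partial>lborel)
        = ennreal (2 ^ j) * l2sq (\<lambda>x. v (Suc j) x - v j x)"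
      unfolding l2sq_def by (subst nn_integral_cmult[symmetric]) (auto simp: ennreal_mult)
    also have "\<dots> \<le> ennreal (2 ^ j) * ennreal (\<bar>C\<bar> * (1/8) ^ j)"
      by (intro mult_left_mono order.trans[OF dist] ennreal_leI mult_right_mono) auto
    also have "\<dots> = ennreal (\<bar>C\<bar> * (1/4) ^ j)"
    proof -
      have "(2::real) ^ j * (\<bar>C\<bar> * (1/8) ^ j) = \<bar>C\<bar> * (2 * (1/8)) ^ j"
        by (subst power_mult_distrib) simp
      then show ?thesis by (subst ennreal_mult[symmetric]) auto
    qed
    finally show "(\<integral>\<^sup>+x. ennreal (2 ^ j * (cmod (v (Suc j) x - v j x))\<^sup>2) \<partial>lborel) \<le> ennreal (\<bar>C\<bar> * (1/4) ^ j)" .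
  qed auto
  also have "\<dots> < \<infinity>"
  proof -
    have "summable (\<lambda>j. \<bar>C\<bar> * (1/4::real) ^ j)" by (intro summable_mult summable_geometric) auto
    then show ?thesis by (subst suminf_ennreal2) auto
  qed
  finally have "AE x in lborel. S x \<noteq> \<infinity>"
    by (intro nn_integral_PInf_AE) auto
  then show lim: "AE x in lborel. (\<lambda>j. v j x) \<longlonglongrightarrow> ?w x"
  proof (rule AE_mp, intro AE_I2 impI)
    fix x assume "S x \<noteq> \<infinity>"
    define B where "B = enn2real (S x)"
    have B: "S x = ennreal B" "B \<ge> 0"
      using \<open>S x \<noteq> \<infinity>\<close> by (auto simp: B_def less_top)
    let ?d = "\<lambda>j. v (Suc j) x - v j x"
    have bd: "cmod (?d j) \<le> sqrt B * (1 / sqrt 2) ^ j" for j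
    proof -
      have "ennreal (2 ^ j * (cmod (?d j))\<^sup>2) \<le> S x"
        unfolding S_def by (rule ennreal_term_le_suminf)
      then have "2 ^ j * (cmod (?d j))\<^sup>2 \<le> B" using B by (simp add: ennreal_le_iff)
      then have "(cmod (?d j))\<^sup>2 \<le> B / 2 ^ j" by (simp add: field_simps)
      then have "cmod (?d j) \<le> sqrt (B / 2 ^ j)" by (rule real_le_rsqrt)
      then show ?thesis by (simp add: real_sqrt_divide real_sqrt_power power_one_over)
    qed
    have "summable (\<lambda>j. sqrt B * (1 / sqrt 2) ^ j)" by (intro summable_mult summable_geometric) auto
    then have "summable ?d" by (rule summable_comparison_test') (use bd in auto)
    then have "(\<lambda>n. \<Sum>j<n. ?d j) \<longlonglongrightarrow> suminf ?d" by (rule summable_LIMSEQ)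
    then have "(\<lambda>n. v n x - v 0 x) \<longlonglongrightarrow> suminf ?d" by (simp only: sum_lessThan_telescope[of "\<lambda>n. v n x"])
    then have "(\<lambda>n. (v n x - v 0 x) + v 0 x) \<longlonglongrightarrow> suminf ?d + v 0 x" by (intro tendsto_intros)
    then show "(\<lambda>j. v j x) \<longlonglongrightarrow> ?w x" by (simp add: convergent_LIMSEQ_iff[symmetric] convergentI)
  qed
  fix j
  show "l2sq (\<lambda>x. ?w x - v j x) \<le> ennreal (C * (1/8) ^ j)"
  proof (rule l2sq_Fatou)
    show "AE x in lborel. (\<lambda>i. v (i + j) x - v j x) \<longlonglongrightarrow> ?w x - v j x"
      using lim by eventually_elim (intro tendsto_intros LIMSEQ_ignore_initial_segment)
    show "l2sq (\<lambda>x. v (i + j) x - v j x) \<le> ennreal (C * (1/8) ^ j)" for i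
      by (rule dist) simp
  qed measurable
qed

section \<open>Integrals of truncated radial powers\<close>

lemma mult_indicator_has_integral:
  fixes f :: "real \<Rightarrow> real"
  shows "((\<lambda>t. f t * indicator A t) has_integral I) UNIV \<longleftrightarrow> (f has_integral I) A"
proof -
  have "(\<lambda>t. f t * indicator A t) = (\<lambda>t. if t \<in> A then f t else 0)"
    by (auto simp: indicator_def)
  then show ?thesis by (simp add: has_integral_restrict_UNIV)
qed

text \<open>The integrand is \<open>\<rho>\<^sup>2 t\<^bsup>1 - 2 s\<^esup>\<close> below \<open>1 / \<rho>\<close> and \<open>t\<^bsup>- 2 s - 1\<^esup>\<close> above. Integrability at the
  origin is the condition \<open>s < 1\<close>, integrability at infinity the condition \<open>s > 0\<close>.\<close>

lemma nn_integral_truncated_power: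
  fixes s \<rho> :: real
  assumes s: "0 < s" "s < 1" and \<rho>: "0 < \<rho>"
  shows "(\<integral>\<^sup>+t. ennreal (min 1 ((\<rho> * t)\<^sup>2) * t powr (- 2 * s - 1)) * indicator {0<..} t \<partial>lborel)
    \<le> ennreal ((1 / (2 - 2 * s) + 1 / (2 * s)) * \<rho> powr (2 * s))"
proof -
  let ?c = "1 / \<rho>"
  have "((\<lambda>t. t powr (1 - 2 * s)) has_integral (?c powr (1 - 2 * s + 1) / (1 - 2 * s + 1))) {0..?c}"
    using s \<rho> by (intro has_integral_powr_from_0) auto
  then have "((\<lambda>t. \<rho>\<^sup>2 * t powr (1 - 2 * s)) has_integral (\<rho>\<^sup>2 * (?c powr (1 - 2 * s + 1) / (1 - 2 * s + 1)))) {0..?c}"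
    by (rule has_integral_mult_right)
  then have 1: "(\<integral>\<^sup>+t. ennreal (\<rho>\<^sup>2 * t powr (1 - 2 * s) * indicator {0..?c} t) \<partial>lborel)
      = ennreal (\<rho>\<^sup>2 * (?c powr (1 - 2 * s + 1) / (1 - 2 * s + 1)))"
    by (intro nn_integral_has_integral_lborel)
       (simp_all add: mult_indicator_has_integral)
  have "((\<lambda>t. t powr (- 2 * s - 1)) has_integral -(?c powr (- 2 * s - 1 + 1)) / (- 2 * s - 1 + 1)) {?c..}"
    using s \<rho> by (intro has_integral_powr_to_inf) auto
  then have 2: "(\<integral>\<^sup>+t. ennreal (t powr (- 2 * s - 1) * indicator {?c..} t) \<partial>lborel)
      = ennreal (-(?c powr (- 2 * s - 1 + 1)) / (- 2 * s - 1 + 1))"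
    by (intro nn_integral_has_integral_lborel)
       (simp_all add: mult_indicator_has_integral)
  have "(\<integral>\<^sup>+t. ennreal (min 1 ((\<rho> * t)\<^sup>2) * t powr (- 2 * s - 1)) * indicator {0<..} t \<partial>lborel)
    \<le> (\<integral>\<^sup>+t. ennreal (\<rho>\<^sup>2 * t powr (1 - 2 * s) * indicator {0..?c} t) + ennreal (t powr (- 2 * s - 1) * indicator {?c..} t) \<partial>lborel)"
  proof (intro nn_integral_mono)
    fix t :: real
    have "t\<^sup>2 * t powr (- 2 * s - 1) = t powr (1 - 2 * s)" if "t > 0"
      using that by (simp add: powr_numeral[symmetric] powr_add[symmetric] del: powr_numeral)
    then have e: "(\<rho> * t)\<^sup>2 * t powr (- 2 * s - 1) = \<rho>\<^sup>2 * t powr (1 - 2 * s)" if "t > 0"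
      using that by (simp add: power_mult_distrib mult.assoc)
    consider "t \<le> 0" | "0 < t" "t \<le> ?c" | "?c \<le> t" "0 < t" by linarith
    then show "ennreal (min 1 ((\<rho> * t)\<^sup>2) * t powr (- 2 * s - 1)) * indicator {0<..} t
      \<le> ennreal (\<rho>\<^sup>2 * t powr (1 - 2 * s) * indicator {0..?c} t) + ennreal (t powr (- 2 * s - 1) * indicator {?c..} t)"
    proof cases
      case 2
      then have "min 1 ((\<rho> * t)\<^sup>2) * t powr (- 2 * s - 1) \<le> \<rho>\<^sup>2 * t powr (1 - 2 * s)"
        using e by (metis min.cobounded2 mult_right_mono powr_ge_zero)
      then show ?thesis using 2 by (intro add_increasing2) (auto intro!: ennreal_leI)
    next
      case 3
      have "min 1 ((\<rho> * t)\<^sup>2) * t powr (- 2 * s - 1) \<le> t powr (- 2 * s - 1)"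
        by (simp add: mult_left_le_one_le)
      then show ?thesis using 3 by (intro add_increasing) (auto intro!: ennreal_leI)
    qed auto
  qed
  also have "\<dots> = ennreal (\<rho>\<^sup>2 * (?c powr (1 - 2 * s + 1) / (1 - 2 * s + 1))) + ennreal (-(?c powr (- 2 * s - 1 + 1)) / (- 2 * s - 1 + 1))"
    by (subst nn_integral_add) (simp_all only: 1 2, measurable)
  also have "\<dots> = ennreal (\<rho>\<^sup>2 * (?c powr (1 - 2 * s + 1) / (1 - 2 * s + 1)) + (?c powr (- 2 * s)) / (2 * s))"
    using s \<rho> by (subst ennreal_plus[symmetric]) auto
  also have "\<rho>\<^sup>2 * (?c powr (1 - 2 * s + 1) / (1 - 2 * s + 1)) + (?c powr (- 2 * s)) / (2 * s)
     = (1 / (2 - 2 * s) + 1 / (2 * s)) * \<rho> powr (2 * s)"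
  proof -
    have "?c powr a = \<rho> powr (- a)" for a
      using \<rho> by (simp add: powr_minus powr_divide inverse_eq_divide)
    moreover have "\<rho>\<^sup>2 = \<rho> powr 2" using \<rho> by simp
    ultimately have "\<rho>\<^sup>2 * ?c powr (1 - 2 * s + 1) = \<rho> powr (2 * s)"
      by (simp add: powr_add[symmetric] del: powr_numeral)
    then show ?thesis using \<rho> s by (simp add: field_simps powr_minus powr_divide)
  qed
  finally show ?thesis .
qed


text \<open>A substitute for polar coordinates. The radial profile
  \<open>\<psi> r = min 1 ((\<rho> r)\<^sup>2) / r\<^bsup>n + 2 s\<^esup>\<close> is at most a constant times the integral of \<open>\<psi> t / t\<close> over
  \<open>r \<le> t \<le> 2 r\<close>, a fortiori over \<open>r \<le> t\<close>. After the integrals are exchanged, the condition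
  \<open>norm h \<le> t\<close> turns the inner one into the volume of a ball, which is a multiple of \<open>t\<^sup>n\<close>, and the
  one-dimensional integral above remains. The power of \<open>\<rho>\<close> is the one that scaling dictates.\<close>

lemma nn_integral_radial_truncated_power:
  fixes s :: real
  assumes s: "0 < s" "s < 1"
  shows "\<exists>C\<ge>0. \<forall>\<rho>>0. (\<integral>\<^sup>+(h::'a::euclidean_space). ennreal (min 1 ((\<rho> * norm h)\<^sup>2) / norm h powr (real DIM('a) + 2 * s)) \<partial>lborel)
     \<le> ennreal (C * \<rho> powr (2 * s))"
proof -
  define n where "n = real DIM('a)"
  define V where "V = unit_ball_vol n"
  \<comment> \<open>\<open>D\<close> makes up for replacing \<open>t\<close> by its largest value \<open>2 * norm h\<close> in the negative power of \<open>g\<close> below.\<close>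
  define D where "D = 2 powr (n + 2 * s + 1)"
  define E where "E = 1 / (2 - 2 * s) + 1 / (2 * s)"
  have V: "V \<ge> 0" by (simp add: V_def n_def)
  have E: "E \<ge> 0" using s by (simp add: E_def)
  have "(\<integral>\<^sup>+(h::'a). ennreal (min 1 ((\<rho> * norm h)\<^sup>2) / norm h powr (n + 2 * s)) \<partial>lborel)
     \<le> ennreal (D * V * E * \<rho> powr (2 * s))" if \<rho>: "\<rho> > 0" for \<rho>
  proof -
    define g where "g t = min 1 ((\<rho> * t)\<^sup>2) * t powr (- n - 2 * s - 1)" for t :: real
    have [measurable]: "g \<in> borel_measurable borel" unfolding g_def by measurable
    have g0: "g t \<ge> 0" for t by (simp add: g_def)
    have "(\<integral>\<^sup>+(h::'a). ennreal (min 1 ((\<rho> * norm h)\<^sup>2) / norm h powr (n + 2 * s)) \<partial>lborel)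
      \<le> (\<integral>\<^sup>+(h::'a). ennreal D * (\<integral>\<^sup>+t. ennreal (g t) * indicator {0<..} t * indicator {h. norm h \<le> t} h \<partial>lborel) \<partial>lborel)"
    proof (intro nn_integral_mono)
      fix h :: 'a
      show "ennreal (min 1 ((\<rho> * norm h)\<^sup>2) / norm h powr (n + 2 * s))
        \<le> ennreal D * (\<integral>\<^sup>+t. ennreal (g t) * indicator {0<..} t * indicator {h. norm h \<le> t} h \<partial>lborel)"
      proof (cases "h = 0")
        case False
        define r where "r = norm h"
        have r: "r > 0" using False by (simp add: r_def)
        define m where "m = min 1 ((\<rho> * r)\<^sup>2) * (2 * r) powr (- n - 2 * s - 1)"
        have m0: "m \<ge> 0" by (simp add: m_def)
        have "ennreal (m * r) = (\<integral>\<^sup>+t. ennreal m * indicator {r..2*r} t \<partial>lborel)"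
          using r m0 by (subst nn_integral_cmult_indicator) (auto simp: ennreal_mult)
        also have "\<dots> \<le> (\<integral>\<^sup>+t. ennreal (g t) * indicator {0<..} t * indicator {h. norm h \<le> t} h \<partial>lborel)"
        proof (intro nn_integral_mono)
          fix t :: real
          have "m \<le> g t" if "r \<le> t" "t \<le> 2 * r"
            unfolding m_def g_def
            using that r \<rho> s by (intro mult_mono min.mono power_mono powr_mono2') (auto simp: n_def)
          then show "ennreal m * indicator {r..2*r} t \<le> ennreal (g t) * indicator {0<..} t * indicator {h. norm h \<le> t} h"
            using r unfolding r_def by (auto simp: indicator_def simp del: zero_less_norm_iff intro!: ennreal_leI)
        qed
        finally have 1: "ennreal (m * r) \<le> \<dots>" .
        have "(2 * r) powr (- n - 2 * s - 1) * r * D = 1 / r powr (n + 2 * s)"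
        proof -
          have "(2 * r) powr (- n - 2 * s - 1) = (2 * r) powr (- (n + 2 * s + 1))"
            by (intro arg_cong2[where f="(powr)"]) auto
          also have "\<dots> = inverse (2 powr (n + 2 * s + 1) * r powr (n + 2 * s + 1))"
            using r by (simp only: powr_minus powr_mult)
          also have "r powr (n + 2 * s + 1) = r powr (n + 2 * s) * r"
            using r by (simp only: powr_add powr_one)
          also have "inverse (2 powr (n + 2 * s + 1) * \<dots>) = 1 / (D * r powr (n + 2 * s) * r)"
            unfolding D_def by (simp add: inverse_eq_divide)
          finally show ?thesis using r by (simp add: D_def)
        qed
        then have "min 1 ((\<rho> * r)\<^sup>2) / r powr (n + 2 * s)
            = min 1 ((\<rho> * r)\<^sup>2) * ((2 * r) powr (- n - 2 * s - 1) * r * D)"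
          by simp
        also have "\<dots> = D * (m * r)"
          unfolding m_def by (simp only: mult_ac)
        finally have "min 1 ((\<rho> * r)\<^sup>2) / r powr (n + 2 * s) = D * (m * r)" .
        then have "ennreal (min 1 ((\<rho> * r)\<^sup>2) / r powr (n + 2 * s)) = ennreal D * ennreal (m * r)"
          using m0 r by (simp add: ennreal_mult D_def)
        also have "\<dots> \<le> ennreal D * (\<integral>\<^sup>+t. ennreal (g t) * indicator {0<..} t * indicator {h. norm h \<le> t} h \<partial>lborel)"
          by (intro mult_left_mono 1) auto
        finally show ?thesis by (simp add: r_def)
      qed simp
    qed
    also have "\<dots> = ennreal D * (\<integral>\<^sup>+(h::'a). \<integral>\<^sup>+t. ennreal (g t) * indicator {0<..} t * indicator {(h, t). norm h \<le> t} (h, t) \<partial>lborel \<partial>lborel)"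
      by (subst nn_integral_cmult) (auto simp: indicator_def)
    also have "(\<integral>\<^sup>+(h::'a). \<integral>\<^sup>+t. ennreal (g t) * indicator {0<..} t * indicator {(h, t). norm h \<le> t} (h, t) \<partial>lborel \<partial>lborel)
      = (\<integral>\<^sup>+t. \<integral>\<^sup>+(h::'a). ennreal (g t) * indicator {0<..} t * indicator {(h, t). norm h \<le> t} (h, t) \<partial>lborel \<partial>lborel)"
      by (rule lborel_pair.Fubini') measurable
    also have "\<dots> = (\<integral>\<^sup>+t. ennreal V * (ennreal (min 1 ((\<rho> * t)\<^sup>2) * t powr (- 2 * s - 1)) * indicator {0<..} t) \<partial>lborel)"
    proof (intro nn_integral_cong)
      fix t :: real
      show "(\<integral>\<^sup>+(h::'a). ennreal (g t) * indicator {0<..} t * indicator {(h, t). norm h \<le> t} (h, t) \<partial>lborel)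
        = ennreal V * (ennreal (min 1 ((\<rho> * t)\<^sup>2) * t powr (- 2 * s - 1)) * indicator {0<..} t)"
      proof (cases "t > 0")
        case True
        have "(\<integral>\<^sup>+(h::'a). ennreal (g t) * indicator {0<..} t * indicator {(h, t). norm h \<le> t} (h, t) \<partial>lborel)
          = (\<integral>\<^sup>+(h::'a). ennreal (g t) * indicator (cball 0 t) h \<partial>lborel)"
          using True by (intro nn_integral_cong) (auto simp: indicator_def)
        also have "\<dots> = ennreal (g t) * emeasure lborel (cball (0::'a) t)"
          by (rule nn_integral_cmult_indicator) auto
        also have "\<dots> = ennreal (g t * (V * t powr n))"
          using True V g0 by (simp add: emeasure_cball V_def n_def powr_realpow ennreal_mult)
        also have "g t * (V * t powr n) = V * (min 1 ((\<rho> * t)\<^sup>2) * t powr (- 2 * s - 1))"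
        proof -
          have "t powr (- n - 2 * s - 1) * t powr n = t powr (- 2 * s - 1)"
            by (simp add: powr_add[symmetric])
          then show ?thesis by (simp add: g_def algebra_simps)
        qed
        finally show ?thesis using True V by (simp add: ennreal_mult)
      qed simp
    qed
    also have "\<dots> \<le> ennreal V * ennreal (E * \<rho> powr (2 * s))"
      unfolding E_def
      by (subst nn_integral_cmult, measurable) (intro mult_left_mono nn_integral_truncated_power[OF s \<rho>], simp)
    also have "ennreal D * (ennreal V * ennreal (E * \<rho> powr (2 * s))) = ennreal (D * V * E * \<rho> powr (2 * s))"
      using V E by (simp add: ennreal_mult[symmetric] D_def mult.assoc)
    finally show ?thesis by (simp add: mult_left_mono)
  qed
  then show ?thesis
    unfolding n_def[symmetric] using V E by (intro exI[of _ "D * V * E"]) (auto simp: D_def)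
qed

text \<open>Outside the unit ball the function is below \<open>norm x\<close> to the power \<open>- n - 1\<close>, which is the profile of the
  preceding lemma for \<open>s = 1/2\<close> and \<open>\<rho> = 1\<close>.\<close>

lemma integrable_inverse_power:
  "integrable lborel (\<lambda>x::'a::euclidean_space. inverse ((1 + norm x) ^ Suc DIM('a)))"
proof (rule integrableI_nonneg)
  let ?n = "real DIM('a)"
  obtain C where C: "(\<integral>\<^sup>+(h::'a). ennreal (min 1 ((1 * norm h)\<^sup>2) / norm h powr (?n + 2 * (1/2))) \<partial>lborel)
     \<le> ennreal (C * 1 powr (2 * (1/2)))"
  proof -
    have "0 < (1/2 :: real)" "(1/2 :: real) < 1" by simp_all
    from nn_integral_radial_truncated_power[OF this, where 'a='a]
    obtain C where "\<forall>\<rho>>0. (\<integral>\<^sup>+(h::'a). ennreal (min 1 ((\<rho> * norm h)\<^sup>2) / norm h powr (?n + 2 * (1/2))) \<partial>lborel)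
     \<le> ennreal (C * \<rho> powr (2 * (1/2)))" by blast
    from that[OF this[rule_format, OF zero_less_one]] show ?thesis .
  qed
  have "(\<integral>\<^sup>+(x::'a). ennreal (inverse ((1 + norm x) ^ Suc DIM('a))) \<partial>lborel)
    \<le> (\<integral>\<^sup>+(x::'a). indicator (cball 0 1) x + ennreal (min 1 ((1 * norm x)\<^sup>2) / norm x powr (?n + 2 * (1/2))) \<partial>lborel)"
  proof (intro nn_integral_mono)
    fix x :: 'a
    show "ennreal (inverse ((1 + norm x) ^ Suc DIM('a)))
      \<le> indicator (cball 0 1) x + ennreal (min 1 ((1 * norm x)\<^sup>2) / norm x powr (?n + 2 * (1/2)))"
    proof (cases "norm x \<le> 1")
      case True
      have "inverse ((1 + norm x) ^ Suc DIM('a)) \<le> 1"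
        by (intro inverse_le_1_iff[THEN iffD2] disjI2 one_le_power) auto
      then show ?thesis using True by (intro add_increasing2) (auto simp del: power_Suc)
    next
      case False
      then have m: "min 1 ((1 * norm x)\<^sup>2) = 1" by (simp add: one_le_power min_def)
      have "norm x powr (?n + 2 * (1/2)) = norm x powr (real (Suc DIM('a)))" by (simp add: add.commute)
      also have "\<dots> = norm x ^ Suc DIM('a)" using False by (subst powr_realpow) auto
      finally have p: "norm x powr (?n + 2 * (1/2)) = norm x ^ Suc DIM('a)" .
      have "inverse ((1 + norm x) ^ Suc DIM('a)) \<le> inverse (norm x ^ Suc DIM('a))"
        using False by (intro le_imp_inverse_le power_mono zero_less_power) auto
      then show ?thesis unfolding m p by (intro add_increasing) (auto simp: inverse_eq_divide simp del: power_Suc intro!: ennreal_leI)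
    qed
  qed
  also have "\<dots> = emeasure lborel (cball (0::'a) 1)
     + (\<integral>\<^sup>+(x::'a). ennreal (min 1 ((1 * norm x)\<^sup>2) / norm x powr (?n + 2 * (1/2))) \<partial>lborel)"
    by (subst nn_integral_add) (auto intro!: borel_measurable_indicator)
  also have "\<dots> < \<infinity>"
    using le_less_trans[OF C ennreal_less_top] emeasure_lborel_cball_finite[of "0::'a" 1]
    by (simp add: less_top)
  finally show "(\<integral>\<^sup>+(x::'a). ennreal (inverse ((1 + norm x) ^ Suc DIM('a))) \<partial>lborel) < \<infinity>" .
qed auto


section \<open>Schwartz functions and their multipliers\<close>

lemma partial_deriv_eqI:
  assumes "(f has_derivative f') (at x)"
  shows "partial_deriv i f x = f' (axis i 1)"
  unfolding partial_deriv_def using frechet_derivative_at[OF assms] by simp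

lemma has_derivative_frechet:
  "f differentiable (at x) \<Longrightarrow> (f has_derivative frechet_derivative f (at x)) (at x)"
  by (simp add: frechet_derivative_works)

lemma iter_partial_deriv_Nil [simp]: "iter_partial_deriv [] f = f"
  and iter_partial_deriv_Cons: "iter_partial_deriv (i # \<alpha>) f = partial_deriv i (iter_partial_deriv \<alpha> f)"
  and iter_partial_deriv_snoc: "iter_partial_deriv (\<alpha> @ [i]) f = iter_partial_deriv \<alpha> (partial_deriv i f)"
  by (simp_all add: iter_partial_deriv_def)

lemma schwartz_differentiable: "f \<in> schwartz \<Longrightarrow> f differentiable (at x)"
  unfolding schwartz_def smooth_def by (auto dest!: spec[of _ "[]"])

lemma schwartz_partial_deriv: "f \<in> schwartz \<Longrightarrow> partial_deriv i f \<in> schwartz"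
  by (auto simp: schwartz_def smooth_def iter_partial_deriv_snoc[symmetric])

lemma schwartz_decay: "f \<in> schwartz \<Longrightarrow> bounded (range (\<lambda>x. norm x ^ k *\<^sub>R f x))"
  unfolding schwartz_def by (auto dest!: spec[of _ "[]"])

text \<open>Iterated derivatives need never be computed: if a set of functions is stable under partial derivatives,
  then every iterated derivative of a member is again a member, and only the members themselves have to be
  estimated. Each proof that some function is Schwartz consists in exhibiting such a set.\<close>

lemma schwartz_coinduct:
  assumes "f \<in> X"
    and d: "\<And>f x. f \<in> X \<Longrightarrow> f differentiable (at x)"
    and p: "\<And>f i. f \<in> X \<Longrightarrow> partial_deriv i f \<in> X"
    and b: "\<And>f k. f \<in> X \<Longrightarrow> bounded (range (\<lambda>x. norm x ^ k *\<^sub>R f x))"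
  shows "f \<in> schwartz"
proof -
  have "iter_partial_deriv \<alpha> f \<in> X" for \<alpha>
    by (induction \<alpha>) (auto simp: iter_partial_deriv_Cons p \<open>f \<in> X\<close>)
  then show ?thesis using d b by (auto simp: schwartz_def smooth_def)
qed

text \<open>The smooth functions of slow increase, often written \<open>\<O>\<^sub>M\<close>. They are the functions by which the
  Schwartz space, and hence tempered distributions, can be multiplied.\<close>

definition multiplier :: "(real^'n \<Rightarrow> complex) set" where
  "multiplier = {g. smooth g \<and> (\<forall>\<alpha>. \<exists>C N. \<forall>x. cmod (iter_partial_deriv \<alpha> g x) \<le> C * (1 + norm x) ^ N)}"

lemma multiplier_differentiable: "f \<in> multiplier \<Longrightarrow> f differentiable (at x)"
  unfolding multiplier_def smooth_def by (auto dest!: spec[of _ "[]"])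

lemma multiplier_partial_deriv: "f \<in> multiplier \<Longrightarrow> partial_deriv i f \<in> multiplier"
  by (auto simp: multiplier_def smooth_def iter_partial_deriv_snoc[symmetric])

lemma multiplier_growth: "f \<in> multiplier \<Longrightarrow> \<exists>C N. \<forall>x. cmod (f x) \<le> C * (1 + norm x) ^ N"
  unfolding multiplier_def by (auto dest!: spec[of _ "[]"]) blast

lemma multiplier_coinduct:
  assumes "f \<in> X"
    and d: "\<And>f x. f \<in> X \<Longrightarrow> f differentiable (at x)"
    and p: "\<And>f i. f \<in> X \<Longrightarrow> partial_deriv i f \<in> X"
    and b: "\<And>f. f \<in> X \<Longrightarrow> \<exists>C N. \<forall>x. cmod (f x) \<le> C * (1 + norm x) ^ N"
  shows "f \<in> multiplier"
proof -
  have "iter_partial_deriv \<alpha> f \<in> X" for \<alpha>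
    by (induction \<alpha>) (auto simp: iter_partial_deriv_Cons p \<open>f \<in> X\<close>)
  then show ?thesis using d b by (auto simp: multiplier_def smooth_def)
qed

lemma one_plus_power_le:
  fixes r :: real
  assumes "0 \<le> r"
  shows "(1 + r) ^ N \<le> 2 ^ N * (1 + r ^ N)"
proof -
  have "(1 + r) ^ N \<le> (2 * max 1 r) ^ N"
    using assms by (intro power_mono) auto
  also have "\<dots> \<le> 2 ^ N * (1 + r ^ N)"
    using assms by (auto simp: power_mult_distrib max_def)
  finally show ?thesis .
qed

text \<open>The weights \<open>norm x ^ k\<close> of the definition vanish at the origin. The weights \<open>(1 + norm x) ^ N\<close> are
  bounded away from zero and give pointwise bounds on the whole space.\<close>

lemma decay_iff:
  fixes f :: "real^'n \<Rightarrow> complex"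
  shows "(\<forall>k. bounded (range (\<lambda>x. norm x ^ k *\<^sub>R f x))) \<longleftrightarrow> (\<forall>N. \<exists>C. \<forall>x. (1 + norm x) ^ N * cmod (f x) \<le> C)"
proof safe
  fix N assume *: "\<forall>k. bounded (range (\<lambda>x. norm x ^ k *\<^sub>R f x))"
  obtain B0 where B0: "\<And>x. cmod (f x) \<le> B0"
    using *[rule_format, of 0] unfolding bounded_iff by auto
  obtain BN where BN: "\<And>x. norm x ^ N * cmod (f x) \<le> BN"
    using *[rule_format, of N] unfolding bounded_iff by auto
  have "(1 + norm x) ^ N * cmod (f x) \<le> 2 ^ N * B0 + 2 ^ N * BN" for x
  proof -
    have "(1 + norm x) ^ N * cmod (f x) \<le> 2 ^ N * (1 + norm x ^ N) * cmod (f x)"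
      by (rule mult_right_mono[OF one_plus_power_le]) auto
    also have "\<dots> = 2 ^ N * cmod (f x) + 2 ^ N * (norm x ^ N * cmod (f x))" by (simp add: algebra_simps)
    also have "\<dots> \<le> 2 ^ N * B0 + 2 ^ N * BN"
      by (intro add_mono mult_left_mono B0 BN) auto
    finally show ?thesis .
  qed
  then show "\<exists>C. \<forall>x. (1 + norm x) ^ N * cmod (f x) \<le> C" by blast
next
  fix k assume *: "\<forall>N. \<exists>C. \<forall>x. (1 + norm x) ^ N * cmod (f x) \<le> C"
  then obtain C where C: "\<And>x. (1 + norm x) ^ k * cmod (f x) \<le> C" by blast
  have "norm x ^ k * cmod (f x) \<le> C" for x
    by (rule order.trans[OF mult_right_mono C]) (auto intro: power_mono)
  then show "bounded (range (\<lambda>x. norm x ^ k *\<^sub>R f x))"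
    by (intro boundedI[of _ C]) auto
qed

lemma schwartz_decay_weighted: "f \<in> schwartz \<Longrightarrow> \<exists>C. \<forall>x. (1 + norm x) ^ N * cmod (f x) \<le> C"
  using schwartz_decay decay_iff by blast

lemma schwartz_decay_bound:
  assumes "f \<in> schwartz"
  obtains C where "C \<ge> 0" "\<And>x. cmod (f x) \<le> C * inverse ((1 + norm x) ^ N)"
proof -
  obtain C where C: "\<And>x. (1 + norm x) ^ N * cmod (f x) \<le> C" using schwartz_decay_weighted[OF assms] by blast
  have "cmod (f x) \<le> C * inverse ((1 + norm x) ^ N)" for x
  proof -
    have "1 + norm x > 0" by (rule add_pos_nonneg) auto
    then show ?thesis using C[of x] by (simp add: field_simps)
  qed
  moreover have "C \<ge> 0" using order.trans[OF _ C[of 0]] by simp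
  ultimately show ?thesis using that by blast
qed

lemma partial_deriv_add:
  assumes "f differentiable (at x)" "g differentiable (at x)"
  shows "partial_deriv i (\<lambda>x. f x + g x) x = partial_deriv i f x + partial_deriv i g x"
  by (subst partial_deriv_eqI[OF has_derivative_add[OF has_derivative_frechet has_derivative_frechet]])
     (use assms in \<open>auto simp: partial_deriv_def\<close>)

lemma partial_deriv_mult:
  assumes "f differentiable (at x)" "g differentiable (at x)"
  shows "partial_deriv i (\<lambda>x. f x * g x) x = f x * partial_deriv i g x + partial_deriv i f x * g x"
  by (subst partial_deriv_eqI[OF has_derivative_mult[OF has_derivative_frechet has_derivative_frechet]])
     (use assms in \<open>auto simp: partial_deriv_def\<close>)

text \<open>The module that \<open>Y\<close> generates over the multipliers. By the product rule it is stable under partial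
  derivatives as soon as the derivatives of its generators lie in it, so it is the natural candidate for
  the two coinduction rules.\<close>

inductive_set mult_span :: "(real^'n \<Rightarrow> complex) set \<Rightarrow> (real^'n \<Rightarrow> complex) set" for Y where
  prod: "g \<in> multiplier \<Longrightarrow> f \<in> Y \<Longrightarrow> (\<lambda>x. g x * f x) \<in> mult_span Y"
| plus: "f \<in> mult_span Y \<Longrightarrow> f' \<in> mult_span Y \<Longrightarrow> (\<lambda>x. f x + f' x) \<in> mult_span Y"

lemma mult_span_differentiable:
  assumes Y: "\<And>f x. f \<in> Y \<Longrightarrow> f differentiable (at x)" and "f \<in> mult_span Y"
  shows "f differentiable (at x)"
  using assms(2)
proof induction
  case (prod g f)
  then show ?case by (intro differentiable_mult multiplier_differentiable Y(1))
qed (rule differentiable_add)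

lemma mult_span_partial_deriv:
  assumes Y: "\<And>f x. f \<in> Y \<Longrightarrow> f differentiable (at x)"
    and D: "\<And>g f i. g \<in> multiplier \<Longrightarrow> f \<in> Y \<Longrightarrow> (\<lambda>x. g x * partial_deriv i f x) \<in> mult_span Y"
    and "f \<in> mult_span Y"
  shows "partial_deriv i f \<in> mult_span Y"
  using assms(3)
proof induction
  case (prod g f)
  have "partial_deriv i (\<lambda>x. g x * f x) = (\<lambda>x. g x * partial_deriv i f x + partial_deriv i g x * f x)"
    using prod by (intro ext partial_deriv_mult multiplier_differentiable Y)
  also have "\<dots> \<in> mult_span Y"
    by (rule mult_span.plus[OF D[OF prod] mult_span.prod[OF multiplier_partial_deriv[OF prod(1)] prod(2)]])
  finally show ?case .
next
  case (plus f f')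
  have "partial_deriv i (\<lambda>x. f x + f' x) = (\<lambda>x. partial_deriv i f x + partial_deriv i f' x)"
    by (rule ext, rule partial_deriv_add)
       (rule mult_span_differentiable[OF Y(1) plus.hyps(1)], assumption,
        rule mult_span_differentiable[OF Y(1) plus.hyps(2)], assumption)
  also have "\<dots> \<in> mult_span Y"
    by (rule mult_span.plus[OF plus.IH])
  finally show ?case .
qed

lemma mult_span_decay:
  fixes f :: "real^'n \<Rightarrow> complex"
  assumes Y: "\<And>f N. f \<in> Y \<Longrightarrow> \<exists>C. \<forall>x. (1 + norm x) ^ N * cmod (f x) \<le> C" and "f \<in> mult_span Y"
  shows "bounded (range (\<lambda>x. norm x ^ k *\<^sub>R f x))"
proof -
  have "\<exists>C. \<forall>x. (1 + norm x) ^ N * cmod (f x) \<le> C" for N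
    using assms(2)
  proof (induction arbitrary: N)
    case (prod g f)
    obtain C M where C: "\<And>x. cmod (g x) \<le> C * (1 + norm x) ^ M" using multiplier_growth[OF prod(1)] by blast
    obtain D where D: "\<And>x. (1 + norm x) ^ (N + M) * cmod (f x) \<le> D" using Y[OF prod(2)] by blast
    have "C \<ge> 0" using order.trans[OF _ C[of 0]] by simp
    have "(1 + norm x) ^ N * cmod (g x * f x) \<le> C * D" for x
    proof -
      have "(1 + norm x) ^ N * cmod (g x * f x) \<le> (1 + norm x) ^ N * ((C * (1 + norm x) ^ M) * cmod (f x))"
        unfolding norm_mult by (intro mult_left_mono mult_right_mono C) auto
      also have "\<dots> = C * ((1 + norm x) ^ (N + M) * cmod (f x))" by (simp add: power_add)
      also have "\<dots> \<le> C * D" by (intro mult_left_mono D \<open>C \<ge> 0\<close>)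
      finally show ?thesis .
    qed
    then show ?case by blast
  next
    case (plus f f')
    obtain C where C: "\<And>x. (1 + norm x) ^ N * cmod (f x) \<le> C" using plus.IH(1) by blast
    obtain D where D: "\<And>x. (1 + norm x) ^ N * cmod (f' x) \<le> D" using plus.IH(2) by blast
    have "(1 + norm x) ^ N * cmod (f x + f' x) \<le> C + D" for x
    proof -
      have "(1 + norm x) ^ N * cmod (f x + f' x) \<le> (1 + norm x) ^ N * (cmod (f x) + cmod (f' x))"
        by (intro mult_left_mono norm_triangle_ineq) auto
      also have "\<dots> \<le> C + D" using C[of x] D[of x] by (simp add: algebra_simps)
      finally show ?thesis .
    qed
    then show ?case by blast
  qed
  then show ?thesis using decay_iff by blast
qed

lemma mult_span_schwartz: "f \<in> mult_span schwartz \<Longrightarrow> f \<in> schwartz"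
proof (rule schwartz_coinduct[of _ "mult_span schwartz"])
  show "partial_deriv i f \<in> mult_span schwartz" if "f \<in> mult_span schwartz" for i and f :: "real^'n \<Rightarrow> complex"
    by (intro mult_span_partial_deriv[OF _ _ that] schwartz_differentiable schwartz_partial_deriv mult_span.prod)
  show "f differentiable (at x)" if "f \<in> mult_span schwartz" for x and f :: "real^'n \<Rightarrow> complex"
    by (rule mult_span_differentiable[OF schwartz_differentiable that])
  show "bounded (range (\<lambda>x. norm x ^ k *\<^sub>R f x))" if "f \<in> mult_span schwartz" for k and f :: "real^'n \<Rightarrow> complex"
    by (rule mult_span_decay[OF schwartz_decay_weighted that])
qed

lemma schwartz_multiplier: "g \<in> multiplier \<Longrightarrow> f \<in> schwartz \<Longrightarrow> (\<lambda>x. g x * f x) \<in> schwartz"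
  by (rule mult_span_schwartz[OF mult_span.prod])

lemma growth_mult:
  assumes "\<exists>C N. \<forall>x. cmod (f x) \<le> C * (1 + norm x) ^ N" "\<exists>C N. \<forall>x. cmod (g x) \<le> C * (1 + norm x) ^ N"
  shows "\<exists>C N. \<forall>x. cmod (f x * g x) \<le> C * (1 + norm x) ^ N"
proof -
  obtain C M where C: "\<And>x. cmod (f x) \<le> C * (1 + norm x) ^ M" using assms(1) by blast
  obtain D N where D: "\<And>x. cmod (g x) \<le> D * (1 + norm x) ^ N" using assms(2) by blast
  have "cmod (f x * g x) \<le> (C * D) * (1 + norm x) ^ (M + N)" for x
  proof -
    have "cmod (f x * g x) \<le> (C * (1 + norm x) ^ M) * (D * (1 + norm x) ^ N)"
      unfolding norm_mult by (intro mult_mono C D norm_ge_zero order.trans[OF norm_ge_zero C])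
    then show ?thesis by (simp add: power_add algebra_simps)
  qed
  then show ?thesis by blast
qed

lemma growth_add:
  assumes "\<exists>C N. \<forall>x. cmod (f x) \<le> C * (1 + norm x) ^ N" "\<exists>C N. \<forall>x. cmod (g x) \<le> C * (1 + norm x) ^ N"
  shows "\<exists>C N. \<forall>x. cmod (f x + g x) \<le> C * (1 + norm x) ^ N"
proof -
  obtain C M where C: "\<And>x. cmod (f x) \<le> C * (1 + norm x) ^ M" using assms(1) by blast
  obtain D N where D: "\<And>x. cmod (g x) \<le> D * (1 + norm x) ^ N" using assms(2) by blast
  have C0: "C \<ge> 0" "D \<ge> 0" using order.trans[OF norm_ge_zero C[of 0]] order.trans[OF norm_ge_zero D[of 0]] by simp_all
  have "cmod (f x + g x) \<le> (C + D) * (1 + norm x) ^ (M + N)" for x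
  proof -
    have "cmod (f x + g x) \<le> C * (1 + norm x) ^ M + D * (1 + norm x) ^ N"
      using norm_triangle_ineq[of "f x" "g x"] C[of x] D[of x] by linarith
    also have "\<dots> \<le> C * (1 + norm x) ^ (M + N) + D * (1 + norm x) ^ (M + N)"
      by (intro add_mono mult_left_mono power_increasing C0) auto
    finally show ?thesis by (simp add: algebra_simps)
  qed
  then show ?thesis by blast
qed

lemma mult_span_growth:
  assumes Y: "\<And>f. f \<in> Y \<Longrightarrow> \<exists>C N. \<forall>x. cmod (f x) \<le> C * (1 + norm x) ^ N" and "f \<in> mult_span Y"
  shows "\<exists>C N. \<forall>x. cmod (f x) \<le> C * (1 + norm x) ^ N"
  using assms(2)
proof induction
  case (prod g f)
  then show ?case by (intro growth_mult multiplier_growth Y)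
next
  case (plus f f')
  show ?case by (rule growth_add[OF plus.IH])
qed

lemma multiplier_mult:
  assumes "g \<in> multiplier" "f \<in> multiplier"
  shows "(\<lambda>x. g x * f x) \<in> multiplier"
proof (rule multiplier_coinduct[of _ "mult_span multiplier"])
  show "(\<lambda>x. g x * f x) \<in> mult_span multiplier" by (intro mult_span.prod assms)
  show "partial_deriv i f \<in> mult_span multiplier" if "f \<in> mult_span multiplier" for i and f :: "real^'n \<Rightarrow> complex"
    by (intro mult_span_partial_deriv[OF _ _ that] multiplier_differentiable multiplier_partial_deriv mult_span.prod)
  show "f differentiable (at x)" if "f \<in> mult_span multiplier" for x and f :: "real^'n \<Rightarrow> complex"
    by (rule mult_span_differentiable[OF multiplier_differentiable that])
  show "\<exists>C N. \<forall>x. cmod (f x) \<le> C * (1 + norm x) ^ N" if "f \<in> mult_span multiplier" for f :: "real^'n \<Rightarrow> complex"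
    by (rule mult_span_growth[OF multiplier_growth that])
qed

lemma multiplier_const: "(\<lambda>x::real^'n. c) \<in> multiplier"
proof (rule multiplier_coinduct[of _ "range (\<lambda>c x. c)"])
  fix f :: "real^'n \<Rightarrow> complex" and i assume "f \<in> range (\<lambda>c x. c)"
  then obtain c where f: "f = (\<lambda>x. c)" by auto
  have "partial_deriv i f = (\<lambda>x. 0)"
    by (rule ext, subst partial_deriv_eqI[of _ "\<lambda>_. 0"]) (auto simp: f)
  then show "partial_deriv i f \<in> range (\<lambda>c x. c)" by auto
  have "\<forall>x::real^'n. cmod (f x) \<le> cmod c * (1 + norm x) ^ 0" by (simp add: f)
  then show "\<exists>C N. \<forall>x. cmod (f x) \<le> C * (1 + norm x) ^ N" by blast
qed auto

lemma multiplier_coord: "(\<lambda>x::real^'n. complex_of_real (x $ j)) \<in> multiplier"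
proof (rule multiplier_coinduct[of _ "insert (\<lambda>x::real^'n. complex_of_real (x $ j)) multiplier"])
  fix f :: "real^'n \<Rightarrow> complex" and i x assume f: "f \<in> insert (\<lambda>x::real^'n. complex_of_real (x $ j)) multiplier"
  have d: "((\<lambda>x. complex_of_real (x $ j)) has_derivative (\<lambda>h. complex_of_real (h $ j))) (at x)" for x :: "real^'n"
    by (intro has_derivative_of_real bounded_linear_imp_has_derivative bounded_linear_vec_nth)
  show "f differentiable (at x)"
    using f multiplier_differentiable differentiableI[OF d] by blast
  have "partial_deriv i (\<lambda>x::real^'n. complex_of_real (x $ j)) = (\<lambda>x. complex_of_real (axis i 1 $ j))"
    by (rule ext) (rule partial_deriv_eqI[OF d])
  then show "partial_deriv i f \<in> insert (\<lambda>x::real^'n. complex_of_real (x $ j)) multiplier"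
    using f by (auto intro: multiplier_partial_deriv multiplier_const)
  have "\<forall>x::real^'n. cmod (complex_of_real (x $ j)) \<le> 1 * (1 + norm x) ^ 1"
    using component_le_norm_cart[of _ j] by (auto intro: add_increasing)
  then show "\<exists>C N. \<forall>x. cmod (f x) \<le> C * (1 + norm x) ^ N"
    using f multiplier_growth by blast
qed auto


lemma mult_span_mult:
  assumes "g \<in> multiplier" "f \<in> mult_span Y"
  shows "(\<lambda>x. g x * f x) \<in> mult_span Y"
  using assms(2)
proof induction
  case (prod h f)
  have "(\<lambda>x. (g x * h x) * f x) \<in> mult_span Y"
    by (rule mult_span.prod[OF multiplier_mult[OF assms(1) prod(1)] prod(2)])
  then show ?case by (simp only: mult.assoc)
next
  case (plus f f')
  show ?case using mult_span.plus[OF plus.IH] by (simp only: distrib_left)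
qed

lemma mult_span_self: "f \<in> Y \<Longrightarrow> f \<in> mult_span Y"
  using mult_span.prod[OF multiplier_const[of 1], of f Y] by simp

text \<open>For the concrete functions below, a derivative of a generator is a multiplier times a generator. Only the
  growth or the decay of the generators themselves is then left to check.\<close>

lemma generated_multiplier:
  assumes "f \<in> Y"
    and d: "\<And>f x. f \<in> Y \<Longrightarrow> f differentiable (at x)"
    and p: "\<And>f i. f \<in> Y \<Longrightarrow> partial_deriv i f \<in> mult_span Y"
    and b: "\<And>f. f \<in> Y \<Longrightarrow> \<exists>C N. \<forall>x. cmod (f x) \<le> C * (1 + norm x) ^ N"
  shows "f \<in> multiplier"
proof (rule multiplier_coinduct[of _ "mult_span Y"])
  show "f \<in> mult_span Y" by (rule mult_span_self[OF assms(1)])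
qed (rule mult_span_differentiable[OF d] mult_span_partial_deriv[OF d mult_span_mult[OF _ p]] mult_span_growth[OF b]; assumption)+

lemma generated_schwartz:
  fixes f :: "real^'n \<Rightarrow> complex"
  assumes "f \<in> Y"
    and d: "\<And>f x. f \<in> Y \<Longrightarrow> f differentiable (at x)"
    and p: "\<And>f i. f \<in> Y \<Longrightarrow> partial_deriv i f \<in> mult_span Y"
    and b: "\<And>f N. f \<in> Y \<Longrightarrow> \<exists>C. \<forall>x. (1 + norm x) ^ N * cmod (f x) \<le> C"
  shows "f \<in> schwartz"
proof (rule schwartz_coinduct[of _ "mult_span Y"])
  show "f \<in> mult_span Y" by (rule mult_span_self[OF assms(1)])
qed (rule mult_span_differentiable[OF d] mult_span_partial_deriv[OF d mult_span_mult[OF _ p]] mult_span_decay[OF b]; assumption)+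

section \<open>Bessel weights, characters and Gaussians\<close>

lemma has_derivative_norm_sq:
  fixes b :: "real^'n"
  shows "((\<lambda>x. (norm (x - b))\<^sup>2) has_derivative (\<lambda>h. 2 * ((x - b) \<bullet> h))) (at x)"
  unfolding power2_norm_eq_inner
  by (auto intro!: derivative_eq_intros simp: inner_commute)

text \<open>The Fourier symbol of \<open>1 - \<Delta>\<close>, in the normalization where the transform has \<open>2 * pi\<close> in the exponent.\<close>

abbreviation bessel_base :: "real^'n \<Rightarrow> real" where
  "bessel_base x \<equiv> 1 + 4 * pi\<^sup>2 * (norm x)\<^sup>2"

definition bessel_weight :: "real \<Rightarrow> real^'n \<Rightarrow> complex" where
  "bessel_weight t x = complex_of_real (bessel_base x powr t)"

lemma bessel_base_pos: "bessel_base x > 0"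
  by (intro add_pos_nonneg) auto

lemma bessel_weight_has_derivative:
  "(bessel_weight t has_derivative
     (\<lambda>h. complex_of_real (t * bessel_base x powr (t - 1) * (8 * pi\<^sup>2 * (x \<bullet> h))))) (at x)"
proof -
  have 1: "((\<lambda>x. 1 + 4 * pi\<^sup>2 * (norm x)\<^sup>2) has_derivative (\<lambda>h. 8 * pi\<^sup>2 * (x \<bullet> h))) (at x)"
    using has_derivative_norm_sq[of 0 x] by (auto intro!: derivative_eq_intros)
  have 2: "((\<lambda>z. z powr t) has_derivative (*) (t * bessel_base x powr (t - 1))) (at (bessel_base x))"
    by (rule has_field_derivative_imp_has_derivative[OF has_real_derivative_powr[OF bessel_base_pos]])
  show ?thesis
    unfolding bessel_weight_def
    by (rule has_derivative_of_real[OF has_derivative_compose[OF 1 2]])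
qed

text \<open>Differentiation lowers the exponent by one, so the generating set has to contain all real exponents at
  once.\<close>

lemma bessel_weight_multiplier: "(bessel_weight t :: real^'n \<Rightarrow> complex) \<in> multiplier"
proof (rule generated_multiplier[of _ "range bessel_weight"])
  fix f :: "real^'n \<Rightarrow> complex" assume "f \<in> range bessel_weight"
  then obtain t where f: "f = bessel_weight t" by auto
  show "f differentiable (at x)" for x
    unfolding f by (rule differentiableI[OF bessel_weight_has_derivative])
  show "partial_deriv i f \<in> mult_span (range bessel_weight)" for i
  proof -
    have "partial_deriv i f = (\<lambda>x. (complex_of_real (t * 8 * pi\<^sup>2) * complex_of_real (x $ i)) * bessel_weight (t - 1) x)"
      unfolding f by (rule ext, subst partial_deriv_eqI[OF bessel_weight_has_derivative])
         (simp add: bessel_weight_def inner_axis mult_ac)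
    also have "\<dots> \<in> mult_span (range bessel_weight)"
      by (intro mult_span.prod multiplier_mult multiplier_const multiplier_coord rangeI)
    finally show ?thesis .
  qed
  obtain N :: nat where N: "t \<le> real N" using real_arch_simple by blast
  have "cmod (f x) \<le> (1 + 4 * pi\<^sup>2) ^ N * (1 + norm x) ^ (2 * N)" for x
  proof -
    let ?b = "1 + 4 * pi\<^sup>2 * (norm x)\<^sup>2"
    have "cmod (f x) = ?b powr t"
      by (simp add: f bessel_weight_def)
    also have "\<dots> \<le> ?b powr real N" by (intro powr_mono N) auto
    also have "\<dots> = ?b ^ N" by (rule powr_realpow[OF bessel_base_pos])
    also have "\<dots> \<le> ((1 + 4 * pi\<^sup>2) * (1 + norm x)\<^sup>2) ^ N"
    proof (rule power_mono)
      have "?b \<le> 1 * (1 + norm x)\<^sup>2 + 4 * pi\<^sup>2 * (1 + norm x)\<^sup>2"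
        by (intro add_mono mult_left_mono power_mono) (auto simp: one_le_power)
      then show "?b \<le> (1 + 4 * pi\<^sup>2) * (1 + norm x)\<^sup>2" by (simp only: distrib_right)
    qed (use bessel_base_pos[of x] in simp)
    also have "\<dots> = (1 + 4 * pi\<^sup>2) ^ N * (1 + norm x) ^ (2 * N)"
      by (simp add: power_mult_distrib power_mult)
    finally show ?thesis .
  qed
  then show "\<exists>C N. \<forall>x. cmod (f x) \<le> C * (1 + norm x) ^ N" by blast
qed simp

definition character :: "real^'n \<Rightarrow> real^'n \<Rightarrow> complex" where
  "character h x = exp (2 * of_real pi * \<i> * of_real (h \<bullet> x))"

lemma cmod_character [simp]: "cmod (character h x) = 1"
  by (simp add: character_def norm_exp_i_times[of "2 * pi * (h \<bullet> x)", simplified] mult_ac)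

lemma character_has_derivative:
  "(character h has_derivative (\<lambda>k. 2 * of_real pi * \<i> * of_real (h \<bullet> k) * character h x)) (at x)"
proof -
  have "((\<lambda>x. 2 * of_real pi * \<i> * complex_of_real (h \<bullet> x)) has_derivative (\<lambda>k. 2 * of_real pi * \<i> * complex_of_real (h \<bullet> k))) (at x)"
    by (auto intro!: derivative_eq_intros)
  then have "((\<lambda>x. exp (2 * of_real pi * \<i> * complex_of_real (h \<bullet> x))) has_derivative
    (\<lambda>k. exp (2 * of_real pi * \<i> * complex_of_real (h \<bullet> x)) * (2 * of_real pi * \<i> * complex_of_real (h \<bullet> k)))) (at x)"
    by (rule has_derivative_compose) (rule has_field_derivative_imp_has_derivative[OF DERIV_exp])
  then show ?thesis unfolding character_def by (simp add: mult_ac)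
qed

lemma character_multiplier: "character h \<in> multiplier"
proof (rule generated_multiplier[of _ "{character h}"])
  fix f assume "f \<in> {character h}"
  then have f: "f = character h" by simp
  show "f differentiable (at x)" for x
    unfolding f by (rule differentiableI[OF character_has_derivative])
  show "partial_deriv i f \<in> mult_span {character h}" for i
  proof -
    have "partial_deriv i f = (\<lambda>x. (2 * of_real pi * \<i> * of_real (h \<bullet> axis i 1)) * character h x)"
      unfolding f by (rule ext, rule partial_deriv_eqI[OF character_has_derivative])
    also have "\<dots> \<in> mult_span {character h}"
      by (intro mult_span.prod multiplier_const) simp
    finally show ?thesis .
  qed
  have "\<forall>x. cmod (f x) \<le> 1 * (1 + norm x) ^ 0" by (simp add: f)
  then show "\<exists>C N. \<forall>x. cmod (f x) \<le> C * (1 + norm x) ^ N" by blast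
qed simp

definition gaussian :: "real \<Rightarrow> real^'n \<Rightarrow> real^'n \<Rightarrow> complex" where
  "gaussian a b x = complex_of_real (exp (- a * (norm (x - b))\<^sup>2))"

lemma gaussian_has_derivative:
  "(gaussian a b has_derivative (\<lambda>h. complex_of_real (- 2 * a * ((x - b) \<bullet> h)) * gaussian a b x)) (at x)"
proof -
  have "((\<lambda>x. - a * (norm (x - b))\<^sup>2) has_derivative (\<lambda>h. - 2 * a * ((x - b) \<bullet> h))) (at x)"
    using has_derivative_mult_right[OF has_derivative_norm_sq[of b x], of "- a"] by (simp add: algebra_simps)
  then have "((\<lambda>x. exp (- a * (norm (x - b))\<^sup>2)) has_derivative
    (\<lambda>h. exp (- a * (norm (x - b))\<^sup>2) * (- 2 * a * ((x - b) \<bullet> h)))) (at x)"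
    by (rule has_derivative_compose) (rule has_field_derivative_imp_has_derivative[OF DERIV_exp])
  from has_derivative_of_real[OF this] show ?thesis unfolding gaussian_def by (simp add: mult_ac)
qed

text \<open>With \<open>c = a / (N + 1)\<close> the inequality \<open>1 + c t\<^sup>2 \<le> exp (c t\<^sup>2)\<close>, raised to the power \<open>N + 1\<close>, bounds a
  polynomial by \<open>exp (a t\<^sup>2)\<close>; and \<open>(1 + t)\<^sup>2\<close> is at most a multiple of \<open>1 + c t\<^sup>2\<close>.\<close>

lemma gaussian_decay:
  fixes a t :: real
  assumes "a > 0"
  obtains C where "\<And>t. t \<ge> 0 \<Longrightarrow> (1 + t) ^ N * exp (- a * t\<^sup>2) \<le> C"
proof
  define c where "c = a / real (Suc N)"
  have c: "c > 0" using assms by (simp add: c_def)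
  define M where "M = max 1 (1 / c)"
  fix t :: real assume t: "t \<ge> 0"
  have "(1 + t) ^ N \<le> (1 + t) ^ (2 * Suc N)" using t by (intro power_increasing) auto
  also have "\<dots> = ((1 + t)\<^sup>2) ^ Suc N" by (rule power_mult)
  also have "\<dots> \<le> (2 * M * (1 + c * t\<^sup>2)) ^ Suc N"
  proof (rule power_mono)
    have "(1 + t)\<^sup>2 \<le> 2 * (1 + t\<^sup>2)" using sum_squares_bound[of 1 t] by (simp add: power2_sum)
    also have "1 + t\<^sup>2 \<le> M + (M * c) * t\<^sup>2"
    proof (intro add_mono)
      have "1 \<le> M * c" using c unfolding M_def by (simp add: max_def field_simps)
      then show "t\<^sup>2 \<le> (M * c) * t\<^sup>2" using mult_right_mono[of 1 "M * c" "t\<^sup>2"] by simp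
    qed (simp add: M_def)
    finally show "(1 + t)\<^sup>2 \<le> 2 * M * (1 + c * t\<^sup>2)" by (simp add: algebra_simps)
  qed simp
  also have "\<dots> = (2 * M) ^ Suc N * (1 + c * t\<^sup>2) ^ Suc N" by (rule power_mult_distrib)
  also have "\<dots> \<le> (2 * M) ^ Suc N * exp (c * t\<^sup>2) ^ Suc N"
    using c exp_ge_add_one_self[of "c * t\<^sup>2"] by (intro mult_left_mono power_mono) (auto simp: M_def)
  also have "exp (c * t\<^sup>2) ^ Suc N = exp (a * t\<^sup>2)"
    by (subst exp_of_nat_mult[symmetric]) (simp add: c_def)
  finally show "(1 + t) ^ N * exp (- a * t\<^sup>2) \<le> (2 * M) ^ Suc N"
    by (simp add: exp_minus field_simps del: power_Suc)
qed

lemma gaussian_schwartz: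
  assumes "a > 0"
  shows "gaussian a b \<in> schwartz"
proof (rule generated_schwartz[of _ "{gaussian a b}"])
  fix f assume "f \<in> {gaussian a b}"
  then have f: "f = gaussian a b" by simp
  show "f differentiable (at x)" for x
    unfolding f by (rule differentiableI[OF gaussian_has_derivative])
  show "partial_deriv i f \<in> mult_span {gaussian a b}" for i
  proof -
    have "partial_deriv i f = (\<lambda>x. (complex_of_real (- 2 * a) * complex_of_real (x $ i)) * gaussian a b x
        + complex_of_real (2 * a * (b $ i)) * gaussian a b x)"
      unfolding f by (rule ext, subst partial_deriv_eqI[OF gaussian_has_derivative])
         (simp add: inner_axis algebra_simps)
    also have "\<dots> \<in> mult_span {gaussian a b}"
      by (intro mult_span.plus mult_span.prod multiplier_const multiplier_coord multiplier_mult) simp_all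
    finally show ?thesis .
  qed
  fix N
  obtain C where C: "\<And>t. t \<ge> 0 \<Longrightarrow> (1 + t) ^ N * exp (- a * t\<^sup>2) \<le> C" using gaussian_decay[OF assms] by blast
  have "(1 + norm x) ^ N * cmod (f x) \<le> (1 + norm b) ^ N * C" for x
  proof -
    have "1 + norm x \<le> (1 + norm b) * (1 + norm (x - b))"
    proof -
      have "norm x \<le> norm b + norm (x - b)"
        using norm_triangle_ineq[of b "x - b"] by simp
      moreover have "0 \<le> norm b * norm (x - b)" by simp
      ultimately show ?thesis by (simp only: distrib_right distrib_left mult_1_left mult_1_right)
    qed
    then have "(1 + norm x) ^ N \<le> (1 + norm b) ^ N * (1 + norm (x - b)) ^ N"
      unfolding power_mult_distrib[symmetric] by (intro power_mono) auto
    then have "(1 + norm x) ^ N * cmod (f x) \<le> (1 + norm b) ^ N * (1 + norm (x - b)) ^ N * cmod (f x)"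
      by (rule mult_right_mono) auto
    also have "\<dots> = (1 + norm b) ^ N * ((1 + norm (x - b)) ^ N * exp (- a * (norm (x - b))\<^sup>2))"
      by (simp add: f gaussian_def)
    also have "\<dots> \<le> (1 + norm b) ^ N * C" by (intro mult_left_mono C) auto
    finally show ?thesis .
  qed
  then show "\<exists>C. \<forall>x. (1 + norm x) ^ N * cmod (f x) \<le> C" by blast
qed simp


section \<open>The Schwartz space inside the Lebesgue spaces\<close>

lemma schwartz_continuous_on: "f \<in> schwartz \<Longrightarrow> continuous_on A f"
  by (intro continuous_at_imp_continuous_on ballI differentiable_imp_continuous_within schwartz_differentiable)

lemma schwartz_measurable [measurable_dest]: "f \<in> schwartz \<Longrightarrow> f \<in> borel_measurable borel"
  by (intro borel_measurable_continuous_onI schwartz_continuous_on)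

lemma schwartz_integrable_weight:
  fixes f :: "real^'n \<Rightarrow> complex"
  assumes "f \<in> schwartz"
  shows "integrable lborel (\<lambda>x. (1 + norm x) ^ k * cmod (f x))"
proof -
  let ?d = "Suc DIM(real^'n)"
  obtain C where C: "C \<ge> 0" "\<And>x. cmod (f x) \<le> C * inverse ((1 + norm x) ^ (?d + k))"
    using schwartz_decay_bound[OF assms, where N="?d + k"] by blast
  note [measurable] = schwartz_measurable[OF assms]
  show ?thesis
  proof (rule Bochner_Integration.integrable_bound)
    show "integrable lborel (\<lambda>x::real^'n. C * inverse ((1 + norm x) ^ ?d))"
      by (rule integrable_mult_right[OF integrable_inverse_power])
    show "(\<lambda>x. (1 + norm x) ^ k * cmod (f x)) \<in> borel_measurable lborel" by measurable
    have "(1 + norm x) ^ k * cmod (f x) \<le> C * inverse ((1 + norm x) ^ ?d)" for x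
    proof -
      have p: "1 + norm x > 0" by (rule add_pos_nonneg) auto
      have "(1 + norm x) ^ k * cmod (f x) \<le> (1 + norm x) ^ k * (C * inverse ((1 + norm x) ^ (?d + k)))"
        by (intro mult_left_mono C) auto
      also have "\<dots> = C * inverse ((1 + norm x) ^ ?d)"
      proof -
        have "u ^ k * (C * inverse (u ^ (d + k))) = C * inverse (u ^ d)" if "u > 0" for u :: real and d
          using that by (simp add: power_add field_simps)
        from this[OF p] show ?thesis .
      qed
      finally show ?thesis .
    qed
    then show "AE x in lborel. norm ((1 + norm x) ^ k * cmod (f x)) \<le> norm (C * inverse ((1 + norm x) ^ ?d))"
      using C(1) by (intro AE_I2) (simp add: abs_mult del: power_Suc)
  qed
qed

lemma schwartz_integrable: "f \<in> schwartz \<Longrightarrow> integrable lborel f"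
  using schwartz_integrable_weight[of f 0] schwartz_measurable[of f]
  by (simp add: integrable_norm_iff)

lemma schwartz_Lp_2:
  assumes f: "f \<in> schwartz"
  shows "f \<in> Lp_space 2"
proof -
  obtain B where B: "B \<ge> 0" "\<And>x. cmod (f x) \<le> B * inverse ((1 + norm x) ^ 0)"
    using schwartz_decay_bound[OF f, where N=0] by blast
  have "integrable lborel (\<lambda>x. B * cmod (f x))"
    by (intro integrable_mult_right integrable_norm schwartz_integrable f)
  then have "integrable lborel (\<lambda>x. (cmod (f x))\<^sup>2)"
    by (rule Bochner_Integration.integrable_bound)
       (use schwartz_measurable[OF f] B in \<open>auto simp: power2_eq_square intro!: mult_right_mono\<close>)
  then show ?thesis unfolding Lp_space_def using schwartz_measurable[OF f] by simp
qed

lemma schwartz_cmult: "f \<in> schwartz \<Longrightarrow> (\<lambda>x. c * f x) \<in> schwartz"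
  by (rule schwartz_multiplier[OF multiplier_const])

lemma schwartz_mult: "f \<in> schwartz \<Longrightarrow> g \<in> schwartz \<Longrightarrow> (\<lambda>x. f x * g x) \<in> schwartz"
proof (rule schwartz_multiplier)
  assume "f \<in> schwartz"
  then show "f \<in> multiplier"
  proof (rule multiplier_coinduct)
    fix f :: "real^'n \<Rightarrow> complex" assume "f \<in> schwartz"
    then obtain C where "\<And>x. (1 + norm x) ^ 0 * cmod (f x) \<le> C" using schwartz_decay_weighted by blast
    then have "\<forall>x. cmod (f x) \<le> C * (1 + norm x) ^ 0" by simp
    then show "\<exists>C N. \<forall>x. cmod (f x) \<le> C * (1 + norm x) ^ N" by blast
  qed (auto intro: schwartz_differentiable schwartz_partial_deriv)
qed

lemma schwartz_add: "f \<in> schwartz \<Longrightarrow> g \<in> schwartz \<Longrightarrow> (\<lambda>x. f x + g x) \<in> schwartz"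
  by (rule mult_span_schwartz[OF mult_span.plus[OF mult_span_self mult_span_self]])

lemma schwartz_diff: "f \<in> schwartz \<Longrightarrow> g \<in> schwartz \<Longrightarrow> (\<lambda>x. f x - g x) \<in> schwartz"
  using schwartz_add[of f "\<lambda>x. -1 * g x"] schwartz_cmult[of g "-1"] by simp

lemma schwartz_reflect:
  fixes f :: "real^'n \<Rightarrow> complex"
  assumes "f \<in> schwartz"
  shows "(\<lambda>x. f (- x)) \<in> schwartz"
proof (rule schwartz_coinduct[of _ "(\<lambda>f x. f (- x)) ` schwartz"])
  fix f :: "real^'n \<Rightarrow> complex" assume "f \<in> (\<lambda>f x. f (- x)) ` schwartz"
  then obtain g where g: "g \<in> schwartz" and f: "f = (\<lambda>x. g (- x))" by auto
  have d: "(f has_derivative (\<lambda>h. frechet_derivative g (at (- x)) (- h))) (at x)" for x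
    unfolding f
    by (rule has_derivative_compose[OF _ has_derivative_frechet[OF schwartz_differentiable[OF g]]])
       (auto intro!: derivative_eq_intros)
  then show "f differentiable (at x)" for x by (rule differentiableI)
  show "partial_deriv i f \<in> (\<lambda>f x. f (- x)) ` schwartz" for i
  proof
    show "(\<lambda>x. -1 * partial_deriv i g x) \<in> schwartz"
      by (intro schwartz_cmult schwartz_partial_deriv g)
    show "partial_deriv i f = (\<lambda>x. -1 * partial_deriv i g (- x))"
    proof
      fix x
      have "linear (frechet_derivative g (at (- x)))"
        using schwartz_differentiable[OF g] by (rule linear_frechet_derivative)
      then show "partial_deriv i f x = -1 * partial_deriv i g (- x)"
        by (subst partial_deriv_eqI[OF d]) (simp add: partial_deriv_def linear_neg)
    qed
  qed
  show "bounded (range (\<lambda>x. norm x ^ k *\<^sub>R f x))" for k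
  proof -
    have "range (\<lambda>x. norm x ^ k *\<^sub>R f x) = range (\<lambda>x. norm x ^ k *\<^sub>R g x)"
      unfolding f by (auto simp: image_iff) (metis add.inverse_inverse norm_minus_cancel)+
    then show ?thesis using schwartz_decay[OF g] by simp
  qed
qed (use assms in auto)

section \<open>The Fourier transform of integrable functions\<close>

lemma character_measurable [measurable]: "(\<lambda>x. character h x) \<in> borel_measurable borel"
  unfolding character_def by measurable

lemma character_add: "character (g + h) x = character g x * character h x"
  by (simp add: character_def inner_add_left distrib_left exp_add)

lemma character_add_right: "character h (x + y) = character h x * character h y"
  by (simp add: character_def inner_add_right distrib_left exp_add)

lemma character_commute: "character h x = character x h"
  by (simp add: character_def inner_commute)

lemma character_minus: "character (- h) x = character h (- x)"
  by (simp add: character_def)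

lemma character_0 [simp]: "character 0 x = 1" "character h 0 = 1"
  by (simp_all add: character_def)

lemma character_mult_minus [simp]: "character h x * character (- h) x = 1"
  using character_add[of h "- h" x] by simp

lemma cnj_character: "cnj (character h x) = character (- h) x"
  by (simp add: character_def exp_cnj)

lemma fourier_character: "fourier f \<xi> = (LINT x|lborel. f x * character (- \<xi>) x)"
  unfolding fourier_def character_def by (simp add: inner_commute)

lemma inv_fourier_character: "inv_fourier f x = (LINT \<xi>|lborel. f \<xi> * character x \<xi>)"
  unfolding inv_fourier_def character_def by simp

lemma inv_fourier_eq: "inv_fourier f x = fourier f (- x)"
  by (simp add: fourier_character inv_fourier_character)

lemma integrable_character:
  "integrable lborel f \<Longrightarrow> integrable lborel (\<lambda>x. f x * character h x)"
  by (rule Bochner_Integration.integrable_bound, assumption)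
     (auto simp: norm_mult dest!: borel_measurable_integrable intro!: borel_measurable_times)

lemma fourier_measurable [measurable]:
  fixes f :: "real^'n \<Rightarrow> complex"
  assumes [measurable]: "f \<in> borel_measurable borel"
  shows "fourier f \<in> borel_measurable borel"
proof -
  have "(\<lambda>\<xi>. LINT x|lborel. f x * exp (- 2 * of_real pi * \<i> * of_real (x \<bullet> \<xi>))) \<in> borel_measurable borel"
    by measurable
  then show ?thesis unfolding fourier_def[abs_def] .
qed

lemma cmod_fourier_le: "cmod (fourier f \<xi>) \<le> (LINT x|lborel. cmod (f x))"
proof -
  have "cmod (fourier f \<xi>) \<le> (LINT x|lborel. cmod (f x * character (- \<xi>) x))"
    unfolding fourier_character by (rule integral_norm_bound)
  then show ?thesis by (simp add: norm_mult)
qed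

text \<open>Fubini's theorem. This symmetry is what motivates the definition of the Fourier transform of a
  distribution by duality, and nearly every identity below is an instance of it.\<close>

lemma fourier_multiplication_formula:
  fixes f g :: "real^'n \<Rightarrow> complex"
  assumes f: "integrable lborel f" and g: "integrable lborel g"
  shows "(LINT \<xi>|lborel. fourier f \<xi> * g \<xi>) = (LINT x|lborel. f x * fourier g x)"
proof -
  have [measurable]: "f \<in> borel_measurable borel" "g \<in> borel_measurable borel" using f g by auto
  have int: "integrable (lborel \<Otimes>\<^sub>M lborel) (\<lambda>(x, \<xi>). f x * exp (- 2 * of_real pi * \<i> * of_real (x \<bullet> \<xi>)) * g \<xi>)"
  proof (rule lborel_pair.Fubini_integrable)
    show "(\<lambda>(x, \<xi>). f x * exp (- 2 * of_real pi * \<i> * of_real (x \<bullet> \<xi>)) * g \<xi>) \<in> borel_measurable (lborel \<Otimes>\<^sub>M lborel)"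
      by measurable
    have n: "cmod (f x * exp (- 2 * of_real pi * \<i> * of_real (x \<bullet> \<xi>)) * g \<xi>) = cmod (f x) * cmod (g \<xi>)" for x \<xi>
      using cmod_character[of "- x" \<xi>] by (simp add: norm_mult character_def)
    show "integrable lborel (\<lambda>x. LINT \<xi>|lborel. norm (case (x, \<xi>) of (x, \<xi>) \<Rightarrow> f x * exp (- 2 * of_real pi * \<i> * of_real (x \<bullet> \<xi>)) * g \<xi>))"
      unfolding case_prod_conv n using f by simp
    show "AE x in lborel. integrable lborel (\<lambda>\<xi>. case (x, \<xi>) of (x, \<xi>) \<Rightarrow> f x * exp (- 2 * of_real pi * \<i> * of_real (x \<bullet> \<xi>)) * g \<xi>)"
    proof (rule AE_I2)
      fix x :: "real^'n"
      have "integrable lborel (\<lambda>\<xi>. f x * (g \<xi> * character (- x) \<xi>))"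
        by (intro integrable_mult_right integrable_character g)
      then show "integrable lborel (\<lambda>\<xi>. case (x, \<xi>) of (x, \<xi>) \<Rightarrow> f x * exp (- 2 * of_real pi * \<i> * of_real (x \<bullet> \<xi>)) * g \<xi>)"
        by (simp add: character_def mult_ac)
    qed
  qed
  have "(LINT \<xi>|lborel. fourier f \<xi> * g \<xi>) = (LINT \<xi>|lborel. LINT x|lborel. f x * exp (- 2 * of_real pi * \<i> * of_real (x \<bullet> \<xi>)) * g \<xi>)"
    unfolding fourier_def by simp
  also have "\<dots> = (LINT x|lborel. LINT \<xi>|lborel. f x * exp (- 2 * of_real pi * \<i> * of_real (x \<bullet> \<xi>)) * g \<xi>)"
    by (rule lborel_pair.Fubini_integral[OF int])
  also have "\<dots> = (LINT x|lborel. f x * fourier g x)"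
    unfolding fourier_def by (simp add: inner_commute mult_ac flip: integral_mult_right_zero)
  finally show ?thesis .
qed

lemma fourier_mult_character: "fourier (\<lambda>x. f x * character h x) \<xi> = fourier f (\<xi> - h)"
  unfolding fourier_character
  by (intro Bochner_Integration.integral_cong) (auto simp: mult.assoc character_add[symmetric])

lemma fourier_translate:
  fixes f :: "real^'n \<Rightarrow> complex"
  assumes [measurable]: "f \<in> borel_measurable borel"
  shows "fourier (\<lambda>x. f (h + x)) \<xi> = character h \<xi> * fourier f \<xi>"
proof -
  have "fourier f \<xi> = (LINT x|lborel. f (h + x) * character (- \<xi>) (h + x))"
    unfolding fourier_character by (rule integral_lborel_translate[symmetric]) measurable
  also have "\<dots> = (LINT x|lborel. character (- \<xi>) h * (f (h + x) * character (- \<xi>) x))"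
    by (simp add: character_add_right mult_ac)
  also have "\<dots> = character (- \<xi>) h * fourier (\<lambda>x. f (h + x)) \<xi>"
    unfolding fourier_character by simp
  finally have "character h \<xi> * fourier f \<xi> = (character \<xi> h * character (- \<xi>) h) * fourier (\<lambda>x. f (h + x)) \<xi>"
    by (simp add: character_commute[of h \<xi>])
  then show ?thesis by simp
qed

section \<open>The Fourier transform preserves the Schwartz space\<close>

text \<open>A quadratic bound on the remainder survives integration over a parameter, whereas the limit that defines
  a derivative would have to be interchanged with the integral.\<close>

lemma has_derivative_quadratic_remainder:
  fixes f :: "'a::real_normed_vector \<Rightarrow> 'b::real_normed_vector"
  assumes "bounded_linear L" and R: "\<And>h. norm (f (x + h) - f x - L h) \<le> C * (norm h)\<^sup>2"
  shows "(f has_derivative L) (at x)"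
  unfolding has_derivative_at
proof (intro conjI assms(1))
  show "((\<lambda>h. norm (f (x + h) - f x - L h) / norm h) \<longlongrightarrow> 0) (at 0)"
  proof (rule Lim_null_comparison[of _ "\<lambda>h. C * norm h"])
    have "norm (f (x + h) - f x - L h) / norm h \<le> C * norm h" for h
      using R[of h] by (cases "h = 0") (auto simp: field_simps power2_eq_square)
    then show "\<forall>\<^sub>F h in at 0. norm (norm (f (x + h) - f x - L h) / norm h) \<le> C * norm h"
      by (intro always_eventually) auto
    show "((\<lambda>h::'a. C * norm h) \<longlongrightarrow> 0) (at 0)"
      by (auto intro!: tendsto_eq_intros)
  qed
qed

lemma character_remainder: "cmod (character h x - 1 - 2 * of_real pi * \<i> * of_real (h \<bullet> x)) \<le> 2 * pi\<^sup>2 * (norm h)\<^sup>2 * (norm x)\<^sup>2"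
proof -
  let ?t = "2 * pi * (h \<bullet> x)"
  have "cmod (character h x - 1 - 2 * of_real pi * \<i> * of_real (h \<bullet> x)) \<le> \<bar>?t\<bar> ^ 2 / 2"
    using iexp_approx1[of ?t 1] by (simp add: character_def numeral_2_eq_2 mult_ac diff_diff_eq)
  also have "\<dots> = 2 * pi\<^sup>2 * \<bar>h \<bullet> x\<bar>\<^sup>2" by (simp add: power_mult_distrib)
  also have "\<dots> \<le> 2 * pi\<^sup>2 * (norm h * norm x)\<^sup>2"
    by (intro mult_left_mono power_mono Cauchy_Schwarz_ineq2) auto
  finally show ?thesis by (simp add: power_mult_distrib)
qed

text \<open>Differentiation under the integral sign. The second-order Taylor bound for characters is integrated
  against \<open>cmod (f x)\<close>; both the first and the second moment of a Schwartz function are finite.\<close>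

lemma fourier_has_derivative:
  fixes f :: "real^'n \<Rightarrow> complex"
  assumes f: "f \<in> schwartz"
  shows "(fourier f has_derivative
    (\<lambda>h. LINT x|lborel. f x * (2 * of_real pi * \<i> * of_real (- h \<bullet> x)) * character (- \<xi>) x)) (at \<xi>)"
proof (rule has_derivative_quadratic_remainder)
  note [measurable] = schwartz_measurable[OF f]
  have i1: "integrable lborel (\<lambda>x. norm x * cmod (f x))"
    by (rule Bochner_Integration.integrable_bound[OF schwartz_integrable_weight[OF f, of 1]])
       (auto intro!: mult_right_mono simp: abs_mult)
  have i2: "integrable lborel (\<lambda>x. (norm x)\<^sup>2 * cmod (f x))"
    by (rule Bochner_Integration.integrable_bound[OF schwartz_integrable_weight[OF f, of 2]])
       (auto intro!: mult_right_mono power_mono simp: abs_mult)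
  let ?l = "\<lambda>h x. f x * (2 * of_real pi * \<i> * of_real (- h \<bullet> x)) * character (- \<xi>) x"
  have bd: "cmod (?l h x) \<le> (2 * pi * norm h) * (norm x * cmod (f x))" for h x
  proof -
    have "cmod (?l h x) = (2 * pi * \<bar>h \<bullet> x\<bar>) * cmod (f x)" by (simp add: norm_mult)
    also have "\<dots> \<le> (2 * pi * (norm h * norm x)) * cmod (f x)"
      by (intro mult_right_mono mult_left_mono Cauchy_Schwarz_ineq2) auto
    finally show ?thesis by (simp add: mult_ac)
  qed
  have il: "integrable lborel (?l h)" for h
    by (rule Bochner_Integration.integrable_bound[OF integrable_mult_right[OF i1, of "2 * pi * norm h"]])
       (rule borel_measurable_times, measurable, rule AE_I2, rule order.trans[OF bd], simp add: abs_mult)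
  let ?L = "\<lambda>h. LINT x|lborel. ?l h x"
  show "bounded_linear ?L"
  proof (rule bounded_linear_intro)
    show "?L (h + k) = ?L h + ?L k" for h k
      by (subst Bochner_Integration.integral_add[symmetric, OF il il]) (simp add: inner_add_left algebra_simps)
    show "?L (r *\<^sub>R h) = r *\<^sub>R ?L h" for r h
    proof -
      have "- (r *\<^sub>R h) \<bullet> x = r * (- h \<bullet> x)" for x by simp
      then have "?l (r *\<^sub>R h) x = r *\<^sub>R ?l h x" for x
        by (simp only: of_real_mult scaleR_conv_of_real mult_ac)
      then show ?thesis by (simp only: integral_scaleR_right)
    qed
    show "norm (?L h) \<le> norm h * (2 * pi * (LINT x|lborel. norm x * cmod (f x)))" for h
    proof -
      have "norm (?L h) \<le> (LINT x|lborel. (2 * pi * norm h) * (norm x * cmod (f x)))"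
        by (rule Bochner_Integration.integral_norm_bound_integral[OF il integrable_mult_right[OF i1]]) (use bd in auto)
      then show ?thesis unfolding integral_mult_right_zero by (simp only: mult_ac)
    qed
  qed
  fix h
  let ?r = "\<lambda>x. f x * (character (- h) x - 1 - 2 * of_real pi * \<i> * of_real (- h \<bullet> x)) * character (- \<xi>) x"
  have "fourier f (\<xi> + h) - fourier f \<xi> - ?L h = (LINT x|lborel. ?r x)"
  proof -
    have i: "integrable lborel (\<lambda>x. f x * character k x)" for k
      by (intro integrable_character schwartz_integrable f)
    have "fourier f (\<xi> + h) - fourier f \<xi> - ?L h = (LINT x|lborel. f x * character (- (\<xi> + h)) x - f x * character (- \<xi>) x - ?l h x)"
      unfolding fourier_character
      by (subst Bochner_Integration.integral_diff[OF Bochner_Integration.integrable_diff[OF i i] il],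
          subst Bochner_Integration.integral_diff[OF i i]) simp
    also have "\<dots> = (LINT x|lborel. ?r x)"
    proof (intro Bochner_Integration.integral_cong refl)
      fix x
      have "character (- (\<xi> + h)) x = character (- h) x * character (- \<xi>) x"
        using character_add[of "- \<xi>" "- h" x] by (simp add: mult.commute)
      then show "f x * character (- (\<xi> + h)) x - f x * character (- \<xi>) x - ?l h x = ?r x"
        by (simp only:) (simp add: algebra_simps)
    qed
    finally show ?thesis .
  qed
  also have "cmod \<dots> \<le> (LINT x|lborel. (2 * pi\<^sup>2 * (norm h)\<^sup>2) * ((norm x)\<^sup>2 * cmod (f x)))"
  proof -
    have b: "cmod (?r x) \<le> (2 * pi\<^sup>2 * (norm h)\<^sup>2) * ((norm x)\<^sup>2 * cmod (f x))" for x
    proof -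
      have "cmod (?r x) = cmod (character (- h) x - 1 - 2 * of_real pi * \<i> * of_real (- h \<bullet> x)) * cmod (f x)"
        by (simp only: norm_mult cmod_character mult_1_right mult.commute)
      also have "\<dots> \<le> (2 * pi\<^sup>2 * (norm (- h))\<^sup>2 * (norm x)\<^sup>2) * cmod (f x)"
        by (intro mult_right_mono character_remainder) auto
      finally show ?thesis by (simp add: mult_ac)
    qed
    have ir: "integrable lborel ?r"
      by (rule Bochner_Integration.integrable_bound[OF integrable_mult_right[OF i2, of "2 * pi\<^sup>2 * (norm h)\<^sup>2"]])
         (use b in \<open>auto simp: abs_mult\<close>)
    show ?thesis
      by (rule Bochner_Integration.integral_norm_bound_integral[OF ir integrable_mult_right[OF i2]]) (use b in auto)
  qed
  finally show "cmod (fourier f (\<xi> + h) - fourier f \<xi> - ?L h) \<le> (2 * pi\<^sup>2 * (LINT x|lborel. (norm x)\<^sup>2 * cmod (f x))) * (norm h)\<^sup>2"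
    unfolding integral_mult_right_zero by (simp only: mult_ac)
qed


lemma has_derivative_directional_limit:
  fixes f :: "'a::real_normed_vector \<Rightarrow> 'b::real_normed_vector"
  assumes f: "(f has_derivative f') (at x)" and t: "t \<longlonglongrightarrow> (0::real)" "\<And>k. t k \<noteq> 0"
  shows "(\<lambda>k. (1 / t k) *\<^sub>R (f (t k *\<^sub>R v + x) - f x)) \<longlonglongrightarrow> f' v"
proof -
  have bl: "bounded_linear f'" using f by (rule has_derivative_bounded_linear)
  have "((\<lambda>s. s *\<^sub>R v + x) has_derivative (\<lambda>s. s *\<^sub>R v)) (at 0)"
    by (auto intro!: derivative_eq_intros)
  then have "((\<lambda>s. f (s *\<^sub>R v + x)) has_derivative (\<lambda>s. f' (s *\<^sub>R v))) (at 0)"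
    by (rule has_derivative_compose) (use f in simp)
  then have lim: "((\<lambda>s. norm (f (s *\<^sub>R v + x) - f x - f' (s *\<^sub>R v)) / norm s) \<longlongrightarrow> 0) (at 0)"
    by (simp add: has_derivative_at)
  have "filterlim t (at 0) sequentially"
    using t by (simp add: filterlim_at)
  from filterlim_compose[OF lim this]
  have "(\<lambda>k. norm (f (t k *\<^sub>R v + x) - f x - f' (t k *\<^sub>R v)) / norm (t k)) \<longlonglongrightarrow> 0" .
  moreover have "norm (f (t k *\<^sub>R v + x) - f x - f' (t k *\<^sub>R v)) / norm (t k)
      = norm ((1 / t k) *\<^sub>R (f (t k *\<^sub>R v + x) - f x) - f' v)" for k
  proof -
    have "(1 / t k) *\<^sub>R (f (t k *\<^sub>R v + x) - f x) - f' v = (1 / t k) *\<^sub>R (f (t k *\<^sub>R v + x) - f x - f' (t k *\<^sub>R v))"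
      using t(2)[of k] by (simp add: linear_scale[OF bounded_linear.linear[OF bl]] scaleR_diff_right)
    then show ?thesis by (simp add: divide_inverse mult.commute)
  qed
  ultimately have "(\<lambda>k. norm ((1 / t k) *\<^sub>R (f (t k *\<^sub>R v + x) - f x) - f' v)) \<longlonglongrightarrow> 0" by simp
  then have "(\<lambda>k. (1 / t k) *\<^sub>R (f (t k *\<^sub>R v + x) - f x) - f' v) \<longlonglongrightarrow> 0"
    by (simp only: tendsto_norm_zero_iff)
  then show ?thesis by (rule LIM_zero_cancel)
qed

lemma character_difference_quotient:
  "(\<lambda>k. (1 / (1 / real (Suc k))) *\<^sub>R (character \<xi> ((1 / real (Suc k)) *\<^sub>R axis i 1 + 0) - character \<xi> 0))
     \<longlonglongrightarrow> 2 * of_real pi * \<i> * of_real (\<xi> $ i)"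
proof -
  have "(character \<xi> has_derivative (\<lambda>k. 2 * of_real pi * \<i> * of_real (\<xi> \<bullet> k) * character \<xi> 0)) (at 0)"
    by (rule character_has_derivative)
  from has_derivative_directional_limit[OF this, of "\<lambda>k. 1 / real (Suc k)" "axis i 1"]
  show ?thesis using LIMSEQ_inverse_real_of_nat by (simp add: inner_axis inverse_eq_divide del: of_nat_Suc)
qed

text \<open>Integration by parts, derived from translation invariance. The transform of a difference quotient of \<open>f\<close>
  is the difference quotient of the character \<open>\<xi>\<close> times the transform of \<open>f\<close>. Both sides converge as the
  step tends to zero, the left one by dominated convergence.\<close>

lemma fourier_partial_deriv:
  fixes f :: "real^'n \<Rightarrow> complex"
  assumes f: "f \<in> schwartz"
  shows "fourier (partial_deriv i f) \<xi> = 2 * of_real pi * \<i> * of_real (\<xi> $ i) * fourier f \<xi>"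
proof (rule LIMSEQ_unique)
  note [measurable] = schwartz_measurable[OF f] schwartz_measurable[OF schwartz_partial_deriv[OF f]]
  define t where "t k = 1 / real (Suc k)" for k
  have t: "t \<longlonglongrightarrow> 0" "\<And>k. t k > 0" "\<And>k. t k \<le> 1"
    using LIMSEQ_inverse_real_of_nat by (auto simp: t_def[abs_def] inverse_eq_divide)
  define e where "e = (axis i 1 :: real^'n)"
  have e: "norm e = 1" by (simp add: e_def)
  let ?D = "\<lambda>k x. (1 / t k) *\<^sub>R (f (t k *\<^sub>R e + x) - f x)"
  let ?N = "Suc DIM(real^'n)"
  obtain C where C: "C \<ge> 0" "\<And>x. cmod (partial_deriv i f x) \<le> C * inverse ((1 + norm x) ^ ?N)"
    using schwartz_decay_bound[OF schwartz_partial_deriv[OF f], where N="?N"] by blast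
  show "(\<lambda>k. fourier (?D k) \<xi>) \<longlonglongrightarrow> fourier (partial_deriv i f) \<xi>"
    unfolding fourier_character
  proof (rule integral_dominated_convergence)
    show "integrable lborel (\<lambda>x::real^'n. (C * 2 ^ ?N) * inverse ((1 + norm x) ^ ?N))"
      by (rule integrable_mult_right[OF integrable_inverse_power])
    show "AE x in lborel. (\<lambda>k. ?D k x * character (- \<xi>) x) \<longlonglongrightarrow> partial_deriv i f x * character (- \<xi>) x"
    proof (rule AE_I2, rule tendsto_mult_right)
      fix x
      have "(\<lambda>k. (1 / t k) *\<^sub>R (f (t k *\<^sub>R e + x) - f x)) \<longlonglongrightarrow> frechet_derivative f (at x) e"
        by (rule has_derivative_directional_limit[OF has_derivative_frechet[OF schwartz_differentiable[OF f]] t(1)])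
           (use t(2) in \<open>simp add: less_imp_neq[symmetric]\<close>)
      then show "(\<lambda>k. ?D k x) \<longlonglongrightarrow> partial_deriv i f x" by (simp add: partial_deriv_def e_def)
    qed
    \<comment> \<open>By the mean value theorem the quotient is at most the derivative at a point within distance 1 of \<open>x\<close>;
      moving back to \<open>x\<close> costs the factor \<open>2 ^ ?N\<close>.\<close>
    show "AE x in lborel. norm (?D k x * character (- \<xi>) x) \<le> (C * 2 ^ ?N) * inverse ((1 + norm x) ^ ?N)" for k
    proof (rule AE_I2)
      fix x
      have d: "((\<lambda>s. f (s *\<^sub>R e + x)) has_derivative (\<lambda>h. frechet_derivative f (at (s *\<^sub>R e + x)) (h *\<^sub>R e))) (at s)" for s
      proof -
        have "((\<lambda>s. s *\<^sub>R e + x) has_derivative (\<lambda>s. s *\<^sub>R e)) (at s)"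
          by (auto intro!: derivative_eq_intros)
        then show ?thesis
          by (rule has_derivative_compose[OF _ has_derivative_frechet[OF schwartz_differentiable[OF f]]])
      qed
      have "continuous_on {0..t k} (\<lambda>s. f (s *\<^sub>R e + x))"
        using d by (intro has_derivative_continuous_on) (auto intro: has_derivative_at_withinI)
      then obtain s where s: "s \<in> {0<..<t k}"
        "norm (f (t k *\<^sub>R e + x) - f (0 *\<^sub>R e + x)) \<le> norm (frechet_derivative f (at (s *\<^sub>R e + x)) ((t k - 0) *\<^sub>R e))"
        using mvt_general[OF t(2)[of k] _ d] by blast
      have lin: "linear (frechet_derivative f (at (s *\<^sub>R e + x)))"
        using schwartz_differentiable[OF f] by (rule linear_frechet_derivative)
      have "norm (?D k x * character (- \<xi>) x) = (1 / t k) * norm (f (t k *\<^sub>R e + x) - f x)"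
        using t(2)[of k] by (simp add: norm_mult)
      also have "\<dots> \<le> (1 / t k) * (t k * norm (partial_deriv i f (s *\<^sub>R e + x)))"
      proof (rule mult_left_mono)
        have "frechet_derivative f (at (s *\<^sub>R e + x)) ((t k - 0) *\<^sub>R e) = t k *\<^sub>R partial_deriv i f (s *\<^sub>R e + x)"
          unfolding partial_deriv_def e_def[symmetric] by (simp only: linear_scale[OF lin] diff_0_right)
        then show "norm (f (t k *\<^sub>R e + x) - f x) \<le> t k * norm (partial_deriv i f (s *\<^sub>R e + x))"
          using s(2) t(2)[of k] by simp
      qed (use t(2)[of k] in simp)
      also have "\<dots> = norm (partial_deriv i f (s *\<^sub>R e + x))" using t(2)[of k] by simp
      also have "\<dots> \<le> C * inverse ((1 + norm (s *\<^sub>R e + x)) ^ ?N)" by (rule C)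
      also have "\<dots> \<le> C * (2 ^ ?N * inverse ((1 + norm x) ^ ?N))"
      proof (rule mult_left_mono[OF _ C(1)])
        have arith: "1 + a \<le> 2 * (1 + b)" if "a \<le> b + c" "c \<le> 1" "0 \<le> b" for a b c :: real
          using that by simp
        have 1: "norm x \<le> norm (s *\<^sub>R e + x) + norm (s *\<^sub>R e)"
          using norm_triangle_ineq4[of "s *\<^sub>R e + x" "s *\<^sub>R e"] by simp
        have 2: "norm (s *\<^sub>R e) \<le> 1" using s(1) t(3)[of k] e by simp
        have "1 + norm x \<le> 2 * (1 + norm (s *\<^sub>R e + x))"
          by (rule arith[OF 1 2 norm_ge_zero])
        then have le: "(1 + norm x) ^ ?N \<le> 2 ^ ?N * (1 + norm (s *\<^sub>R e + x)) ^ ?N"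
          unfolding power_mult_distrib[symmetric] by (intro power_mono) auto
        have p: "(1 + norm y) ^ ?N > 0" for y :: "real^'n"
          by (intro zero_less_power add_pos_nonneg) auto
        have "inverse b \<le> c * inverse a" if "a \<le> c * b" "a > 0" "b > 0" for a b c :: real
          using that by (simp add: field_simps)
        from this[OF le p p] show "inverse ((1 + norm (s *\<^sub>R e + x)) ^ ?N) \<le> 2 ^ ?N * inverse ((1 + norm x) ^ ?N)" .
      qed
      finally show "norm (?D k x * character (- \<xi>) x) \<le> (C * 2 ^ ?N) * inverse ((1 + norm x) ^ ?N)"
        by (simp only: mult.assoc)
    qed
  qed measurable
  have i: "integrable lborel (\<lambda>x. f x * character (- \<xi>) x)"
    by (intro integrable_character schwartz_integrable f)
  have i': "integrable lborel (\<lambda>x. f (h + x) * character (- \<xi>) x)" for h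
    by (intro integrable_character integrable_lborel_translate schwartz_integrable f)
  have "fourier (?D k) \<xi> = (1 / t k) *\<^sub>R (character \<xi> (t k *\<^sub>R e + 0) - character \<xi> 0) * fourier f \<xi>" for k
  proof -
    have "fourier (?D k) \<xi> = (LINT x|lborel. (1 / t k) *\<^sub>R (f (t k *\<^sub>R e + x) * character (- \<xi>) x - f x * character (- \<xi>) x))"
      unfolding fourier_character by (simp add: left_diff_distrib scaleR_conv_of_real mult.assoc)
    also have "\<dots> = (1 / t k) *\<^sub>R (fourier (\<lambda>x. f (t k *\<^sub>R e + x)) \<xi> - fourier f \<xi>)"
      unfolding fourier_character
      by (subst integral_scaleR_right, subst Bochner_Integration.integral_diff[OF i' i]) simp
    also have "\<dots> = (1 / t k) *\<^sub>R (character \<xi> (t k *\<^sub>R e + 0) - character \<xi> 0) * fourier f \<xi>"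
      by (subst fourier_translate) (simp_all add: character_commute[of "t k *\<^sub>R e"] left_diff_distrib scaleR_diff_right)
    finally show ?thesis .
  qed
  then show "(\<lambda>k. fourier (?D k) \<xi>) \<longlonglongrightarrow> 2 * of_real pi * \<i> * of_real (\<xi> $ i) * fourier f \<xi>"
    using tendsto_mult_right[OF character_difference_quotient[of \<xi> i], of "fourier f \<xi>"]
    by (simp only: t_def e_def)
qed

lemma partial_deriv_fourier:
  fixes f :: "real^'n \<Rightarrow> complex"
  assumes f: "f \<in> schwartz"
  shows "partial_deriv i (fourier f) = fourier (\<lambda>x. (- 2 * of_real pi * \<i> * complex_of_real (x $ i)) * f x)"
proof
  fix \<xi>
  show "partial_deriv i (fourier f) \<xi> = fourier (\<lambda>x. (- 2 * of_real pi * \<i> * complex_of_real (x $ i)) * f x) \<xi>"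
    unfolding partial_deriv_eqI[OF fourier_has_derivative[OF f]] fourier_character
    by (intro Bochner_Integration.integral_cong) (auto simp: inner_axis' mult_ac)
qed

text \<open>Every power of \<open>norm \<xi>\<close> is paid for with one derivative of \<open>f\<close>, coordinate by coordinate.\<close>

lemma fourier_power_bound:
  fixes f :: "real^'n \<Rightarrow> complex"
  assumes "f \<in> schwartz"
  shows "\<exists>C. \<forall>\<xi>. norm \<xi> ^ k * cmod (fourier f \<xi>) \<le> C"
  using assms
proof (induction k arbitrary: f)
  case 0
  then show ?case using cmod_fourier_le by auto
next
  case (Suc k)
  have "\<forall>i. \<exists>C. \<forall>\<xi>. norm \<xi> ^ k * cmod (fourier (partial_deriv i f) \<xi>) \<le> C"
    using Suc by (auto intro: schwartz_partial_deriv)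
  then obtain C where C: "\<And>i \<xi>. norm \<xi> ^ k * cmod (fourier (partial_deriv i f) \<xi>) \<le> C i" by metis
  have "norm \<xi> ^ Suc k * cmod (fourier f \<xi>) \<le> (\<Sum>i\<in>UNIV. C i)" for \<xi>
  proof -
    have "norm \<xi> ^ Suc k * cmod (fourier f \<xi>) \<le> (\<Sum>i\<in>UNIV. \<bar>\<xi> $ i\<bar>) * (norm \<xi> ^ k * cmod (fourier f \<xi>))"
      using mult_right_mono[OF norm_le_l1_cart[of \<xi>], of "norm \<xi> ^ k * cmod (fourier f \<xi>)"] by (simp add: mult.assoc)
    also have "\<dots> = (\<Sum>i\<in>UNIV. norm \<xi> ^ k * (\<bar>\<xi> $ i\<bar> * cmod (fourier f \<xi>)))"
      by (simp add: sum_distrib_right sum_distrib_left mult_ac)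
    also have "\<dots> \<le> (\<Sum>i\<in>UNIV. C i)"
    proof (rule sum_mono)
      fix i
      have "1 * (\<bar>\<xi> $ i\<bar> * cmod (fourier f \<xi>)) \<le> (2 * pi) * (\<bar>\<xi> $ i\<bar> * cmod (fourier f \<xi>))"
        using pi_ge_two by (intro mult_right_mono) auto
      also have "\<dots> = cmod (fourier (partial_deriv i f) \<xi>)"
        by (simp add: fourier_partial_deriv[OF Suc.prems] norm_mult)
      finally have "norm \<xi> ^ k * (\<bar>\<xi> $ i\<bar> * cmod (fourier f \<xi>)) \<le> norm \<xi> ^ k * cmod (fourier (partial_deriv i f) \<xi>)"
        by (intro mult_left_mono) auto
      also have "\<dots> \<le> C i" by (rule C)
      finally show "norm \<xi> ^ k * (\<bar>\<xi> $ i\<bar> * cmod (fourier f \<xi>)) \<le> C i" .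
    qed
    finally show ?thesis .
  qed
  then show ?case by blast
qed

text \<open>The transforms of Schwartz functions form a set to which coinduction applies: a derivative of a transform
  is the transform of the function multiplied by a coordinate.\<close>

lemma schwartz_fourier:
  fixes f :: "real^'n \<Rightarrow> complex"
  assumes "f \<in> schwartz"
  shows "fourier f \<in> schwartz"
proof (rule schwartz_coinduct[of _ "fourier ` schwartz"])
  show "fourier f \<in> fourier ` schwartz" using assms by simp
  fix g :: "real^'n \<Rightarrow> complex" assume "g \<in> fourier ` schwartz"
  then obtain f where f: "f \<in> schwartz" and g: "g = fourier f" by auto
  show "g differentiable (at x)" for x
    unfolding g by (rule differentiableI[OF fourier_has_derivative[OF f]])
  show "partial_deriv i g \<in> fourier ` schwartz" for i
    unfolding g partial_deriv_fourier[OF f]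
    by (intro imageI schwartz_multiplier multiplier_mult multiplier_const multiplier_coord f)
  show "bounded (range (\<lambda>x. norm x ^ k *\<^sub>R g x))" for k
    using fourier_power_bound[OF f, of k] unfolding g bounded_iff by auto
qed

lemma schwartz_inv_fourier: "f \<in> schwartz \<Longrightarrow> inv_fourier f \<in> schwartz"
  using schwartz_reflect[OF schwartz_fourier[of f]] unfolding inv_fourier_eq[abs_def] .

section \<open>Gaussian kernels and Fourier inversion\<close>

text \<open>A rescaling of the characteristic function of the standard normal distribution.\<close>

lemma gaussian_fourier_1d:
  fixes a \<xi> :: real
  assumes a: "a > 0"
  shows "integrable lborel (\<lambda>u. complex_of_real (exp (- a * u\<^sup>2)) * exp (- 2 * of_real pi * \<i> * of_real (u * \<xi>)))"
    and "(LINT u|lborel. complex_of_real (exp (- a * u\<^sup>2)) * exp (- 2 * of_real pi * \<i> * of_real (u * \<xi>)))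
      = complex_of_real (sqrt (pi / a) * exp (- pi\<^sup>2 * \<xi>\<^sup>2 / a))"
proof -
  define c where "c = sqrt (2 * a)"
  have c: "c > 0" "c\<^sup>2 = 2 * a" using a by (auto simp: c_def)
  define t where "t = - 2 * pi * \<xi> / c"
  have char: "(LINT x|lborel. std_normal_density x *\<^sub>R iexp (t * x)) = complex_of_real (exp (- (t\<^sup>2) / 2))"
    using fun_cong[OF char_std_normal_distribution, of t] unfolding char_def
    by (subst (asm) integral_density) (auto simp: normal_density_nonneg)
  have i0: "integrable lborel (\<lambda>x. std_normal_density x *\<^sub>R iexp (t * x))"
    by (rule Bochner_Integration.integrable_bound[OF integrable_normal_density[of 1 0]])
       (auto simp: normal_density_nonneg norm_mult)
  have eq: "std_normal_density (0 + c * u) *\<^sub>R iexp (t * (0 + c * u))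
      = complex_of_real (1 / sqrt (2 * pi)) * (complex_of_real (exp (- a * u\<^sup>2)) * exp (- 2 * of_real pi * \<i> * of_real (u * \<xi>)))" for u
  proof -
    have 1: "t * (0 + c * u) = - 2 * pi * (u * \<xi>)" using c by (simp add: t_def)
    have 2: "- (0 + c * u)\<^sup>2 / 2 = - a * u\<^sup>2" using c by (simp add: power_mult_distrib)
    show ?thesis
      unfolding std_normal_density_def 1 2 by (simp add: scaleR_conv_of_real mult_ac)
  qed
  have "integrable lborel (\<lambda>u. std_normal_density (0 + c * u) *\<^sub>R iexp (t * (0 + c * u)))"
    by (rule lborel_integrable_real_affine[OF i0]) (use c in simp)
  then have "integrable lborel (\<lambda>u. complex_of_real (sqrt (2 * pi)) * (complex_of_real (1 / sqrt (2 * pi)) * (complex_of_real (exp (- a * u\<^sup>2)) * exp (- 2 * of_real pi * \<i> * of_real (u * \<xi>)))))"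
    unfolding eq by (rule integrable_mult_right)
  then show "integrable lborel (\<lambda>u. complex_of_real (exp (- a * u\<^sup>2)) * exp (- 2 * of_real pi * \<i> * of_real (u * \<xi>)))"
    by (simp add: mult.assoc[symmetric])
  let ?I = "LINT u|lborel. complex_of_real (exp (- a * u\<^sup>2)) * exp (- 2 * of_real pi * \<i> * of_real (u * \<xi>))"
  have "complex_of_real (exp (- (t\<^sup>2) / 2)) = \<bar>c\<bar> *\<^sub>R (LINT u|lborel. std_normal_density (0 + c * u) *\<^sub>R iexp (t * (0 + c * u)))"
    unfolding char[symmetric] by (rule lborel_integral_real_affine) (use c in simp)
  also have "\<dots> = complex_of_real (c / sqrt (2 * pi)) * ?I"
    unfolding eq integral_mult_right_zero using c by (simp add: scaleR_conv_of_real)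
  finally have "?I = complex_of_real (exp (- (t\<^sup>2) / 2)) / complex_of_real (c / sqrt (2 * pi))"
    using c by (simp add: field_simps)
  also have "\<dots> = complex_of_real (sqrt (2 * pi) / c * exp (- (t\<^sup>2) / 2))" by simp
  also have "sqrt (2 * pi) / c = sqrt (pi / a)"
    unfolding c_def by (simp add: real_sqrt_mult real_sqrt_divide)
  also have "- (t\<^sup>2) / 2 = - pi\<^sup>2 * \<xi>\<^sup>2 / a"
    using c a by (simp add: t_def power_divide power_mult_distrib)
  finally show "?I = complex_of_real (sqrt (pi / a) * exp (- pi\<^sup>2 * \<xi>\<^sup>2 / a))" .
qed

text \<open>Both the Gaussian and the character are products over the coordinates, and Lebesgue measure is the product
  measure.\<close>

lemma fourier_gaussian:
  fixes \<xi> :: "real^'n"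
  assumes a: "a > 0"
  shows "fourier (gaussian a 0) \<xi> = complex_of_real (sqrt (pi / a) ^ CARD('n) * exp (- pi\<^sup>2 * (norm \<xi>)\<^sup>2 / a))"
proof -
  let ?g = "\<lambda>(b::real^'n) u. complex_of_real (exp (- a * u\<^sup>2)) * exp (- 2 * of_real pi * \<i> * of_real (u * (\<xi> \<bullet> b)))"
  interpret product_sigma_finite "\<lambda>_::real^'n. lborel :: real measure" ..
  have "fourier (gaussian a 0) \<xi> = (LINT x|distr (\<Pi>\<^sub>M b\<in>Basis. lborel) borel (\<lambda>f. \<Sum>b\<in>Basis. f b *\<^sub>R b).
      gaussian a 0 x * exp (- 2 * of_real pi * \<i> * of_real (x \<bullet> \<xi>)))"
    unfolding fourier_def lborel_eq[symmetric] ..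
  also have "\<dots> = (LINT f|(\<Pi>\<^sub>M b\<in>Basis. lborel). gaussian a 0 (\<Sum>b\<in>Basis. f b *\<^sub>R b) * exp (- 2 * of_real pi * \<i> * of_real ((\<Sum>b\<in>Basis. f b *\<^sub>R b) \<bullet> \<xi>)))"
    unfolding gaussian_def by (rule integral_distr) measurable
  also have "\<dots> = (LINT f|(\<Pi>\<^sub>M b\<in>(Basis::(real^'n) set). lborel). (\<Prod>b\<in>Basis. ?g b (f b)))"
  proof (rule Bochner_Integration.integral_cong[OF refl])
    fix f :: "real^'n \<Rightarrow> real"
    let ?x = "\<Sum>b\<in>Basis. f b *\<^sub>R b"
    have "(norm ?x)\<^sup>2 = (\<Sum>b\<in>Basis. (f b)\<^sup>2)"
      by (subst norm_sum_Pythagorean) (auto simp: pairwise_def orthogonal_def inner_Basis intro!: sum.cong)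
    then have 1: "gaussian a 0 ?x = (\<Prod>b\<in>Basis. complex_of_real (exp (- a * (f b)\<^sup>2)))"
      by (simp add: gaussian_def sum_distrib_left exp_sum sum_negf[symmetric] exp_of_real)
    have 2: "exp (- 2 * of_real pi * \<i> * of_real (?x \<bullet> \<xi>)) = (\<Prod>b\<in>Basis. exp (- 2 * of_real pi * \<i> * of_real (f b * (\<xi> \<bullet> b))))"
      by (subst exp_sum[symmetric]) (auto simp: inner_sum_left sum_distrib_left inner_commute[of \<xi>])
    show "gaussian a 0 ?x * exp (- 2 * of_real pi * \<i> * of_real (?x \<bullet> \<xi>)) = (\<Prod>b\<in>Basis. ?g b (f b))"
      unfolding 1 2 prod.distrib ..
  qed
  also have "\<dots> = (\<Prod>b\<in>Basis. LINT u|lborel. ?g b u)"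
    by (rule product_integral_prod[OF finite_Basis gaussian_fourier_1d(1)[OF a]])
  also have "\<dots> = (\<Prod>b\<in>Basis. complex_of_real (sqrt (pi / a) * exp (- pi\<^sup>2 * (\<xi> \<bullet> b)\<^sup>2 / a)))"
    by (intro prod.cong refl gaussian_fourier_1d(2)[OF a])
  also have "\<dots> = complex_of_real (sqrt (pi / a) ^ CARD('n) * (\<Prod>b\<in>Basis. exp (- pi\<^sup>2 * (\<xi> \<bullet> b)\<^sup>2 / a)))"
    by (simp add: prod.distrib)
  also have "(\<Prod>b\<in>Basis. exp (- pi\<^sup>2 * (\<xi> \<bullet> b)\<^sup>2 / a)) = exp (- pi\<^sup>2 * (norm \<xi>)\<^sup>2 / a)"
    by (subst exp_sum[symmetric])
       (auto simp: norm_eq_sqrt_inner euclidean_inner[of \<xi> \<xi>] sum_nonneg power2_eq_square[symmetric] sum_distrib_left sum_divide_distrib sum_negf)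
  finally show ?thesis .
qed


text \<open>An approximate identity of width \<open>1 / (k + 1)\<close>. It is the Fourier transform of the Gaussian with parameter
  \<open>1 / (k + 1)\<^sup>2\<close>, as the next lemma shows. Natural numbers index it because the dominated convergence
  theorem is about sequences.\<close>

definition gauss_kernel :: "nat \<Rightarrow> real^'n \<Rightarrow> real" where
  "gauss_kernel k z = (sqrt pi * real (Suc k)) ^ CARD('n) * exp (- (pi * real (Suc k))\<^sup>2 * (norm z)\<^sup>2)"

lemma gauss_kernel_fourier:
  "fourier (gaussian ((1 / real (Suc k))\<^sup>2) 0) z = complex_of_real (gauss_kernel k z)"
proof -
  have "sqrt (pi / (1 / real (Suc k))\<^sup>2) = sqrt pi * real (Suc k)"
    by (simp add: power_divide real_sqrt_mult del: of_nat_Suc)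
  moreover have "- pi\<^sup>2 * (norm z)\<^sup>2 / (1 / real (Suc k))\<^sup>2 = - (pi * real (Suc k))\<^sup>2 * (norm z)\<^sup>2"
    by (simp add: power_divide power_mult_distrib del: of_nat_Suc)
  ultimately show ?thesis by (subst fourier_gaussian) (auto simp: gauss_kernel_def simp del: of_nat_Suc)
qed

lemma gauss_kernel_measurable [measurable]: "gauss_kernel k \<in> borel_measurable borel"
  unfolding gauss_kernel_def[abs_def] by measurable

lemma gauss_kernel_nonneg: "gauss_kernel k z \<ge> 0"
  by (simp add: gauss_kernel_def)

lemma gauss_kernel_minus: "gauss_kernel k (- z) = gauss_kernel k z"
  by (simp add: gauss_kernel_def)

lemma gauss_kernel_scale:
  fixes z :: "real^'n"
  shows "real (Suc k) ^ CARD('n) * gauss_kernel 0 (real (Suc k) *\<^sub>R z) = gauss_kernel k z"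
  by (simp add: gauss_kernel_def power_mult_distrib mult_ac)

text \<open>The total mass is read off from the value at the origin of another Gaussian's transform.\<close>

lemma gauss_kernel_0:
  shows "integrable lborel (gauss_kernel 0 :: real^'n \<Rightarrow> real)" "(LINT z|lborel. gauss_kernel 0 (z :: real^'n)) = 1"
proof -
  have g: "gaussian (pi\<^sup>2) 0 = (\<lambda>z::real^'n. complex_of_real (exp (- (pi\<^sup>2) * (norm z)\<^sup>2)))"
    by (simp add: gaussian_def[abs_def])
  have k: "gauss_kernel 0 z = sqrt pi ^ CARD('n) * exp (- (pi\<^sup>2) * (norm z)\<^sup>2)" for z :: "real^'n"
    by (simp add: gauss_kernel_def)
  have i: "integrable lborel (gaussian (pi\<^sup>2) 0 :: real^'n \<Rightarrow> complex)"
    by (intro schwartz_integrable gaussian_schwartz) simp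
  then have i': "integrable lborel (\<lambda>z::real^'n. exp (- (pi\<^sup>2) * (norm z)\<^sup>2))"
    unfolding g by (simp only: complex_of_real_integrable_eq)
  then show "integrable lborel (gauss_kernel 0 :: real^'n \<Rightarrow> real)" unfolding k[abs_def] by (rule integrable_mult_right)
  have "complex_of_real (LINT z|lborel. exp (- (pi\<^sup>2) * (norm (z::real^'n))\<^sup>2)) = fourier (gaussian (pi\<^sup>2) 0) (0::real^'n)"
    unfolding fourier_character g by simp
  also have "\<dots> = complex_of_real (sqrt (pi / pi\<^sup>2) ^ CARD('n))"
    by (subst fourier_gaussian) auto
  finally have "(LINT z|lborel. exp (- (pi\<^sup>2) * (norm (z::real^'n))\<^sup>2)) = sqrt (pi / pi\<^sup>2) ^ CARD('n)"
    by (simp only: of_real_eq_iff)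
  then have "(LINT z|lborel. gauss_kernel 0 (z :: real^'n)) = (sqrt pi * sqrt (pi / pi\<^sup>2)) ^ CARD('n)"
    unfolding k by (simp add: power_mult_distrib)
  also have "sqrt pi * sqrt (pi / pi\<^sup>2) = 1"
    by (simp add: real_sqrt_mult[symmetric] power2_eq_square)
  finally show "(LINT z|lborel. gauss_kernel 0 (z :: real^'n)) = 1" by simp
qed

lemma gauss_kernel_integrable: "integrable lborel (gauss_kernel k :: real^'n \<Rightarrow> real)"
proof -
  have "integrable lborel (\<lambda>z::real^'n. real (Suc k) ^ CARD('n) * gauss_kernel 0 (real (Suc k) *\<^sub>R z))"
    by (intro integrable_mult_right integrable_lborel_scaleR gauss_kernel_0) simp
  then show ?thesis by (simp only: gauss_kernel_scale)
qed

lemma gauss_kernel_integral_change: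
  fixes g :: "real^'n \<Rightarrow> 'b::{banach, second_countable_topology}"
  assumes [measurable]: "g \<in> borel_measurable borel"
  shows "(LINT y|lborel. gauss_kernel k (y - x) *\<^sub>R g y) = (LINT z|lborel. gauss_kernel 0 z *\<^sub>R g (x + (1 / real (Suc k)) *\<^sub>R z))"
proof -
  let ?c = "1 / real (Suc k)"
  have m: "(\<lambda>y. gauss_kernel k y *\<^sub>R g (x + y)) \<in> borel_measurable borel" by measurable
  have "(LINT y|lborel. gauss_kernel k (y - x) *\<^sub>R g y) = (LINT y|lborel. gauss_kernel k ((x + y) - x) *\<^sub>R g (x + y))"
    by (rule integral_lborel_translate[symmetric]) measurable
  also have "\<dots> = (LINT y|lborel. gauss_kernel k y *\<^sub>R g (x + y))" by simp
  also have "\<dots> = \<bar>?c\<bar> ^ DIM(real^'n) *\<^sub>R (LINT z|lborel. gauss_kernel k (?c *\<^sub>R z) *\<^sub>R g (x + ?c *\<^sub>R z))"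
    by (rule integral_lborel_scaleR[OF m]) simp
  also have "\<dots> = (LINT z|lborel. (\<bar>?c\<bar> ^ DIM(real^'n) * gauss_kernel k (?c *\<^sub>R z)) *\<^sub>R g (x + ?c *\<^sub>R z))"
    by (simp only: integral_scaleR_right[symmetric] scaleR_scaleR)
  also have "(\<lambda>z::real^'n. \<bar>?c\<bar> ^ DIM(real^'n) * gauss_kernel k (?c *\<^sub>R z)) = gauss_kernel 0"
    by (rule ext) (subst gauss_kernel_scale[symmetric], simp add: power_one_over del: of_nat_Suc)
  finally show ?thesis .
qed

lemma gauss_kernel_integral: "(LINT y|lborel. gauss_kernel k (y - x)) = (1::real)" for x :: "real^'n"
  using gauss_kernel_integral_change[of "\<lambda>_. 1::real" k x] by (simp add: gauss_kernel_0)

text \<open>After a change of variables the kernel is fixed and the dependence on \<open>k\<close> sits in the argument of \<open>g\<close>, where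
  continuity and dominated convergence apply.\<close>

lemma gauss_kernel_approx_identity:
  fixes g :: "real^'n \<Rightarrow> 'b::{banach, second_countable_topology}"
  assumes c: "continuous_on UNIV g" and b: "\<And>x. norm (g x) \<le> B"
  shows "(\<lambda>k. LINT y|lborel. gauss_kernel k (y - x) *\<^sub>R g y) \<longlonglongrightarrow> g x"
proof -
  have [measurable]: "g \<in> borel_measurable borel" by (rule borel_measurable_continuous_onI[OF c])
  have "(\<lambda>k. LINT z|lborel. gauss_kernel 0 z *\<^sub>R g (x + (1 / real (Suc k)) *\<^sub>R z)) \<longlonglongrightarrow> (LINT z|lborel. gauss_kernel 0 (z::real^'n) *\<^sub>R g x)"
  proof (rule integral_dominated_convergence[where w="\<lambda>z. gauss_kernel 0 z * B"])
    show "integrable lborel (\<lambda>z::real^'n. gauss_kernel 0 z * B)" by (intro integrable_mult_left gauss_kernel_0)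
    show "AE z in lborel. (\<lambda>k. gauss_kernel 0 z *\<^sub>R g (x + (1 / real (Suc k)) *\<^sub>R z)) \<longlonglongrightarrow> gauss_kernel 0 z *\<^sub>R g x"
    proof (intro AE_I2 tendsto_intros)
      fix z :: "real^'n"
      have "(\<lambda>k. x + (1 / real (Suc k)) *\<^sub>R z) \<longlonglongrightarrow> x + 0 *\<^sub>R z"
        using LIMSEQ_inverse_real_of_nat by (intro tendsto_intros) (simp add: inverse_eq_divide)
      then show "(\<lambda>k. g (x + (1 / real (Suc k)) *\<^sub>R z)) \<longlonglongrightarrow> g x"
        by (intro isCont_tendsto_compose[of x g]) (use c in \<open>auto simp: continuous_on_eq_continuous_at\<close>)
    qed
    show "AE z in lborel. norm (gauss_kernel 0 z *\<^sub>R g (x + (1 / real (Suc k)) *\<^sub>R z)) \<le> gauss_kernel 0 z * B" for k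
      by (rule AE_I2) (auto simp: gauss_kernel_nonneg intro!: mult_left_mono b)
  qed measurable
  also have "(LINT z|lborel. gauss_kernel 0 (z::real^'n) *\<^sub>R g x) = g x"
    by (subst integral_scaleR_left) (auto simp: gauss_kernel_0)
  finally show ?thesis by (simp only: gauss_kernel_integral_change[OF \<open>g \<in> borel_measurable borel\<close>])
qed

lemma schwartz_bounded: "f \<in> schwartz \<Longrightarrow> \<exists>B. \<forall>x. cmod (f x) \<le> B"
  using schwartz_decay_weighted[of f 0] by simp

lemma gaussian_le_1: "a \<ge> 0 \<Longrightarrow> cmod (gaussian a b x) \<le> 1"
  by (simp add: gaussian_def)

lemma gaussian_tendsto_1: "(\<lambda>k. gaussian ((1 / real (Suc k))\<^sup>2) 0 x) \<longlonglongrightarrow> 1"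
proof -
  have "(\<lambda>k. 1 / real (Suc k)) \<longlonglongrightarrow> 0"
    using LIMSEQ_inverse_real_of_nat by (simp add: inverse_eq_divide)
  then have "(\<lambda>k. complex_of_real (exp (- (1 / real (Suc k))\<^sup>2 * (norm (x - 0))\<^sup>2))) \<longlonglongrightarrow> complex_of_real (exp (- (0\<^sup>2) * (norm (x - 0))\<^sup>2))"
    by (intro tendsto_intros)
  then show ?thesis by (simp add: gaussian_def)
qed

lemma gaussian_integrable: "a > 0 \<Longrightarrow> integrable lborel (gaussian a b)"
  by (intro schwartz_integrable gaussian_schwartz)

text \<open>The inversion integral is a double integral that does not converge absolutely. With a Gaussian factor in
  \<open>\<xi>\<close> it does, and the multiplication formula turns it into an average of \<open>f\<close> against a Gaussian kernel
  centred at \<open>x\<close>. As the Gaussian widens, its transform concentrates at \<open>x\<close>.\<close>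

lemma inv_fourier_fourier:
  fixes f :: "real^'n \<Rightarrow> complex"
  assumes f: "f \<in> schwartz"
  shows "inv_fourier (fourier f) = f"
proof
  fix x
  let ?a = "\<lambda>k. (1 / real (Suc k))\<^sup>2"
  note fi = schwartz_integrable[OF f] and Fi = schwartz_integrable[OF schwartz_fourier[OF f]]
  note [measurable] = schwartz_measurable[OF f] schwartz_measurable[OF schwartz_fourier[OF f]]
  have gm[measurable]: "gaussian a b \<in> borel_measurable borel" for a and b :: "real^'n"
    unfolding gaussian_def[abs_def] by measurable
  have "(LINT \<xi>|lborel. fourier f \<xi> * (gaussian (?a k) 0 \<xi> * character x \<xi>)) = (LINT y|lborel. gauss_kernel k (y - x) *\<^sub>R f y)" for k
  proof -
    have "(LINT \<xi>|lborel. fourier f \<xi> * (gaussian (?a k) 0 \<xi> * character x \<xi>))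
       = (LINT y|lborel. f y * fourier (\<lambda>\<xi>. gaussian (?a k) 0 \<xi> * character x \<xi>) y)"
      by (intro fourier_multiplication_formula fi integrable_character gaussian_integrable) simp
    then show ?thesis
      unfolding fourier_mult_character gauss_kernel_fourier by (simp add: scaleR_conv_of_real mult.commute)
  qed
  moreover have "(\<lambda>k. LINT \<xi>|lborel. fourier f \<xi> * (gaussian (?a k) 0 \<xi> * character x \<xi>)) \<longlonglongrightarrow> inv_fourier (fourier f) x"
    unfolding inv_fourier_character
  proof (rule integral_dominated_convergence)
    show "integrable lborel (\<lambda>\<xi>. cmod (fourier f \<xi>))" using Fi by (rule integrable_norm)
    show "AE \<xi> in lborel. (\<lambda>k. fourier f \<xi> * (gaussian (?a k) 0 \<xi> * character x \<xi>)) \<longlonglongrightarrow> fourier f \<xi> * character x \<xi>"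
      by (intro AE_I2 tendsto_mult_left) (use tendsto_mult_right[OF gaussian_tendsto_1] in fastforce)
    show "AE \<xi> in lborel. norm (fourier f \<xi> * (gaussian (?a k) 0 \<xi> * character x \<xi>)) \<le> cmod (fourier f \<xi>)" for k
      by (intro AE_I2) (auto simp: norm_mult intro!: mult_left_le gaussian_le_1)
  qed measurable
  moreover obtain B where "\<And>x. cmod (f x) \<le> B" using schwartz_bounded[OF f] by blast
  then have "(\<lambda>k. LINT y|lborel. gauss_kernel k (y - x) *\<^sub>R f y) \<longlonglongrightarrow> f x"
    by (intro gauss_kernel_approx_identity schwartz_continuous_on f)
  ultimately show "inv_fourier (fourier f) x = f x"
    using LIMSEQ_unique by (simp only:)
qed

lemma fourier_inv_fourier:
  fixes f :: "real^'n \<Rightarrow> complex"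
  assumes f: "f \<in> schwartz"
  shows "fourier (inv_fourier f) = f"
proof
  fix x
  note [measurable] = schwartz_measurable[OF schwartz_fourier[OF f]]
  have "fourier (inv_fourier f) x = (LINT \<xi>|lborel. fourier f (- \<xi>) * character x (- \<xi>))"
    unfolding fourier_character[of "inv_fourier f"] inv_fourier_eq character_minus ..
  also have "\<dots> = inv_fourier (fourier f) x"
    unfolding inv_fourier_character by (rule integral_lborel_reflect) measurable
  finally show "fourier (inv_fourier f) x = f x" by (simp add: inv_fourier_fourier[OF f])
qed


section \<open>Schwartz functions separate square-integrable functions\<close>

text \<open>The indicator of a nonempty closed set is the pointwise limit of the continuous functions
  \<open>max 0 (1 - k * infdist x C)\<close>.\<close>

lemma set_integral_zero_of_closed:
  fixes F :: "real^'n \<Rightarrow> complex"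
  assumes F: "integrable lborel F"
    and z: "\<And>g::real^'n \<Rightarrow> real. continuous_on UNIV g \<Longrightarrow> (\<And>x. 0 \<le> g x \<and> g x \<le> 1) \<Longrightarrow> (LINT x|lborel. g x *\<^sub>R F x) = 0"
    and C: "closed C"
  shows "set_lebesgue_integral lborel C F = 0"
proof (cases "C = {}")
  case False
  let ?g = "\<lambda>k x. max 0 (1 - real k * infdist x C)"
  have [measurable]: "F \<in> borel_measurable borel" using F by auto
  have [measurable]: "C \<in> sets borel" using C by (rule borel_closed)
  have cont: "continuous_on UNIV (?g k)" for k
    by (intro continuous_intros)
  note [measurable] = borel_measurable_continuous_onI[OF cont]
  have "(\<lambda>k. LINT x|lborel. ?g k x *\<^sub>R F x) \<longlonglongrightarrow> (LINT x|lborel. indicator C x *\<^sub>R F x)"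
  proof (rule integral_dominated_convergence)
    show "(\<lambda>x. indicator C x *\<^sub>R F x) \<in> borel_measurable lborel" by measurable
    show "integrable lborel (\<lambda>x. cmod (F x))" using F by (rule integrable_norm)
    show "AE x in lborel. norm (?g k x *\<^sub>R F x) \<le> cmod (F x)" for k
      by (rule AE_I2) (auto intro!: mult_left_le_one_le simp: infdist_nonneg)
    show "AE x in lborel. (\<lambda>k. ?g k x *\<^sub>R F x) \<longlonglongrightarrow> indicator C x *\<^sub>R F x"
    proof (rule AE_I2, rule tendsto_scaleR)
      fix x
      show "(\<lambda>k. ?g k x) \<longlonglongrightarrow> indicator C x"
      proof (cases "x \<in> C")
        case False
        then have p: "infdist x C > 0"
          using in_closed_iff_infdist_zero[OF C \<open>C \<noteq> {}\<close>] infdist_nonneg[of x C] by (simp add: less_le)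
        obtain N where N: "1 / infdist x C \<le> real N" using real_arch_simple by blast
        have "?g k x = 0" if "k \<ge> N" for k
        proof -
          have "1 / infdist x C \<le> real k" using N that by (meson of_nat_mono order_trans)
          then have "1 \<le> real k * infdist x C" using p by (simp add: divide_le_eq)
          then show ?thesis by simp
        qed
        then have "\<forall>\<^sub>F k in sequentially. ?g k x = 0" by (auto simp: eventually_sequentially)
        then show ?thesis using False by (simp add: tendsto_eventually)
      qed simp
    qed simp
  qed measurable
  moreover have "(LINT x|lborel. ?g k x *\<^sub>R F x) = 0" for k
    by (rule z[OF cont]) (auto simp: infdist_nonneg)
  ultimately show ?thesis by (simp add: set_lebesgue_integral_def LIMSEQ_const_iff)
qed (simp add: set_lebesgue_integral_def)

text \<open>Closed sets are stable under intersection and generate the Borel sets, so by Dynkin's theorem the integral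
  of \<open>F\<close> vanishes over every Borel set.\<close>

lemma AE_zero_of_continuous_tests:
  fixes F :: "real^'n \<Rightarrow> complex"
  assumes F: "integrable lborel F"
    and z: "\<And>g::real^'n \<Rightarrow> real. continuous_on UNIV g \<Longrightarrow> (\<And>x. 0 \<le> g x \<and> g x \<le> 1) \<Longrightarrow> (LINT x|lborel. g x *\<^sub>R F x) = 0"
  shows "AE x in lborel. F x = 0"
proof (rule sigma_finite_measure.density_zero[OF sigma_finite_lborel F])
  fix A :: "(real^'n) set"
  have si: "set_integrable lborel B F" if "B \<in> sets borel" for B
    unfolding set_integrable_def using that by (intro integrable_mult_indicator F) simp
  assume "A \<in> sets lborel"
  then have A: "A \<in> sigma_sets UNIV {C::(real^'n) set. closed C}" by (simp add: borel_eq_closed)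
  have sub: "sigma_sets UNIV {C::(real^'n) set. closed C} = sets borel" by (simp add: borel_eq_closed)
  show "set_lebesgue_integral lborel A F = 0"
  proof (rule sigma_sets_induct_disjoint[OF _ _ A])
    show "Int_stable {C::(real^'n) set. closed C}" by (auto simp: Int_stable_def)
    show "set_lebesgue_integral lborel C F = 0" if "C \<in> {C. closed C}" for C
      using that by (intro set_integral_zero_of_closed[OF F z]) auto
    fix B :: "(real^'n) set" assume B: "B \<in> sigma_sets UNIV {C. closed C}" "set_lebesgue_integral lborel B F = 0"
    have "set_lebesgue_integral lborel (B \<union> (UNIV - B)) F = set_lebesgue_integral lborel B F + set_lebesgue_integral lborel (UNIV - B) F"
      using B sub by (intro set_integral_Un si) auto
    moreover have "set_lebesgue_integral lborel UNIV F = 0"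
      by (intro set_integral_zero_of_closed[OF F z]) auto
    ultimately show "set_lebesgue_integral lborel (UNIV - B) F = 0" using B by simp
  next
    fix B :: "nat \<Rightarrow> (real^'n) set"
    assume B: "disjoint_family B" "range B \<subseteq> sigma_sets UNIV {C. closed C}" "\<And>i. set_lebesgue_integral lborel (B i) F = 0"
    have m: "B i \<in> sets borel" for i using B(2) sub by auto
    have "set_lebesgue_integral lborel (\<Union>i. B i) F = (\<Sum>i. set_lebesgue_integral lborel (B i) F)"
      using B(1) m by (intro lebesgue_integral_countable_add si) (auto simp: disjoint_family_on_def)
    then show "set_lebesgue_integral lborel (\<Union>i. B i) F = 0" using B(3) by simp
  qed (auto simp: set_lebesgue_integral_def)
qed

lemma gauss_kernel_gaussian:
  fixes z :: "real^'n"
  shows "complex_of_real (gauss_kernel k (z - y)) = complex_of_real ((sqrt pi * real (Suc k)) ^ CARD('n)) * gaussian ((pi * real (Suc k))\<^sup>2) y z"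
  by (simp add: gauss_kernel_def gaussian_def)

text \<open>The fixed Gaussian factor makes \<open>f\<close> integrable and is nowhere zero. A kernel times that factor is a Schwartz
  function, so all kernel averages of the product vanish. Letting the kernel concentrate shows that
  the product integrates to zero against every continuous function between 0 and 1.\<close>

lemma L2_zero_of_schwartz_tests:
  fixes f :: "real^'n \<Rightarrow> complex"
  assumes f: "f \<in> Lp_space 2" and z: "\<And>\<phi>. \<phi> \<in> schwartz \<Longrightarrow> (LINT x|lborel. f x * \<phi> x) = 0"
  shows "AE x in lborel. f x = 0"
proof -
  let ?F = "\<lambda>x. f x * gaussian 1 0 x"
  have g1: "gaussian 1 (0::real^'n) \<in> schwartz" by (rule gaussian_schwartz) simp
  have F: "integrable lborel ?F"
    by (intro integrable_mult_L2 f schwartz_Lp_2 g1)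
  have [measurable]: "f \<in> borel_measurable borel" by (rule Lp_space_2_measurable[OF f])
  have [measurable]: "gaussian 1 (0::real^'n) \<in> borel_measurable borel" by (rule schwartz_measurable[OF g1])
  have "AE x in lborel. ?F x = 0"
  proof (rule AE_zero_of_continuous_tests[OF F])
    fix g :: "real^'n \<Rightarrow> real" assume g: "continuous_on UNIV g" "\<And>x. 0 \<le> g x \<and> g x \<le> 1"
    have [measurable]: "g \<in> borel_measurable borel" by (rule borel_measurable_continuous_onI[OF g(1)])
    have "(LINT x|lborel. (LINT y|lborel. gauss_kernel k (y - x) *\<^sub>R g y) *\<^sub>R ?F x) = 0" for k
    proof -
      have ki: "integrable lborel (\<lambda>y::real^'n. gauss_kernel k (y - x) * g y)" for x
      proof (rule Bochner_Integration.integrable_bound)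
        show "integrable lborel (\<lambda>y::real^'n. gauss_kernel k (- x + y))"
          by (rule integrable_lborel_translate[OF gauss_kernel_integrable])
      qed (use g(2) in \<open>auto simp: gauss_kernel_nonneg abs_mult intro!: mult_left_le\<close>)
      have int: "integrable (lborel \<Otimes>\<^sub>M lborel) (\<lambda>(x, y). complex_of_real (gauss_kernel k (y - x) * g y) * ?F x)"
      proof (rule lborel_pair.Fubini_integrable)
        show "(\<lambda>(x, y). complex_of_real (gauss_kernel k (y - x) * g y) * ?F x) \<in> borel_measurable (lborel \<Otimes>\<^sub>M lborel)"
          by measurable
        show "AE x in lborel. integrable lborel (\<lambda>y. case (x, y) of (x, y) \<Rightarrow> complex_of_real (gauss_kernel k (y - x) * g y) * ?F x)"
          unfolding case_prod_conv using ki by (intro AE_I2 integrable_mult_left integrable_of_real)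
        have n: "(LINT y|lborel. cmod (complex_of_real (gauss_kernel k (y - x) * g y) * ?F x)) = (LINT y|lborel. gauss_kernel k (y - x) * g y) * cmod (?F x)" for x
        proof -
          have "cmod (complex_of_real (gauss_kernel k (y - x) * g y) * ?F x) = (gauss_kernel k (y - x) * g y) * cmod (?F x)" for y
            unfolding norm_mult norm_of_real using g(2)[of y] gauss_kernel_nonneg[of k "y - x"] by (simp add: abs_mult)
          then show ?thesis by simp
        qed
        show "integrable lborel (\<lambda>x. LINT y|lborel. norm (case (x, y) of (x, y) \<Rightarrow> complex_of_real (gauss_kernel k (y - x) * g y) * ?F x))"
          unfolding case_prod_conv n
        proof (rule Bochner_Integration.integrable_bound[OF integrable_norm[OF F]])
          have "(LINT y|lborel. gauss_kernel k (y - x) * g y) \<le> (LINT y|lborel. gauss_kernel k (y - x))" for x :: "real^'n"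
            by (rule integral_mono[OF ki]) (use integrable_lborel_translate[OF gauss_kernel_integrable, of k "-x"] g(2) gauss_kernel_nonneg in \<open>auto intro!: mult_left_le\<close>)
          then have "(LINT y|lborel. gauss_kernel k (y - x) * g y) \<le> 1" for x :: "real^'n" by (simp add: gauss_kernel_integral)
          moreover have "0 \<le> (LINT y|lborel. gauss_kernel k (y - x) * g y)" for x
            by (rule Bochner_Integration.integral_nonneg) (simp add: g(2) gauss_kernel_nonneg)
          ultimately show "AE x in lborel. norm ((LINT y|lborel. gauss_kernel k (y - x) * g y) * cmod (?F x)) \<le> norm (cmod (?F x))"
            by (intro AE_I2) (auto simp: abs_mult intro!: mult_left_le_one_le)
        qed measurable
      qed
      \<comment> \<open>For fixed \<open>y\<close>, the product of kernel and Gaussian factor is a Schwartz function of \<open>x\<close>, and \<open>f\<close> integrates to zero against it.\<close>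
      have zero: "(LINT x|lborel. complex_of_real (gauss_kernel k (y - x) * g y) * ?F x) = 0" for y
      proof -
        have "(LINT x|lborel. f x * ((gaussian ((pi * real (Suc k))\<^sup>2) y x * gaussian 1 0 x))) = 0"
          by (intro z schwartz_mult gaussian_schwartz) auto
        then have "complex_of_real ((sqrt pi * real (Suc k)) ^ CARD('n) * g y) * (LINT x|lborel. f x * ((gaussian ((pi * real (Suc k))\<^sup>2) y x * gaussian 1 0 x))) = 0"
          by simp
        moreover have "complex_of_real (gauss_kernel k (y - x) * g y) * ?F x
          = complex_of_real ((sqrt pi * real (Suc k)) ^ CARD('n) * g y) * (f x * ((gaussian ((pi * real (Suc k))\<^sup>2) y x * gaussian 1 0 x)))" for x
        proof -
          have "gauss_kernel k (y - x) = gauss_kernel k (x - y)" using gauss_kernel_minus[of k "x - y"] by simp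
          then show ?thesis unfolding of_real_mult by (simp only: gauss_kernel_gaussian) (simp only: of_real_mult mult_ac)
        qed
        ultimately show ?thesis by (simp only: integral_mult_right_zero)
      qed
      have "(LINT x|lborel. (LINT y|lborel. gauss_kernel k (y - x) *\<^sub>R g y) *\<^sub>R ?F x)
        = (LINT x|lborel. (LINT y|lborel. complex_of_real (gauss_kernel k (y - x) * g y) * ?F x))"
        by (simp add: scaleR_conv_of_real flip: of_real_mult)
      also have "\<dots> = (LINT y|lborel. (LINT x|lborel. complex_of_real (gauss_kernel k (y - x) * g y) * ?F x))"
        by (rule lborel_pair.Fubini_integral[OF int, symmetric])
      finally show ?thesis unfolding zero by simp
    qed
    moreover have "(\<lambda>k. LINT x|lborel. (LINT y|lborel. gauss_kernel k (y - x) *\<^sub>R g y) *\<^sub>R ?F x) \<longlonglongrightarrow> (LINT x|lborel. g x *\<^sub>R ?F x)"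
    proof (rule integral_dominated_convergence)
      show "integrable lborel (\<lambda>x. cmod (?F x))" by (rule integrable_norm[OF F])
      have gb: "norm (g x) \<le> 1" for x using g(2)[of x] by simp
      show "AE x in lborel. (\<lambda>k. (LINT y|lborel. gauss_kernel k (y - x) *\<^sub>R g y) *\<^sub>R ?F x) \<longlonglongrightarrow> g x *\<^sub>R ?F x"
        by (intro AE_I2 tendsto_intros gauss_kernel_approx_identity[OF g(1) gb])
      show "AE x in lborel. norm ((LINT y|lborel. gauss_kernel k (y - x) *\<^sub>R g y) *\<^sub>R ?F x) \<le> cmod (?F x)" for k
      proof (rule AE_I2)
        fix x :: "real^'n"
        have kt: "integrable lborel (\<lambda>y::real^'n. gauss_kernel k (y - x))"
          using integrable_lborel_translate[OF gauss_kernel_integrable, of k "-x"] by simp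
        have "norm (LINT y|lborel. gauss_kernel k (y - x) *\<^sub>R g y) \<le> (LINT y|lborel. norm (gauss_kernel k (y - x) *\<^sub>R g y))"
          by (rule integral_norm_bound)
        also have "\<dots> \<le> (LINT y|lborel. gauss_kernel k (y - x))"
          by (rule integral_mono_AE'[OF kt]) (use gb in \<open>auto simp: gauss_kernel_nonneg abs_mult intro!: mult_left_le\<close>)
        also have "\<dots> = 1" by (rule gauss_kernel_integral)
        finally show "norm ((LINT y|lborel. gauss_kernel k (y - x) *\<^sub>R g y) *\<^sub>R ?F x) \<le> cmod (?F x)"
          by (simp add: mult_left_le_one_le)
      qed
    qed measurable
    ultimately show "(LINT x|lborel. g x *\<^sub>R ?F x) = 0" by (simp add: LIMSEQ_const_iff)
  qed
  then show ?thesis by (auto simp: gaussian_def)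
qed

section \<open>The Fourier transform of square-integrable functions\<close>

lemma ennreal_norm_integral_le:
  fixes f :: "'a \<Rightarrow> 'b::{banach, second_countable_topology}"
  shows "ennreal (norm (integral\<^sup>L M f)) \<le> (\<integral>\<^sup>+x. norm (f x) \<partial>M)"
  by (cases "integrable M f") (auto simp: integral_norm_bound_ennreal not_integrable_integral_eq)

text \<open>Schur's test: \<open>2 a b \<le> a\<^sup>2 + b\<^sup>2\<close>, and the kernel has mass 1 in each of its two variables.\<close>

lemma l2sq_gauss_kernel_pairing:
  fixes u :: "real^'n \<Rightarrow> complex"
  assumes [measurable]: "u \<in> borel_measurable borel"
  shows "(\<integral>\<^sup>+x. \<integral>\<^sup>+y. ennreal (cmod (u x) * (cmod (u y) * gauss_kernel k (y - x))) \<partial>lborel \<partial>lborel) \<le> l2sq u"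
proof -
  let ?h = "\<lambda>x. ennreal ((cmod (u x))\<^sup>2 / 2)"
  have half: "(\<integral>\<^sup>+x. ?h x \<partial>lborel) + (\<integral>\<^sup>+x. ?h x \<partial>lborel) = l2sq u"
    unfolding l2sq_def
    by (subst nn_integral_add[symmetric]) (auto simp: ennreal_plus[symmetric] simp del: ennreal_plus)
  have k1: "(\<integral>\<^sup>+y. ennreal (gauss_kernel k (y - x)) \<partial>lborel) = 1" for x :: "real^'n"
  proof -
    have "integrable lborel (\<lambda>y::real^'n. gauss_kernel k (y - x))"
      using integrable_lborel_translate[OF gauss_kernel_integrable, of k "-x"] by simp
    then show ?thesis by (subst nn_integral_eq_integral) (auto simp: gauss_kernel_nonneg gauss_kernel_integral)
  qed
  have k2: "(\<integral>\<^sup>+x. ennreal (gauss_kernel k (y - x)) \<partial>lborel) = 1" for y :: "real^'n"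
    using k1[of y] gauss_kernel_minus[of k "y - _"] by (simp add: gauss_kernel_minus[of k "y - _", symmetric])
  have "(\<integral>\<^sup>+x. \<integral>\<^sup>+y. ennreal (cmod (u x) * (cmod (u y) * gauss_kernel k (y - x))) \<partial>lborel \<partial>lborel)
    \<le> (\<integral>\<^sup>+x. \<integral>\<^sup>+y. ?h x * ennreal (gauss_kernel k (y - x)) + ?h y * ennreal (gauss_kernel k (y - x)) \<partial>lborel \<partial>lborel)"
  proof (intro nn_integral_mono)
    fix x y :: "real^'n"
    have "cmod (u x) * cmod (u y) \<le> (cmod (u x))\<^sup>2 / 2 + (cmod (u y))\<^sup>2 / 2"
      using sum_squares_bound[of "cmod (u x)" "cmod (u y)"] by simp
    then have "cmod (u x) * cmod (u y) * gauss_kernel k (y - x) \<le> ((cmod (u x))\<^sup>2 / 2 + (cmod (u y))\<^sup>2 / 2) * gauss_kernel k (y - x)"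
      by (rule mult_right_mono) (rule gauss_kernel_nonneg)
    then show "ennreal (cmod (u x) * (cmod (u y) * gauss_kernel k (y - x))) \<le> ?h x * ennreal (gauss_kernel k (y - x)) + ?h y * ennreal (gauss_kernel k (y - x))"
      by (simp add: ennreal_mult[symmetric] ennreal_plus[symmetric] gauss_kernel_nonneg distrib_right mult.assoc ennreal_leI del: ennreal_plus)
  qed
  also have "\<dots> = (\<integral>\<^sup>+x. \<integral>\<^sup>+y. ?h x * ennreal (gauss_kernel k (y - x)) \<partial>lborel \<partial>lborel)
     + (\<integral>\<^sup>+x. \<integral>\<^sup>+y. ?h y * ennreal (gauss_kernel k (y - x)) \<partial>lborel \<partial>lborel)"
    by (subst nn_integral_add[symmetric]) (auto simp: nn_integral_add)
  also have "(\<integral>\<^sup>+x. \<integral>\<^sup>+y. ?h x * ennreal (gauss_kernel k (y - x)) \<partial>lborel \<partial>lborel) = (\<integral>\<^sup>+x. ?h x \<partial>lborel)"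
    by (subst nn_integral_cmult) (auto simp: k1)
  also have "(\<integral>\<^sup>+(x::real^'n). \<integral>\<^sup>+y. ?h y * ennreal (gauss_kernel k (y - x)) \<partial>lborel \<partial>lborel)
    = (\<integral>\<^sup>+y. \<integral>\<^sup>+(x::real^'n). ?h y * ennreal (gauss_kernel k (y - x)) \<partial>lborel \<partial>lborel)"
    by (rule lborel_pair.Fubini') measurable
  also have "\<dots> = (\<integral>\<^sup>+x. ?h x \<partial>lborel)"
    by (subst nn_integral_cmult) (auto simp: k2)
  finally show ?thesis unfolding half .
qed

text \<open>With a Gaussian factor inserted, the multiplication formula, applied twice, rewrites the squared norm of
  the transform as the pairing of \<open>u\<close> with its own kernel average, which Schur's test bounds. Fatou's lemma
  removes the factor. Only the inequality comes out this way; Plancherel's equality will follow because the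
  inverse transform is a contraction too.\<close>

lemma fourier_contraction:
  fixes u :: "real^'n \<Rightarrow> complex"
  assumes u: "integrable lborel u"
  shows "l2sq (fourier u) \<le> l2sq u"
proof -
  have [measurable]: "u \<in> borel_measurable borel" using u by auto
  let ?a = "\<lambda>k. (1 / real (Suc k))\<^sup>2"
  have ga: "?a k > 0" for k by simp
  have [measurable]: "gaussian (a::real) (0::real^'n) \<in> borel_measurable borel" for a
    unfolding gaussian_def[abs_def] by measurable
  define B where "B = (LINT x|lborel. cmod (u x))"
  have B: "cmod (fourier u \<xi>) \<le> B" for \<xi> unfolding B_def by (rule cmod_fourier_le)
  have step: "(\<integral>\<^sup>+\<xi>. ennreal ((cmod (fourier u \<xi>))\<^sup>2 * exp (- ?a k * (norm \<xi>)\<^sup>2)) \<partial>lborel) \<le> l2sq u" for k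
  proof -
    let ?w = "\<lambda>\<xi>. cnj (fourier u \<xi>) * gaussian (?a k) 0 \<xi>"
    have cn: "cnj (fourier u \<xi>) = fourier (\<lambda>x. cnj (u x)) (- \<xi>)" for \<xi>
      unfolding fourier_character by (subst Bochner_Integration.integral_cnj[symmetric]) (simp add: cnj_character)
    have cu: "integrable lborel (\<lambda>x. cnj (u x))" using u by simp
    have [measurable]: "(\<lambda>x. cnj (u x)) \<in> borel_measurable borel" using borel_measurable_integrable[OF cu] by simp
    have [measurable]: "(\<lambda>\<xi>. cnj (fourier u \<xi>)) \<in> borel_measurable borel"
    proof -
      have "(\<lambda>\<xi>. fourier (\<lambda>x. cnj (u x)) (- \<xi>)) \<in> borel_measurable borel"
        by (rule measurable_compose[OF _ fourier_measurable]) measurable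
      then show ?thesis unfolding cn .
    qed
    have B': "norm z * c \<le> \<bar>B * c\<bar>" if "norm z \<le> B" "0 \<le> c" for z c
      using mult_right_mono[OF that] by simp
    have w: "integrable lborel ?w"
    proof (rule Bochner_Integration.integrable_bound)
      show "integrable lborel (\<lambda>\<xi>::real^'n. B * cmod (gaussian (?a k) 0 \<xi>))"
        by (intro integrable_mult_right integrable_norm gaussian_integrable ga)
      show "?w \<in> borel_measurable lborel" by measurable
      show "AE \<xi> in lborel. norm (?w \<xi>) \<le> norm (B * cmod (gaussian (?a k) 0 \<xi>))"
        unfolding norm_mult complex_mod_cnj by (intro AE_I2) (simp only: B'[OF B] norm_ge_zero real_norm_def abs_mult[symmetric])
    qed
    have fw: "fourier ?w x = (LINT y|lborel. cnj (u y) * complex_of_real (gauss_kernel k (y - x)))" for x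
    proof -
      have "fourier ?w x = (LINT \<xi>|lborel. ?w \<xi> * character (- x) \<xi>)"
        by (rule fourier_character)
      also have "\<dots> = (LINT \<xi>|lborel. fourier (\<lambda>x. cnj (u x)) (- \<xi>) * (gaussian (?a k) 0 (- \<xi>) * character x (- \<xi>)))"
        by (simp add: cn character_minus gaussian_def mult.assoc del: of_nat_Suc)
      also have "\<dots> = (LINT \<xi>|lborel. fourier (\<lambda>x. cnj (u x)) \<xi> * (gaussian (?a k) 0 \<xi> * character x \<xi>))"
        by (rule integral_lborel_reflect[of "\<lambda>\<xi>. fourier (\<lambda>x. cnj (u x)) \<xi> * (gaussian (?a k) 0 \<xi> * character x \<xi>)"]) measurable
      also have "\<dots> = (LINT y|lborel. cnj (u y) * fourier (\<lambda>\<xi>. gaussian (?a k) 0 \<xi> * character x \<xi>) y)"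
        by (intro fourier_multiplication_formula cu integrable_character gaussian_integrable ga)
      finally show ?thesis unfolding fourier_mult_character gauss_kernel_fourier .
    qed
    have eq: "fourier u \<xi> * ?w \<xi> = complex_of_real ((cmod (fourier u \<xi>))\<^sup>2 * exp (- ?a k * (norm \<xi>)\<^sup>2))" for \<xi>
      unfolding gaussian_def of_real_mult complex_norm_square by (simp add: mult_ac)
    have ir: "integrable lborel (\<lambda>\<xi>. (cmod (fourier u \<xi>))\<^sup>2 * exp (- ?a k * (norm \<xi>)\<^sup>2))"
    proof -
      have "integrable lborel (\<lambda>\<xi>. fourier u \<xi> * ?w \<xi>)"
      proof (rule Bochner_Integration.integrable_bound)
        show "integrable lborel (\<lambda>\<xi>. B * cmod (?w \<xi>))"
          by (intro integrable_mult_right integrable_norm w)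
        show "(\<lambda>\<xi>. fourier u \<xi> * ?w \<xi>) \<in> borel_measurable lborel" by measurable
        show "AE \<xi> in lborel. norm (fourier u \<xi> * ?w \<xi>) \<le> norm (B * cmod (?w \<xi>))"
          unfolding norm_mult[of "fourier u _"] by (intro AE_I2) (simp only: B'[OF B] norm_ge_zero real_norm_def)
      qed
      then show ?thesis unfolding eq complex_of_real_integrable_eq .
    qed
    have "(\<integral>\<^sup>+\<xi>. ennreal ((cmod (fourier u \<xi>))\<^sup>2 * exp (- ?a k * (norm \<xi>)\<^sup>2)) \<partial>lborel)
      = ennreal (LINT \<xi>|lborel. (cmod (fourier u \<xi>))\<^sup>2 * exp (- ?a k * (norm \<xi>)\<^sup>2))"
      by (rule nn_integral_eq_integral[OF ir]) simp
    also have "\<dots> = ennreal (cmod (LINT \<xi>|lborel. fourier u \<xi> * ?w \<xi>))"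
      unfolding eq by (subst integral_complex_of_real) simp
    also have "(LINT \<xi>|lborel. fourier u \<xi> * ?w \<xi>) = (LINT x|lborel. u x * fourier ?w x)"
      by (rule fourier_multiplication_formula[OF u w])
    also have "ennreal (cmod \<dots>) \<le> (\<integral>\<^sup>+x. cmod (u x * fourier ?w x) \<partial>lborel)"
      by (rule ennreal_norm_integral_le)
    also have "\<dots> = (\<integral>\<^sup>+x. ennreal (cmod (u x)) * ennreal (cmod (fourier ?w x)) \<partial>lborel)"
      by (simp add: norm_mult ennreal_mult)
    also have "\<dots> \<le> (\<integral>\<^sup>+x. ennreal (cmod (u x)) * (\<integral>\<^sup>+y. ennreal (cmod (u y) * gauss_kernel k (y - x)) \<partial>lborel) \<partial>lborel)"
    proof (intro nn_integral_mono mult_left_mono)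
      fix x :: "real^'n"
      show "ennreal (cmod (fourier ?w x)) \<le> (\<integral>\<^sup>+y. ennreal (cmod (u y) * gauss_kernel k (y - x)) \<partial>lborel)"
        unfolding fw by (rule order.trans[OF ennreal_norm_integral_le]) (simp add: norm_mult gauss_kernel_nonneg)
    qed simp
    also have "\<dots> = (\<integral>\<^sup>+x. \<integral>\<^sup>+y. ennreal (cmod (u x) * (cmod (u y) * gauss_kernel k (y - x))) \<partial>lborel \<partial>lborel)"
      by (subst nn_integral_cmult[symmetric]) (auto simp: ennreal_mult gauss_kernel_nonneg)
    also have "\<dots> \<le> l2sq u" by (rule l2sq_gauss_kernel_pairing) measurable
    finally show ?thesis .
  qed
  show ?thesis
  proof (rule l2sq_Fatou)
    let ?v = "\<lambda>k \<xi>. fourier u \<xi> * complex_of_real (exp (- ?a k / 2 * (norm \<xi>)\<^sup>2))"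
    show "?v k \<in> borel_measurable borel" for k by measurable
    have "(\<lambda>k. ?v k \<xi>) \<longlonglongrightarrow> fourier u \<xi> * complex_of_real (exp (- (0\<^sup>2) / 2 * (norm \<xi>)\<^sup>2))" for \<xi>
    proof -
      have "(\<lambda>k. 1 / real (Suc k)) \<longlonglongrightarrow> 0"
        using LIMSEQ_inverse_real_of_nat by (simp add: inverse_eq_divide)
      then show ?thesis by (intro tendsto_intros) simp_all
    qed
    then show "AE \<xi> in lborel. (\<lambda>k. ?v k \<xi>) \<longlonglongrightarrow> fourier u \<xi>" by simp
    show "l2sq (?v k) \<le> l2sq u" for k
    proof -
      have "(cmod (?v k \<xi>))\<^sup>2 = (cmod (fourier u \<xi>))\<^sup>2 * exp (- ?a k * (norm \<xi>)\<^sup>2)" for \<xi>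
      proof -
        have "(exp (- ?a k / 2 * (norm \<xi>)\<^sup>2))\<^sup>2 = exp (- ?a k * (norm \<xi>)\<^sup>2)"
          by (subst exp_double[symmetric]) simp
        then show ?thesis by (simp only: norm_mult norm_of_real power_mult_distrib abs_exp_cancel)
      qed
      then show ?thesis unfolding l2sq_def[of "?v k"] using step[of k] by (simp only:)
    qed
  qed
qed


text \<open>The Fourier transform of a square-integrable function, characterized by the duality that defines the
  transform of a tempered distribution. It is a relation because the transform is determined only up to a
  null set.\<close>

definition l2_fourier :: "(real^'n \<Rightarrow> complex) \<Rightarrow> (real^'n \<Rightarrow> complex) \<Rightarrow> bool" where
  "l2_fourier u v \<longleftrightarrow> u \<in> Lp_space 2 \<and> v \<in> Lp_space 2 \<and>
     (\<forall>\<phi>\<in>schwartz. (LINT \<xi>|lborel. v \<xi> * \<phi> \<xi>) = (LINT x|lborel. u x * fourier \<phi> x))"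

lemma indicator_ball_Lp_2: "(\<lambda>x::real^'n. indicator (ball 0 r) x :: complex) \<in> Lp_space 2"
proof -
  have "l2sq (\<lambda>x::real^'n. indicator (ball 0 r) x :: complex) = (\<integral>\<^sup>+x. indicator (ball (0::real^'n) r) x \<partial>lborel)"
    unfolding l2sq_def by (intro nn_integral_cong) (auto simp: indicator_def)
  also have "\<dots> = emeasure lborel (ball (0::real^'n) r)" by simp
  also have "\<dots> < \<infinity>" by (rule emeasure_lborel_ball_finite)
  finally show ?thesis by (simp add: Lp_space_2_iff borel_measurable_indicator)
qed

lemma truncation_converges:
  fixes u :: "real^'n \<Rightarrow> complex"
  assumes u: "u \<in> Lp_space 2"
  shows "(\<lambda>k. l2sq (\<lambda>x. u x - indicator (ball 0 (real k)) x * u x)) \<longlonglongrightarrow> 0"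
proof -
  note [measurable] = Lp_space_2_measurable[OF u]
  have [measurable]: "ball (0::real^'n) r \<in> sets borel" for r by simp
  have "(\<lambda>k. \<integral>\<^sup>+x. ennreal ((cmod (u x - indicator (ball 0 (real k)) x * u x))\<^sup>2) \<partial>lborel) \<longlonglongrightarrow> (\<integral>\<^sup>+(x::real^'n). 0 \<partial>lborel)"
  proof (rule nn_integral_dominated_convergence[where w="\<lambda>x. ennreal ((cmod (u x))\<^sup>2)"])
    show "(\<integral>\<^sup>+x. ennreal ((cmod (u x))\<^sup>2) \<partial>lborel) < \<infinity>"
      using u by (simp add: Lp_space_2_iff l2sq_def)
    show "AE x in lborel. ennreal ((cmod (u x - indicator (ball 0 (real k)) x * u x))\<^sup>2) \<le> ennreal ((cmod (u x))\<^sup>2)" for k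
      by (intro AE_I2) (auto simp: indicator_def)
    show "AE x in lborel. (\<lambda>k. ennreal ((cmod (u x - indicator (ball 0 (real k)) x * u x))\<^sup>2)) \<longlonglongrightarrow> 0"
    proof (rule AE_I2)
      fix x :: "real^'n"
      obtain N :: nat where N: "norm x < real N" using reals_Archimedean2 by blast
      have "ennreal ((cmod (u x - indicator (ball 0 (real k)) x * u x))\<^sup>2) = 0" if "k \<ge> N" for k
        using N that by (auto simp: indicator_def)
      then show "(\<lambda>k. ennreal ((cmod (u x - indicator (ball 0 (real k)) x * u x))\<^sup>2)) \<longlonglongrightarrow> 0"
        by (intro tendsto_eventually) (auto simp: eventually_sequentially)
    qed
  qed measurable
  then show ?thesis by (simp add: l2sq_def)
qed

lemma integral_mult_L2_tendsto:
  assumes f: "\<And>k. f k \<in> Lp_space 2" and g: "g \<in> Lp_space 2" and h: "h \<in> Lp_space 2"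
    and lim: "(\<lambda>k. l2sq (\<lambda>x. g x - f k x)) \<longlonglongrightarrow> 0"
  shows "(\<lambda>k. LINT x|lborel. f k x * h x) \<longlonglongrightarrow> (LINT x|lborel. g x * h x)"
proof -
  have fin: "(\<lambda>x. g x - f k x) \<in> Lp_space 2" for k by (intro Lp_space_2_diff f g)
  have "(\<lambda>k. l2sq (\<lambda>x. g x - f k x)) \<longlonglongrightarrow> ennreal 0" using lim by simp
  then have e: "(\<lambda>k. enn2real (l2sq (\<lambda>x. g x - f k x))) \<longlonglongrightarrow> 0"
    by (rule tendsto_enn2real) simp
  have l: "(\<lambda>k. sqrt (enn2real (l2sq (\<lambda>x. g x - f k x))) * sqrt (enn2real (l2sq h))) \<longlonglongrightarrow> sqrt 0 * sqrt (enn2real (l2sq h))"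
    by (rule tendsto_mult[OF tendsto_real_sqrt[OF e] tendsto_const])
  have "(\<lambda>k. LINT x|lborel. (g x - f k x) * h x) \<longlonglongrightarrow> 0"
    by (rule Lim_null_comparison[OF _ l[simplified]])
       (intro always_eventually allI integral_mult_L2_le fin h)
  moreover have "(LINT x|lborel. (g x - f k x) * h x) = (LINT x|lborel. g x * h x) - (LINT x|lborel. f k x * h x)" for k
    by (rule integral_diff_mult_L2[OF g f h])
  ultimately have "(\<lambda>k. (LINT x|lborel. g x * h x) - (LINT x|lborel. f k x * h x)) \<longlonglongrightarrow> 0" by simp
  from tendsto_diff[OF tendsto_const[of "LINT x|lborel. g x * h x"] this] show ?thesis by simp
qed

text \<open>Truncations of \<open>u\<close> to balls are integrable, so the integral defines their transforms, and by the contraction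
  property these form a Cauchy sequence when the truncations do. The limit inherits the duality with
  Schwartz functions.\<close>

lemma l2_fourier_exists:
  fixes u :: "real^'n \<Rightarrow> complex"
  assumes u: "u \<in> Lp_space 2"
  shows "\<exists>v. l2_fourier u v \<and> l2sq v \<le> l2sq u"
proof -
  note [measurable] = Lp_space_2_measurable[OF u]
  have "\<exists>K. l2sq (\<lambda>x. u x - indicator (ball 0 (real K)) x * u x) \<le> ennreal ((1/8) ^ j)" for j :: nat
  proof -
    have "\<forall>\<^sub>F k in sequentially. l2sq (\<lambda>x. u x - indicator (ball 0 (real k)) x * u x) < ennreal ((1/8) ^ j)"
      by (rule order_tendstoD(2)[OF truncation_converges[OF u]]) simp
    then obtain N where "\<forall>k\<ge>N. l2sq (\<lambda>x. u x - indicator (ball 0 (real k)) x * u x) < ennreal ((1/8) ^ j)"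
      unfolding eventually_sequentially by blast
    then show ?thesis by (intro exI[of _ N]) (simp add: less_imp_le)
  qed
  \<comment> \<open>The radii are chosen so as to reach the geometric rate that \<open>L2_limit_exists\<close> asks for.\<close>
  then obtain K where K: "\<And>j. l2sq (\<lambda>x. u x - indicator (ball 0 (real (K j))) x * u x) \<le> ennreal ((1/8) ^ j)"
    by metis
  define U where "U j x = indicator (ball 0 (real (K j))) x * u x" for j x
  have UL1: "integrable lborel (U j)" for j
    unfolding U_def[abs_def] by (rule integrable_mult_L2[OF indicator_ball_Lp_2 u])
  have Um[measurable]: "U j \<in> borel_measurable borel" for j using UL1[of j] by auto
  have Ule: "l2sq (U j) \<le> l2sq u" for j
    by (rule l2sq_mono) (auto simp: U_def indicator_def)
  have UL2: "U j \<in> Lp_space 2" for j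
    using Ule[of j] u by (auto simp: Lp_space_2_iff intro: le_less_trans)
  have Ud: "l2sq (\<lambda>x. u x - U j x) \<le> ennreal ((1/8) ^ j)" for j
    using K[of j] by (simp add: U_def)
  define V where "V j = fourier (U j)" for j
  have Vm[measurable]: "V j \<in> borel_measurable borel" for j unfolding V_def by (rule fourier_measurable[OF Um])
  have Vle: "l2sq (V j) \<le> l2sq u" for j
    unfolding V_def by (rule order.trans[OF fourier_contraction[OF UL1] Ule])
  have VL2: "V j \<in> Lp_space 2" for j
    using Vle[of j] u by (auto simp: Lp_space_2_iff intro: le_less_trans)
  have dist: "l2sq (\<lambda>x. V i x - V j x) \<le> ennreal (4 * (1/8) ^ j)" if "j \<le> i" for i j
  proof -
    have "(\<lambda>x. V i x - V j x) = fourier (\<lambda>x. U i x - U j x)"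
      unfolding V_def fourier_character[abs_def]
      by (subst Bochner_Integration.integral_diff[symmetric, OF integrable_character[OF UL1] integrable_character[OF UL1]])
         (simp add: left_diff_distrib)
    then have "l2sq (\<lambda>x. V i x - V j x) \<le> l2sq (\<lambda>x. U i x - U j x)"
      by (simp only: fourier_contraction[OF Bochner_Integration.integrable_diff[OF UL1 UL1]])
    also have "(\<lambda>x. U i x - U j x) = (\<lambda>x. (u x - U j x) - (u x - U i x))" by auto
    also have "l2sq \<dots> \<le> 2 * l2sq (\<lambda>x. u x - U j x) + 2 * l2sq (\<lambda>x. u x - U i x)"
      by (rule l2sq_diff_le) measurable
    also have "\<dots> \<le> 2 * ennreal ((1/8) ^ j) + 2 * ennreal ((1/8) ^ j)"
    proof (intro add_mono mult_left_mono Ud)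
      have "((1/8)::real) ^ i \<le> (1/8) ^ j" using that by (intro power_decreasing) auto
      then show "l2sq (\<lambda>x. u x - U i x) \<le> ennreal ((1/8) ^ j)"
        using Ud[of i] by (meson ennreal_leI order_trans)
    qed auto
    also have "\<dots> = ennreal (2 * (1/8) ^ j + 2 * (1/8) ^ j)"
      by (subst ennreal_plus) (simp_all add: ennreal_mult)
    finally show ?thesis by simp
  qed
  obtain w where w[measurable]: "w \<in> borel_measurable borel" and ae: "AE x in lborel. (\<lambda>j. V j x) \<longlonglongrightarrow> w x"
    and wd: "\<And>j. l2sq (\<lambda>x. w x - V j x) \<le> ennreal (4 * (1/8) ^ j)"
    using L2_limit_exists[of V 4, OF Vm dist] by blast
  have wle: "l2sq w \<le> l2sq u" by (rule l2sq_Fatou[OF Vm ae Vle])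
  then have wL2: "w \<in> Lp_space 2" using u w by (auto simp: Lp_space_2_iff intro: le_less_trans)
  have to0: "(\<lambda>j. ennreal (c * (1/8) ^ j)) \<longlonglongrightarrow> 0" for c
  proof -
    have "(\<lambda>j. c * (1/8::real) ^ j) \<longlonglongrightarrow> c * 0"
      by (intro tendsto_intros LIMSEQ_power_zero) simp
    from tendsto_ennrealI[OF this] show ?thesis by simp
  qed
  have "(LINT \<xi>|lborel. w \<xi> * \<phi> \<xi>) = (LINT x|lborel. u x * fourier \<phi> x)" if \<phi>: "\<phi> \<in> schwartz" for \<phi>
  proof (rule LIMSEQ_unique)
    show "(\<lambda>j. LINT \<xi>|lborel. V j \<xi> * \<phi> \<xi>) \<longlonglongrightarrow> (LINT \<xi>|lborel. w \<xi> * \<phi> \<xi>)"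
      by (rule integral_mult_L2_tendsto[OF VL2 wL2 schwartz_Lp_2[OF \<phi>]])
         (rule tendsto_sandwich[OF always_eventually[OF allI[OF zero_le]] always_eventually[OF allI[OF wd]] tendsto_const to0])
    have "(\<lambda>j. LINT x|lborel. U j x * fourier \<phi> x) \<longlonglongrightarrow> (LINT x|lborel. u x * fourier \<phi> x)"
      by (rule integral_mult_L2_tendsto[OF UL2 u schwartz_Lp_2[OF schwartz_fourier[OF \<phi>]]])
         (rule tendsto_sandwich[OF always_eventually[OF allI[OF zero_le]] always_eventually[OF allI[OF Ud]] tendsto_const to0[of 1, simplified]])
    then show "(\<lambda>j. LINT \<xi>|lborel. V j \<xi> * \<phi> \<xi>) \<longlonglongrightarrow> (LINT x|lborel. u x * fourier \<phi> x)"
      unfolding V_def by (simp only: fourier_multiplication_formula[OF UL1 schwartz_integrable[OF \<phi>]])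
  qed
  then show ?thesis using u wL2 wle unfolding l2_fourier_def by blast
qed

lemma AE_eq_of_schwartz_tests:
  fixes f g :: "real^'n \<Rightarrow> complex"
  assumes f: "f \<in> Lp_space 2" and g: "g \<in> Lp_space 2"
    and eq: "\<And>\<phi>. \<phi> \<in> schwartz \<Longrightarrow> (LINT x|lborel. f x * \<phi> x) = (LINT x|lborel. g x * \<phi> x)"
  shows "AE x in lborel. f x = g x"
proof -
  have "AE x in lborel. f x - g x = 0"
  proof (rule L2_zero_of_schwartz_tests[OF Lp_space_2_diff[OF f g]])
    fix \<phi> :: "real^'n \<Rightarrow> complex" assume \<phi>: "\<phi> \<in> schwartz"
    have "(LINT x|lborel. (f x - g x) * \<phi> x) = (LINT x|lborel. f x * \<phi> x) - (LINT x|lborel. g x * \<phi> x)"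
      by (rule integral_diff_mult_L2[OF f g schwartz_Lp_2[OF \<phi>]])
    then show "(LINT x|lborel. (f x - g x) * \<phi> x) = 0" using eq[OF \<phi>] by simp
  qed
  then show ?thesis by simp
qed

lemma l2_fourier_inverse_pairing:
  assumes uv: "l2_fourier u v" and \<phi>: "\<phi> \<in> schwartz"
  shows "(LINT x|lborel. u x * \<phi> x) = (LINT \<xi>|lborel. v \<xi> * inv_fourier \<phi> \<xi>)"
  using uv schwartz_inv_fourier[OF \<phi>] by (auto simp: l2_fourier_def fourier_inv_fourier[OF \<phi>])

lemma l2_fourier_le:
  assumes "l2_fourier u v"
  shows "l2sq v \<le> l2sq u"
proof -
  obtain w where w: "l2_fourier u w" "l2sq w \<le> l2sq u"
    using l2_fourier_exists assms unfolding l2_fourier_def by blast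
  have "AE x in lborel. v x = w x"
    using assms w by (intro AE_eq_of_schwartz_tests) (auto simp: l2_fourier_def)
  then show ?thesis using w l2sq_cong_AE by metis
qed

text \<open>The inverse transform is the transform followed by a reflection; inversion on the Schwartz space, applied
  to the test function, shows that it is a right inverse.\<close>

lemma l2_fourier_surj:
  fixes v :: "real^'n \<Rightarrow> complex"
  assumes v: "v \<in> Lp_space 2"
  shows "\<exists>u. l2_fourier u v \<and> l2sq u \<le> l2sq v"
proof -
  obtain w where w: "l2_fourier v w" "l2sq w \<le> l2sq v" using l2_fourier_exists[OF v] by blast
  then have [measurable]: "w \<in> borel_measurable borel" by (auto simp: l2_fourier_def Lp_space_2_iff)
  let ?u = "\<lambda>x. w (- x)"
  have l: "l2sq ?u = l2sq w"
    unfolding l2sq_def by (rule nn_integral_lborel_reflect) measurable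
  have "?u \<in> Lp_space 2"
    using w l by (auto simp: l2_fourier_def Lp_space_2_iff)
  moreover have "(LINT \<xi>|lborel. v \<xi> * \<phi> \<xi>) = (LINT x|lborel. ?u x * fourier \<phi> x)" if \<phi>: "\<phi> \<in> schwartz" for \<phi>
  proof -
    note [measurable] = schwartz_measurable[OF schwartz_inv_fourier[OF \<phi>]]
    have "(LINT x|lborel. ?u x * fourier \<phi> x) = (LINT x|lborel. w (- x) * inv_fourier \<phi> (- x))"
      by (simp add: inv_fourier_eq)
    also have "\<dots> = (LINT x|lborel. w x * inv_fourier \<phi> x)"
      by (rule integral_lborel_reflect[of "\<lambda>x. w x * inv_fourier \<phi> x"]) measurable
    also have "\<dots> = (LINT \<xi>|lborel. v \<xi> * \<phi> \<xi>)"
      using w schwartz_inv_fourier[OF \<phi>] by (auto simp: l2_fourier_def fourier_inv_fourier[OF \<phi>])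
    finally show ?thesis by simp
  qed
  ultimately have "l2_fourier ?u v" using v by (auto simp: l2_fourier_def)
  then show ?thesis using l w by auto
qed

text \<open>Both the transform and its inverse are contractions, and a function is determined by its transform since
  transforms of Schwartz functions exhaust the Schwartz space.\<close>

lemma plancherel:
  assumes uv: "l2_fourier u v"
  shows "l2sq v = l2sq u"
proof (rule antisym[OF l2_fourier_le[OF uv]])
  obtain u' where u': "l2_fourier u' v" "l2sq u' \<le> l2sq v"
    using l2_fourier_surj uv unfolding l2_fourier_def by blast
  have "AE x in lborel. u x = u' x"
  proof (rule AE_eq_of_schwartz_tests)
    fix \<phi> :: "real^'a \<Rightarrow> complex" assume "\<phi> \<in> schwartz"
    then show "(LINT x|lborel. u x * \<phi> x) = (LINT x|lborel. u' x * \<phi> x)"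
      by (simp add: l2_fourier_inverse_pairing[OF uv] l2_fourier_inverse_pairing[OF u'(1)])
  qed (use uv u' in \<open>auto simp: l2_fourier_def\<close>)
  then show "l2sq u \<le> l2sq v" using u'(2) l2sq_cong_AE by metis
qed

lemma l2sq_translate:
  fixes u :: "real^'n \<Rightarrow> complex"
  assumes [measurable]: "u \<in> borel_measurable borel"
  shows "l2sq (\<lambda>x. u (h + x)) = l2sq u"
  unfolding l2sq_def by (rule nn_integral_lborel_translate[of "\<lambda>x. ennreal ((cmod (u x))\<^sup>2)"]) measurable

text \<open>A translation of \<open>u\<close> can be moved to the test function, where it amounts to multiplication of the untransformed
  test function by a character.\<close>

lemma l2_fourier_difference:
  fixes u :: "real^'n \<Rightarrow> complex"
  assumes uv: "l2_fourier u v"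
  shows "l2_fourier (\<lambda>x. u (h + x) - u x) (\<lambda>\<xi>. (character h \<xi> - 1) * v \<xi>)"
proof -
  have u: "u \<in> Lp_space 2" and v: "v \<in> Lp_space 2" using uv by (auto simp: l2_fourier_def)
  note [measurable] = Lp_space_2_measurable[OF u] Lp_space_2_measurable[OF v]
  have uh: "(\<lambda>x. u (h + x)) \<in> Lp_space 2"
    using u by (auto simp: Lp_space_2_iff l2sq_translate)
  have d: "(\<lambda>x. u (h + x) - u x) \<in> Lp_space 2" by (rule Lp_space_2_diff[OF uh u])
  have "cmod (character h \<xi> - 1) \<le> 2" for \<xi>
    using norm_triangle_ineq4[of "character h \<xi>" 1] by simp
  then have cv: "(\<lambda>\<xi>. (character h \<xi> - 1) * v \<xi>) \<in> Lp_space 2"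
    by (intro Lp_space_2_bounded_mult[OF v]) measurable
  have "(LINT \<xi>|lborel. ((character h \<xi> - 1) * v \<xi>) * \<phi> \<xi>) = (LINT x|lborel. (u (h + x) - u x) * fourier \<phi> x)"
    if \<phi>: "\<phi> \<in> schwartz" for \<phi>
  proof -
    have c\<phi>: "(\<lambda>\<xi>. character h \<xi> * \<phi> \<xi>) \<in> schwartz"
      by (rule schwartz_multiplier[OF character_multiplier \<phi>])
    note F = schwartz_fourier[OF \<phi>]
    note [measurable] = schwartz_measurable[OF F]
    have "(LINT x|lborel. (u (h + x) - u x) * fourier \<phi> x) = (LINT x|lborel. u (h + x) * fourier \<phi> x) - (LINT x|lborel. u x * fourier \<phi> x)"
      by (rule integral_diff_mult_L2[OF uh u schwartz_Lp_2[OF F]])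
    also have "(LINT x|lborel. u (h + x) * fourier \<phi> x) = (LINT x|lborel. u (h + x) * fourier \<phi> ((h + x) - h))" by simp
    also have "\<dots> = (LINT x|lborel. u x * fourier \<phi> (x - h))"
      by (rule integral_lborel_translate[of "\<lambda>x. u x * fourier \<phi> (x - h)"]) measurable
    also have "\<dots> = (LINT x|lborel. u x * fourier (\<lambda>\<xi>. character h \<xi> * \<phi> \<xi>) x)"
      unfolding fourier_mult_character[symmetric] by (simp only: mult.commute)
    also have "\<dots> = (LINT \<xi>|lborel. v \<xi> * (character h \<xi> * \<phi> \<xi>))"
      using uv c\<phi> by (auto simp: l2_fourier_def)
    also have "(LINT x|lborel. u x * fourier \<phi> x) = (LINT \<xi>|lborel. v \<xi> * \<phi> \<xi>)"
      using uv \<phi> by (auto simp: l2_fourier_def)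
    also have "(LINT \<xi>|lborel. v \<xi> * (character h \<xi> * \<phi> \<xi>)) - (LINT \<xi>|lborel. v \<xi> * \<phi> \<xi>)
      = (LINT \<xi>|lborel. ((character h \<xi> - 1) * v \<xi>) * \<phi> \<xi>)"
      using integral_diff_mult_L2[OF schwartz_Lp_2[OF c\<phi>] schwartz_Lp_2[OF \<phi>] v] by (simp add: algebra_simps)
    finally show ?thesis by simp
  qed
  then show ?thesis using d cv by (auto simp: l2_fourier_def)
qed


section \<open>The Gagliardo energy on the Fourier side\<close>

text \<open>The Fourier symbol of the Gagliardo energy. By scaling and rotation it is a constant multiple of
  \<open>norm \<xi> powr (2 * s)\<close>; bounds of this order suffice, and they spare the computation of the constant.\<close>

definition symbol_energy :: "real \<Rightarrow> real^'n \<Rightarrow> ennreal" where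
  "symbol_energy s \<xi> = (\<integral>\<^sup>+h. ennreal ((cmod (character h \<xi> - 1))\<^sup>2 / norm h powr (real CARD('n) + 2 * s)) \<partial>lborel)"

lemma cmod_character_minus_1_sq_le: "(cmod (character h \<xi> - 1))\<^sup>2 \<le> 4 * min 1 ((pi * norm \<xi> * norm h)\<^sup>2)"
proof -
  let ?t = "2 * pi * (h \<bullet> \<xi>)"
  have "cmod (character h \<xi> - 1) \<le> 2"
    using norm_triangle_ineq4[of "character h \<xi>" 1] by simp
  then have 1: "(cmod (character h \<xi> - 1))\<^sup>2 \<le> 2\<^sup>2" by (rule power_mono) simp
  have "cmod (character h \<xi> - 1) \<le> \<bar>?t\<bar>"
    using iexp_approx1[of ?t 0] by (simp add: character_def mult_ac)
  also have "\<dots> = 2 * pi * \<bar>h \<bullet> \<xi>\<bar>" by (simp add: abs_mult)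
  also have "\<dots> \<le> 2 * pi * (norm h * norm \<xi>)"
    by (intro mult_left_mono Cauchy_Schwarz_ineq2) auto
  finally have "(cmod (character h \<xi> - 1))\<^sup>2 \<le> (2 * pi * (norm h * norm \<xi>))\<^sup>2" by (rule power_mono) simp
  also have "\<dots> = 4 * (pi * norm \<xi> * norm h)\<^sup>2" by (simp add: power_mult_distrib mult_ac)
  finally show ?thesis using 1 by (simp add: min_def)
qed

text \<open>Since \<open>\<bar>exp (\<i> t) - 1\<bar> \<le> min 2 \<bar>t\<bar>\<close>, the integrand is at most four times the truncated power of the radial
  estimate with \<open>\<rho> = pi * norm \<xi>\<close>.\<close>

lemma symbol_energy_upper:
  assumes s: "0 < s" "s < 1"
  obtains C where "C \<ge> 0" "\<And>\<xi>::real^'n. symbol_energy s \<xi> \<le> ennreal (C * bessel_base \<xi> powr s)"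
proof -
  obtain C where C: "C \<ge> 0" and le: "\<forall>\<rho>>0. (\<integral>\<^sup>+(h::real^'n). ennreal (min 1 ((\<rho> * norm h)\<^sup>2) / norm h powr (real DIM(real^'n) + 2 * s)) \<partial>lborel)
     \<le> ennreal (C * \<rho> powr (2 * s))"
    using nn_integral_radial_truncated_power[OF s, where 'a="real^'n"] by blast
  have "symbol_energy s \<xi> \<le> ennreal (4 * C * bessel_base \<xi> powr s)" for \<xi> :: "real^'n"
  proof (cases "\<xi> = 0")
    case False
    let ?r = "pi * norm \<xi>"
    have r: "?r > 0" using False by simp
    have "symbol_energy s \<xi> \<le> (\<integral>\<^sup>+(h::real^'n). ennreal 4 * ennreal (min 1 ((?r * norm h)\<^sup>2) / norm h powr (real CARD('n) + 2 * s)) \<partial>lborel)"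
      unfolding symbol_energy_def
    proof (rule nn_integral_mono)
      fix h :: "real^'n"
      have "(cmod (character h \<xi> - 1))\<^sup>2 / norm h powr (real CARD('n) + 2 * s)
        \<le> 4 * min 1 ((?r * norm h)\<^sup>2) / norm h powr (real CARD('n) + 2 * s)"
        by (intro divide_right_mono cmod_character_minus_1_sq_le) simp
      then show "ennreal ((cmod (character h \<xi> - 1))\<^sup>2 / norm h powr (real CARD('n) + 2 * s))
        \<le> ennreal 4 * ennreal (min 1 ((?r * norm h)\<^sup>2) / norm h powr (real CARD('n) + 2 * s))"
        by (subst ennreal_mult[symmetric]) (auto intro!: ennreal_leI)
    qed
    also have "\<dots> = ennreal 4 * (\<integral>\<^sup>+(h::real^'n). ennreal (min 1 ((?r * norm h)\<^sup>2) / norm h powr (real CARD('n) + 2 * s)) \<partial>lborel)"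
      by (rule nn_integral_cmult) measurable
    also have "\<dots> \<le> ennreal 4 * ennreal (C * ?r powr (2 * s))"
      using le[rule_format, OF r] by (intro mult_left_mono) (simp_all add: mult.commute)
    also have "\<dots> \<le> ennreal (4 * C * bessel_base \<xi> powr s)"
    proof -
      have "?r powr (2 * s) = (?r powr 2) powr s" by (simp only: powr_powr)
      also have "?r powr 2 = pi\<^sup>2 * (norm \<xi>)\<^sup>2" using r by (simp add: power_mult_distrib)
      also have "(pi\<^sup>2 * (norm \<xi>)\<^sup>2) powr s \<le> bessel_base \<xi> powr s"
        using s by (intro powr_mono2) auto
      finally have "4 * (C * ?r powr (2 * s)) \<le> 4 * (C * bessel_base \<xi> powr s)"
        using C by (intro mult_left_mono) auto
      then show ?thesis using C by (subst ennreal_mult[symmetric]) (auto intro!: ennreal_leI)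
    qed
    finally show ?thesis .
  qed (simp add: symbol_energy_def)
  then show ?thesis using that[of "4 * C"] C by simp
qed

lemma cmod_character_minus_1_sq: "(cmod (character h \<xi> - 1))\<^sup>2 = 2 - 2 * cos (2 * pi * (h \<bullet> \<xi>))"
proof -
  have "character h \<xi> = cis (2 * pi * (h \<bullet> \<xi>))"
    by (simp add: character_def cis_conv_exp mult_ac)
  then have "(cmod (character h \<xi> - 1))\<^sup>2 = (cos (2 * pi * (h \<bullet> \<xi>)) - 1)\<^sup>2 + (sin (2 * pi * (h \<bullet> \<xi>)))\<^sup>2"
    by (simp add: cmod_power2)
  also have "\<dots> = 2 - 2 * cos (2 * pi * (h \<bullet> \<xi>))"
    using sin_cos_squared_add[of "2 * pi * (h \<bullet> \<xi>)"] by (simp add: power2_diff)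
  finally show ?thesis .
qed

text \<open>It is enough to integrate over a ball on which the character stays away from 1. At the centre
  \<open>\<xi> / (2 * (norm \<xi>)\<^sup>2)\<close> the phase \<open>h \<bullet> \<xi>\<close> is exactly 1/2, and the radius \<open>1 / (4 * norm \<xi>)\<close> keeps it between
  1/4 and 3/4, where the cosine is nonpositive.\<close>

lemma symbol_energy_lower_homogeneous:
  fixes \<xi> :: "real^'n"
  assumes s: "0 < s" and \<xi>: "\<xi> \<noteq> 0"
  shows "ennreal (2 * unit_ball_vol (real CARD('n)) / 4 ^ CARD('n) * norm \<xi> powr (2 * s)) \<le> symbol_energy s \<xi>"
proof -
  define r where "r = norm \<xi>"
  have r: "r > 0" using \<xi> by (simp add: r_def)
  define c where "c = (1 / (2 * r\<^sup>2)) *\<^sub>R \<xi>"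
  let ?B = "ball c (1 / (4 * r))"
  let ?n = "real CARD('n)"
  have bound: "2 * r powr (?n + 2 * s) \<le> (cmod (character h \<xi> - 1))\<^sup>2 / norm h powr (?n + 2 * s)" if h: "h \<in> ?B" for h
  proof -
    have d: "norm (h - c) \<le> 1 / (4 * r)" using h by (simp add: dist_norm norm_minus_commute)
    have c\<xi>: "c \<bullet> \<xi> = 1 / 2" using r by (simp add: c_def r_def dot_square_norm)
    have "\<bar>(h - c) \<bullet> \<xi>\<bar> \<le> 1 / (4 * r) * r"
      using Cauchy_Schwarz_ineq2[of "h - c" \<xi>] mult_right_mono[OF d, of r] r by (simp add: r_def)
    also have "1 / (4 * r) * r = 1 / 4" using r by simp
    finally have t: "\<bar>h \<bullet> \<xi> - 1 / 2\<bar> \<le> 1 / 4" unfolding inner_diff_left c\<xi> .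
    have "h \<bullet> \<xi> > 0" using t unfolding abs_le_iff by simp
    then have "h \<noteq> 0" by auto
    have "cos (2 * pi * (h \<bullet> \<xi>)) = - cos (2 * pi * (h \<bullet> \<xi> - 1 / 2))"
      using cos_minus_pi[of "2 * pi * (h \<bullet> \<xi>)"] by (simp add: algebra_simps)
    moreover have "cos (2 * pi * (h \<bullet> \<xi> - 1 / 2)) \<ge> 0"
    proof (rule cos_ge_zero)
      have "2 * pi * \<bar>h \<bullet> \<xi> - 1 / 2\<bar> \<le> 2 * pi * (1 / 4)" by (intro mult_left_mono t) auto
      then have "\<bar>2 * pi * (h \<bullet> \<xi> - 1 / 2)\<bar> \<le> pi / 2" by (simp add: abs_mult)
      then show "- (pi / 2) \<le> 2 * pi * (h \<bullet> \<xi> - 1 / 2)" "2 * pi * (h \<bullet> \<xi> - 1 / 2) \<le> pi / 2"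
        unfolding abs_le_iff by simp_all
    qed
    ultimately have two: "2 \<le> (cmod (character h \<xi> - 1))\<^sup>2"
      unfolding cmod_character_minus_1_sq by simp
    have nc: "norm c = 1 / (2 * r)" using r by (simp add: c_def r_def[symmetric] power2_eq_square)
    have "norm h \<le> norm c + norm (h - c)" using norm_triangle_ineq[of c "h - c"] by simp
    also have "\<dots> \<le> 1 / (2 * r) + 1 / (4 * r)" using d nc by simp
    also have "\<dots> \<le> 1 / r" using r by (simp add: field_simps)
    finally have "norm h powr (?n + 2 * s) \<le> (1 / r) powr (?n + 2 * s)"
      using s by (intro powr_mono2) auto
    also have "\<dots> = 1 / r powr (?n + 2 * s)" using r by (simp add: powr_divide)
    finally have "r powr (?n + 2 * s) * norm h powr (?n + 2 * s) \<le> 1" using r by (simp add: field_simps)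
    then have "2 * r powr (?n + 2 * s) * norm h powr (?n + 2 * s) \<le> (cmod (character h \<xi> - 1))\<^sup>2"
      using two by simp
    then show ?thesis using \<open>h \<noteq> 0\<close> by (simp add: pos_le_divide_eq)
  qed
  have "ennreal (2 * r powr (?n + 2 * s) * (unit_ball_vol ?n * (1 / (4 * r)) ^ CARD('n)))
    = (\<integral>\<^sup>+h. ennreal (2 * r powr (?n + 2 * s)) * indicator ?B h \<partial>lborel)"
    using r by (subst nn_integral_cmult_indicator) (auto simp: emeasure_ball ennreal_mult)
  also have "\<dots> \<le> symbol_energy s \<xi>"
    unfolding symbol_energy_def by (intro nn_integral_mono) (auto simp: indicator_def intro!: ennreal_leI bound)
  also have "2 * r powr (?n + 2 * s) * (unit_ball_vol ?n * (1 / (4 * r)) ^ CARD('n)) = 2 * unit_ball_vol ?n / 4 ^ CARD('n) * r powr (2 * s)"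
    using r by (simp add: powr_add powr_realpow power_divide power_mult_distrib)
  finally show ?thesis by (simp add: r_def)
qed

text \<open>For small \<open>\<xi>\<close> the Bessel symbol is bounded and the summand 1 controls it; for large \<open>\<xi>\<close> it is comparable to
  the homogeneous power, which the symbol of the energy controls.\<close>

lemma symbol_energy_lower:
  assumes s: "0 < s" "s < 1"
  obtains c where "c > 0" "\<And>\<xi>::real^'n. ennreal (c * bessel_base \<xi> powr s) \<le> 1 + symbol_energy s \<xi>"
proof -
  define b where "b = 2 * unit_ball_vol (real CARD('n)) / 4 ^ CARD('n)"
  have b: "b > 0" by (simp add: b_def)
  define c where "c = min (1 / 2) (b / (8 * pi\<^sup>2) powr s)"
  have c: "c > 0" using b by (simp add: c_def)
  have cb: "c \<le> b / (8 * pi\<^sup>2) powr s" by (simp only: c_def min.cobounded2)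
  have "ennreal (c * bessel_base \<xi> powr s) \<le> 1 + symbol_energy s \<xi>" for \<xi> :: "real^'n"
  proof (cases "4 * pi\<^sup>2 * (norm \<xi>)\<^sup>2 \<le> 1")
    case True
    have "bessel_base \<xi> powr s \<le> 2 powr s" using True s by (intro powr_mono2) auto
    also have "\<dots> \<le> 2 powr 1" using s by (intro powr_mono) auto
    finally have "bessel_base \<xi> powr s \<le> 2" by simp
    moreover have "c \<le> 1 / 2" by (simp only: c_def min.cobounded1)
    ultimately have "c * bessel_base \<xi> powr s \<le> (1 / 2) * 2"
      by (intro mult_mono) simp_all
    then have "ennreal (c * bessel_base \<xi> powr s) \<le> 1" by simp
    then show ?thesis by (rule add_increasing2[rotated]) simp
  next
    case False
    then have "\<xi> \<noteq> 0" by auto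
    have "bessel_base \<xi> powr s \<le> ((8 * pi\<^sup>2) * (norm \<xi> powr 2)) powr s"
      using False s \<open>\<xi> \<noteq> 0\<close> by (intro powr_mono2) auto
    also have "\<dots> = (8 * pi\<^sup>2) powr s * (norm \<xi> powr 2) powr s"
      by (rule powr_mult)
    also have "(norm \<xi> powr 2) powr s = norm \<xi> powr (2 * s)" by (rule powr_powr)
    finally have "c * bessel_base \<xi> powr s \<le> b / (8 * pi\<^sup>2) powr s * ((8 * pi\<^sup>2) powr s * norm \<xi> powr (2 * s))"
      using b c by (intro mult_mono cb) simp_all
    also have "\<dots> = b * norm \<xi> powr (2 * s)" by simp
    finally have "ennreal (c * bessel_base \<xi> powr s) \<le> ennreal (b * norm \<xi> powr (2 * s))"
      by (rule ennreal_leI)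
    also have "\<dots> \<le> symbol_energy s \<xi>"
      unfolding b_def by (rule symbol_energy_lower_homogeneous[OF s(1) \<open>\<xi> \<noteq> 0\<close>])
    finally show ?thesis by (rule add_increasing[rotated]) simp
  qed
  then show ?thesis using that c by blast
qed

lemma symbol_energy_measurable [measurable]: "(symbol_energy s :: real^'n \<Rightarrow> ennreal) \<in> borel_measurable borel"
  unfolding symbol_energy_def[abs_def] character_def by measurable

text \<open>Substituting \<open>x = y + h\<close> and exchanging the integrals leaves, for each \<open>h\<close>, the squared norm of the difference
  of \<open>u\<close> and its translate by \<open>h\<close>. Plancherel's theorem replaces it by the squared norm of
  \<open>(character h \<xi> - 1) * v \<xi>\<close>, and a second exchange collects everything that depends on \<open>h\<close> into the symbol.\<close>

lemma gagliardo_energy_fourier: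
  fixes u :: "real^'n \<Rightarrow> complex"
  assumes uv: "l2_fourier u v"
  shows "gagliardo_energy s 2 u = (\<integral>\<^sup>+\<xi>. ennreal ((cmod (v \<xi>))\<^sup>2) * symbol_energy s \<xi> \<partial>lborel)"
proof -
  have [measurable]: "u \<in> borel_measurable borel" "v \<in> borel_measurable borel"
    using uv by (auto simp: l2_fourier_def Lp_space_2_iff)
  let ?a = "real CARD('n) + 2 * s"
  have "gagliardo_energy s 2 u = (\<integral>\<^sup>+y. \<integral>\<^sup>+x. ennreal ((cmod (u x - u y))\<^sup>2 / norm (x - y) powr ?a) \<partial>lborel \<partial>lborel)"
    unfolding gagliardo_energy_def by (simp add: mult.commute)
  also have "\<dots> = (\<integral>\<^sup>+y. \<integral>\<^sup>+h. ennreal ((cmod (u (y + h) - u y))\<^sup>2 / norm ((y + h) - y) powr ?a) \<partial>lborel \<partial>lborel)"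
  proof (rule nn_integral_cong)
    fix y :: "real^'n"
    show "(\<integral>\<^sup>+x. ennreal ((cmod (u x - u y))\<^sup>2 / norm (x - y) powr ?a) \<partial>lborel)
      = (\<integral>\<^sup>+h. ennreal ((cmod (u (y + h) - u y))\<^sup>2 / norm ((y + h) - y) powr ?a) \<partial>lborel)"
      by (rule nn_integral_lborel_translate[of "\<lambda>x. ennreal ((cmod (u x - u y))\<^sup>2 / norm (x - y) powr ?a)" y, symmetric]) measurable
  qed
  also have "\<dots> = (\<integral>\<^sup>+y. \<integral>\<^sup>+h. ennreal ((cmod (u (h + y) - u y))\<^sup>2 / norm h powr ?a) \<partial>lborel \<partial>lborel)"
    by (simp add: add.commute)
  also have "\<dots> = (\<integral>\<^sup>+h. \<integral>\<^sup>+y. ennreal ((cmod (u (h + y) - u y))\<^sup>2 / norm h powr ?a) \<partial>lborel \<partial>lborel)"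
    by (rule lborel_pair.Fubini') measurable
  also have "\<dots> = (\<integral>\<^sup>+h. \<integral>\<^sup>+\<xi>. ennreal ((cmod ((character h \<xi> - 1) * v \<xi>))\<^sup>2 / norm h powr ?a) \<partial>lborel \<partial>lborel)"
  proof (rule nn_integral_cong)
    fix h :: "real^'n"
    have fac: "(\<integral>\<^sup>+y. ennreal ((cmod (f y))\<^sup>2 / norm h powr ?a) \<partial>lborel) = ennreal (inverse (norm h powr ?a)) * l2sq f"
      if [measurable]: "f \<in> borel_measurable borel" for f :: "real^'n \<Rightarrow> complex"
      unfolding l2sq_def by (subst nn_integral_cmult[symmetric]) (auto simp: ennreal_mult[symmetric] divide_inverse mult.commute)
    have "l2sq (\<lambda>\<xi>. (character h \<xi> - 1) * v \<xi>) = l2sq (\<lambda>y. u (h + y) - u y)"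
      by (rule plancherel[OF l2_fourier_difference[OF uv]])
    then show "(\<integral>\<^sup>+y. ennreal ((cmod (u (h + y) - u y))\<^sup>2 / norm h powr ?a) \<partial>lborel)
      = (\<integral>\<^sup>+\<xi>. ennreal ((cmod ((character h \<xi> - 1) * v \<xi>))\<^sup>2 / norm h powr ?a) \<partial>lborel)"
      by (subst (1 2) fac) simp_all
  qed
  also have "\<dots> = (\<integral>\<^sup>+\<xi>. \<integral>\<^sup>+h. ennreal ((cmod ((character h \<xi> - 1) * v \<xi>))\<^sup>2 / norm h powr ?a) \<partial>lborel \<partial>lborel)"
    unfolding character_def by (rule lborel_pair.Fubini') measurable
  also have "\<dots> = (\<integral>\<^sup>+\<xi>. ennreal ((cmod (v \<xi>))\<^sup>2) * symbol_energy s \<xi> \<partial>lborel)"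
  proof (rule nn_integral_cong)
    fix \<xi> :: "real^'n"
    have [measurable]: "(\<lambda>h. character h \<xi>) \<in> borel_measurable borel" unfolding character_def by measurable
    show "(\<integral>\<^sup>+h. ennreal ((cmod ((character h \<xi> - 1) * v \<xi>))\<^sup>2 / norm h powr ?a) \<partial>lborel) = ennreal ((cmod (v \<xi>))\<^sup>2) * symbol_energy s \<xi>"
      unfolding symbol_energy_def
      by (subst nn_integral_cmult[symmetric]) (auto simp: ennreal_mult[symmetric] norm_mult power_mult_distrib mult_ac)
  qed
  finally show ?thesis .
qed

lemma cmod_bessel_weight: "cmod (bessel_weight t \<xi>) = bessel_base \<xi> powr t"
  by (simp add: bessel_weight_def)

lemma bessel_weight_measurable [measurable]: "bessel_weight t \<in> borel_measurable borel"
  unfolding bessel_weight_def[abs_def] by measurable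

lemma l2sq_bessel_weight:
  "l2sq (\<lambda>\<xi>. bessel_weight (s / 2) \<xi> * v \<xi>) = (\<integral>\<^sup>+\<xi>. ennreal ((cmod (v \<xi>))\<^sup>2) * ennreal (bessel_base \<xi> powr s) \<partial>lborel)"
proof -
  have p: "(bessel_base \<xi> powr (s / 2))\<^sup>2 = bessel_base \<xi> powr s" for \<xi> :: "real^'n"
    using bessel_base_pos[of \<xi>] by (simp add: powr_power)
  have "(cmod (bessel_weight (s / 2) \<xi> * v \<xi>))\<^sup>2 = (cmod (v \<xi>))\<^sup>2 * bessel_base \<xi> powr s" for \<xi>
    unfolding norm_mult power_mult_distrib cmod_bessel_weight p by (rule mult.commute)
  then show ?thesis
    unfolding l2sq_def by (simp add: ennreal_mult)
qed

text \<open>On the Fourier side both norms are weighted norms of \<open>v\<close>, with weights \<open>bessel_base \<xi> powr s\<close> and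
  \<open>1 + symbol_energy s \<xi>\<close>. The two bounds on the symbol compare the weights pointwise.\<close>

lemma bessel_gagliardo_equivalence:
  assumes s: "0 < s" "s < 1"
  shows "\<exists>c>0. \<exists>C>0. \<forall>(u::real^'n \<Rightarrow> complex) v. l2_fourier u v \<longrightarrow>
       ennreal c * l2sq (\<lambda>\<xi>. bessel_weight (s / 2) \<xi> * v \<xi>) \<le> l2sq u + gagliardo_energy s 2 u \<and>
       l2sq u + gagliardo_energy s 2 u \<le> ennreal C * l2sq (\<lambda>\<xi>. bessel_weight (s / 2) \<xi> * v \<xi>)"
proof -
  obtain C where C: "C \<ge> 0" "\<And>\<xi>::real^'n. symbol_energy s \<xi> \<le> ennreal (C * bessel_base \<xi> powr s)"
    using symbol_energy_upper[OF s, where 'n='n] by blast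
  obtain c where c: "c > 0" "\<And>\<xi>::real^'n. ennreal (c * bessel_base \<xi> powr s) \<le> 1 + symbol_energy s \<xi>"
    using symbol_energy_lower[OF s, where 'n='n] by blast
  have sum: "l2sq u + gagliardo_energy s 2 u = (\<integral>\<^sup>+\<xi>. ennreal ((cmod (v \<xi>))\<^sup>2) * (1 + symbol_energy s \<xi>) \<partial>lborel)"
    if uv: "l2_fourier u v" for u v :: "real^'n \<Rightarrow> complex"
  proof -
    have [measurable]: "v \<in> borel_measurable borel" using uv by (auto simp: l2_fourier_def Lp_space_2_iff)
    show ?thesis
      unfolding plancherel[OF uv, symmetric] gagliardo_energy_fourier[OF uv]
      unfolding l2sq_def
      by (subst nn_integral_add[symmetric]) (auto simp: distrib_left)
  qed
  show ?thesis
  proof (rule exI[of _ c], intro conjI exI[of _ "1 + C"] allI impI)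
    fix u v :: "real^'n \<Rightarrow> complex" assume uv: "l2_fourier u v"
    have [measurable]: "v \<in> borel_measurable borel" using uv by (auto simp: l2_fourier_def Lp_space_2_iff)
    have "ennreal c * l2sq (\<lambda>\<xi>. bessel_weight (s / 2) \<xi> * v \<xi>)
      = (\<integral>\<^sup>+\<xi>. ennreal ((cmod (v \<xi>))\<^sup>2) * ennreal (c * bessel_base \<xi> powr s) \<partial>lborel)"
      unfolding l2sq_bessel_weight using c(1)
      by (subst nn_integral_cmult[symmetric]) (auto simp: ennreal_mult[symmetric] mult_ac)
    also have "\<dots> \<le> l2sq u + gagliardo_energy s 2 u"
      unfolding sum[OF uv] by (intro nn_integral_mono mult_left_mono c) auto
    finally show "ennreal c * l2sq (\<lambda>\<xi>. bessel_weight (s / 2) \<xi> * v \<xi>) \<le> l2sq u + gagliardo_energy s 2 u" .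
  next
    fix u v :: "real^'n \<Rightarrow> complex" assume uv: "l2_fourier u v"
    have [measurable]: "v \<in> borel_measurable borel" using uv by (auto simp: l2_fourier_def Lp_space_2_iff)
    have "l2sq u + gagliardo_energy s 2 u
      \<le> (\<integral>\<^sup>+\<xi>. ennreal ((cmod (v \<xi>))\<^sup>2) * ennreal ((1 + C) * bessel_base \<xi> powr s) \<partial>lborel)"
      unfolding sum[OF uv]
    proof (intro nn_integral_mono mult_left_mono)
      fix \<xi> :: "real^'n"
      have "1 powr s \<le> bessel_base \<xi> powr s" using s by (intro powr_mono2) auto
      then have "ennreal 1 \<le> ennreal (bessel_base \<xi> powr s)" by (intro ennreal_leI) simp
      then have "1 + symbol_energy s \<xi> \<le> ennreal (bessel_base \<xi> powr s) + ennreal (C * bessel_base \<xi> powr s)"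
        by (intro add_mono C) simp
      also have "\<dots> = ennreal ((1 + C) * bessel_base \<xi> powr s)"
        using C(1) by (subst ennreal_plus[symmetric]) (auto simp: distrib_right)
      finally show "1 + symbol_energy s \<xi> \<le> ennreal ((1 + C) * bessel_base \<xi> powr s)" .
    qed auto
    also have "\<dots> = ennreal (1 + C) * l2sq (\<lambda>\<xi>. bessel_weight (s / 2) \<xi> * v \<xi>)"
      unfolding l2sq_bessel_weight using C(1)
      by (subst nn_integral_cmult[symmetric]) (auto simp: ennreal_mult[symmetric] mult_ac simp del: ennreal_plus)
    finally show "l2sq u + gagliardo_energy s 2 u \<le> ennreal (1 + C) * l2sq (\<lambda>\<xi>. bessel_weight (s / 2) \<xi> * v \<xi>)" .
  qed (use c C in auto)
qed

section \<open>Bessel potentials of square-integrable functions\<close>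

lemma bessel_potential_apply:
  assumes \<phi>: "\<phi> \<in> schwartz"
  shows "bessel_potential (- complex_of_real s) T \<phi> = T (fourier (\<lambda>\<xi>. bessel_weight (s / 2) \<xi> * inv_fourier \<phi> \<xi>))"
proof -
  have w: "complex_of_real (bessel_base \<xi>) powr (- (- complex_of_real s) / 2) = bessel_weight (s / 2) \<xi>" for \<xi> :: "real^'a"
  proof -
    have "complex_of_real (bessel_base \<xi>) powr (complex_of_real (s / 2)) = bessel_weight (s / 2) \<xi>"
      unfolding bessel_weight_def by (rule powr_of_real) (use bessel_base_pos[of \<xi>] in auto)
    then show ?thesis by simp
  qed
  have "inv_fourier \<phi> \<in> schwartz" by (rule schwartz_inv_fourier[OF \<phi>])
  moreover from this have "(\<lambda>\<xi>. bessel_weight (s / 2) \<xi> * inv_fourier \<phi> \<xi>) \<in> schwartz"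
    by (rule schwartz_multiplier[OF bessel_weight_multiplier])
  ultimately show ?thesis
    unfolding bessel_potential_def inv_fourier_dist_def mult_dist_def fourier_dist_def w
    using \<phi> by simp
qed

lemma bessel_potential_extensional: "bessel_potential s T \<in> extensional schwartz"
  unfolding bessel_potential_def inv_fourier_dist_def by simp

lemma regular_dist_apply: "\<phi> \<in> schwartz \<Longrightarrow> regular_dist u \<phi> = (LINT x|lborel. u x * \<phi> x)"
  by (simp add: regular_dist_def)

lemma regular_dist_extensional: "regular_dist u \<in> extensional schwartz"
  by (simp add: regular_dist_def)

lemma regular_dist_eq_AE:
  fixes f g :: "real^'n \<Rightarrow> complex"
  assumes "f \<in> Lp_space 2" "g \<in> Lp_space 2" "regular_dist f = regular_dist g"
  shows "AE x in lborel. f x = g x"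
  using assms by (intro AE_eq_of_schwartz_tests) (auto simp flip: regular_dist_apply)

text \<open>On functions the Bessel potential of order \<open>- s\<close> is multiplication of the Fourier transform by the weight.
  The weight and the two transforms are moved onto the test function and back.\<close>

lemma bessel_potential_regular_dist:
  fixes u g v :: "real^'n \<Rightarrow> complex"
  assumes uv: "l2_fourier u v" and g: "l2_fourier g (\<lambda>\<xi>. bessel_weight (s / 2) \<xi> * v \<xi>)"
  shows "bessel_potential (- complex_of_real s) (regular_dist u) = regular_dist g"
proof (rule extensionalityI[OF bessel_potential_extensional regular_dist_extensional])
  fix \<phi> :: "real^'n \<Rightarrow> complex" assume \<phi>: "\<phi> \<in> schwartz"
  let ?\<psi> = "\<lambda>\<xi>. bessel_weight (s / 2) \<xi> * inv_fourier \<phi> \<xi>"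
  have \<psi>: "?\<psi> \<in> schwartz"
    by (intro schwartz_multiplier bessel_weight_multiplier schwartz_inv_fourier \<phi>)
  have "bessel_potential (- complex_of_real s) (regular_dist u) \<phi> = (LINT x|lborel. u x * fourier ?\<psi> x)"
    by (simp add: bessel_potential_apply[OF \<phi>] regular_dist_apply schwartz_fourier[OF \<psi>])
  also have "\<dots> = (LINT \<xi>|lborel. v \<xi> * ?\<psi> \<xi>)"
    using uv \<psi> by (auto simp: l2_fourier_def)
  also have "\<dots> = (LINT \<xi>|lborel. (bessel_weight (s / 2) \<xi> * v \<xi>) * inv_fourier \<phi> \<xi>)"
    by (simp add: mult_ac)
  also have "\<dots> = (LINT x|lborel. g x * \<phi> x)"
    by (rule l2_fourier_inverse_pairing[OF g \<phi>, symmetric])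
  finally show "bessel_potential (- complex_of_real s) (regular_dist u) \<phi> = regular_dist g \<phi>"
    by (simp add: regular_dist_apply[OF \<phi>])
qed

text \<open>The Bessel potential is undone by dividing the transform of the square-integrable function \<open>g\<close> that represents
  it by the weight. The quotient is square-integrable because the inverse weight is bounded by 1. That its
  inverse transform \<open>u\<close> represents \<open>T\<close> is seen by feeding the potential of \<open>T\<close> the test function for which
  the weights cancel.\<close>

lemma bessel_space_regular:
  fixes T :: "(real^'n \<Rightarrow> complex) \<Rightarrow> complex"
  assumes s: "0 < s" and T: "T \<in> bessel_space s 2"
  shows "\<exists>u v. l2_fourier u v \<and> (\<lambda>\<xi>. bessel_weight (s / 2) \<xi> * v \<xi>) \<in> Lp_space 2 \<and> T = regular_dist u"
proof -
  obtain g where g: "g \<in> Lp_space 2" and JT: "bessel_potential (- complex_of_real s) T = regular_dist g"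
    using T by (auto simp: bessel_space_def)
  have Text: "T \<in> extensional schwartz" using T by (auto simp: bessel_space_def tempered_distributions_def)
  obtain w where w: "l2_fourier g w" using l2_fourier_exists[OF g] by blast
  have wL: "w \<in> Lp_space 2" using w by (auto simp: l2_fourier_def)
  let ?m = "bessel_weight (s / 2) :: real^'n \<Rightarrow> complex" and ?m' = "bessel_weight (- (s / 2)) :: real^'n \<Rightarrow> complex"
  have inv: "?m \<xi> * ?m' \<xi> = 1" for \<xi>
    using bessel_base_pos[of \<xi>] unfolding bessel_weight_def by (simp add: powr_minus flip: of_real_mult)
  have "cmod (?m' \<xi>) \<le> 1" for \<xi>
  proof -
    have "bessel_base \<xi> powr (- (s / 2)) \<le> bessel_base \<xi> powr 0"
      using s by (intro powr_mono) auto
    then show ?thesis using bessel_base_pos[of \<xi>] by (simp add: cmod_bessel_weight)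
  qed
  then have v: "(\<lambda>\<xi>. ?m' \<xi> * w \<xi>) \<in> Lp_space 2"
    by (intro Lp_space_2_bounded_mult[OF wL]) measurable
  obtain u where u: "l2_fourier u (\<lambda>\<xi>. ?m' \<xi> * w \<xi>)" using l2_fourier_surj[OF v] by blast
  have "T = regular_dist u"
  proof (rule extensionalityI[OF Text regular_dist_extensional])
    fix \<phi> :: "real^'n \<Rightarrow> complex" assume \<phi>: "\<phi> \<in> schwartz"
    let ?\<psi>' = "\<lambda>\<xi>. ?m' \<xi> * inv_fourier \<phi> \<xi>"
    have \<psi>': "?\<psi>' \<in> schwartz"
      by (intro schwartz_multiplier bessel_weight_multiplier schwartz_inv_fourier \<phi>)
    have \<psi>: "fourier ?\<psi>' \<in> schwartz" by (rule schwartz_fourier[OF \<psi>'])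
    have m\<psi>': "(\<lambda>\<xi>. ?m \<xi> * ?\<psi>' \<xi>) = inv_fourier \<phi>"
      by (rule ext) (simp only: mult.assoc[symmetric] inv mult_1_left)
    have "bessel_potential (- complex_of_real s) T (fourier ?\<psi>') = T \<phi>"
      by (simp only: bessel_potential_apply[OF \<psi>] inv_fourier_fourier[OF \<psi>'] m\<psi>' fourier_inv_fourier[OF \<phi>])
    then have "T \<phi> = (LINT x|lborel. g x * fourier ?\<psi>' x)"
      unfolding JT by (simp add: regular_dist_apply[OF \<psi>])
    also have "\<dots> = (LINT \<xi>|lborel. w \<xi> * ?\<psi>' \<xi>)"
      using w \<psi>' by (auto simp: l2_fourier_def)
    also have "\<dots> = (LINT \<xi>|lborel. (?m' \<xi> * w \<xi>) * inv_fourier \<phi> \<xi>)"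
      by (simp add: mult_ac)
    also have "\<dots> = (LINT x|lborel. u x * \<phi> x)"
      by (rule l2_fourier_inverse_pairing[OF u \<phi>, symmetric])
    finally show "T \<phi> = regular_dist u \<phi>" by (simp add: regular_dist_apply[OF \<phi>])
  qed
  moreover have "(\<lambda>\<xi>. ?m \<xi> * (?m' \<xi> * w \<xi>)) = w"
    using inv by (auto simp: mult.assoc[symmetric])
  then have "(\<lambda>\<xi>. ?m \<xi> * (?m' \<xi> * w \<xi>)) \<in> Lp_space 2" using wL by simp
  ultimately show ?thesis using u by blast
qed

section \<open>Square-integrable functions are tempered distributions\<close>

lemma schwartz_seminorm_upper:
  assumes "\<phi> \<in> schwartz"
  shows "norm x ^ k * cmod (\<phi> x) \<le> schwartz_seminorm k [] \<phi>"
proof -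
  have "bdd_above (range (\<lambda>x. norm x ^ k * cmod (\<phi> x)))"
    using schwartz_decay[OF assms, of k] unfolding bounded_iff bdd_above_def by auto
  then show ?thesis unfolding schwartz_seminorm_def by (auto intro: cSUP_upper)
qed

text \<open>The continuous embedding of the Schwartz space into the square-integrable functions: two seminorms dominate
  \<open>(1 + norm x) ^ (n + 1) * cmod (\<eta> x)\<close>, and the inverse weight is integrable.\<close>

lemma schwartz_L2_bound:
  "\<exists>I\<ge>0. \<forall>\<eta>\<in>schwartz. \<forall>\<delta>>0. schwartz_seminorm 0 [] \<eta> < \<delta> \<longrightarrow> schwartz_seminorm (Suc CARD('n)) [] \<eta> < \<delta> \<longrightarrow>
     sqrt (enn2real (l2sq (\<eta> :: real^'n \<Rightarrow> complex))) \<le> I * \<delta>"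
proof -
  let ?d = "Suc CARD('n)"
  let ?J = "LINT x|lborel. inverse ((1 + norm (x::real^'n)) ^ ?d)"
  have ii: "integrable lborel (\<lambda>x::real^'n. inverse ((1 + norm x) ^ ?d))"
    using integrable_inverse_power[where 'a="real^'n"] by simp
  have J: "?J \<ge> 0" by (rule Bochner_Integration.integral_nonneg) (simp del: power_Suc)
  have "sqrt (enn2real (l2sq \<eta>)) \<le> (2 ^ ?d * 2 * sqrt ?J) * \<delta>"
    if \<eta>: "\<eta> \<in> schwartz" and \<delta>: "\<delta> > 0" "schwartz_seminorm 0 [] \<eta> < \<delta>" "schwartz_seminorm ?d [] \<eta> < \<delta>"
    for \<eta> :: "real^'n \<Rightarrow> complex" and \<delta>
  proof -
    define M where "M = 2 ^ ?d * (2 * \<delta>)"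
    have M: "M \<ge> 0" using \<delta> by (simp add: M_def)
    have bd: "(cmod (\<eta> x))\<^sup>2 \<le> M\<^sup>2 * inverse ((1 + norm x) ^ ?d)" for x
    proof -
      let ?q = "(1 + norm x) ^ ?d"
      have q: "?q \<ge> 1" by (rule one_le_power) simp
      have "?q * cmod (\<eta> x) \<le> 2 ^ ?d * (1 + norm x ^ ?d) * cmod (\<eta> x)"
        by (intro mult_right_mono one_plus_power_le) auto
      also have "\<dots> = 2 ^ ?d * (norm x ^ 0 * cmod (\<eta> x) + norm x ^ ?d * cmod (\<eta> x))"
        by (simp only: power_0 mult_1_left distrib_right mult.assoc)
      also have "\<dots> \<le> M"
        unfolding M_def using schwartz_seminorm_upper[OF \<eta>, of x 0] schwartz_seminorm_upper[OF \<eta>, of x ?d] \<delta>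
        by (intro mult_left_mono) simp_all
      finally have le: "?q * cmod (\<eta> x) \<le> M" .
      have "y \<le> M * inverse q" if "q * y \<le> M" "1 \<le> q" for q y :: real
        using that by (simp add: field_simps)
      from this[OF le q] have "cmod (\<eta> x) \<le> M * inverse ?q" .
      then have "(cmod (\<eta> x))\<^sup>2 \<le> (M * inverse ?q)\<^sup>2" by (rule power_mono) simp
      also have "\<dots> = M\<^sup>2 * (inverse ?q * inverse ?q)" by (simp only: power2_eq_square mult_ac)
      also have "\<dots> \<le> M\<^sup>2 * (inverse ?q * 1)"
      proof -
        have "inverse ?q \<le> 1" using q by (rule inverse_le_1_iff[THEN iffD2, OF disjI2])
        then show ?thesis using q by (intro mult_left_mono) (auto simp del: power_Suc)
      qed
      finally show ?thesis by simp
    qed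
    have "l2sq \<eta> \<le> (\<integral>\<^sup>+(x::real^'n). ennreal (M\<^sup>2 * inverse ((1 + norm x) ^ ?d)) \<partial>lborel)"
      unfolding l2sq_def by (intro nn_integral_mono ennreal_leI bd)
    also have "\<dots> = ennreal (M\<^sup>2 * ?J)"
      by (subst nn_integral_eq_integral[OF integrable_mult_right[OF ii]]) (simp_all del: power_Suc)
    finally have "enn2real (l2sq \<eta>) \<le> M\<^sup>2 * ?J"
      by (rule enn2real_leI[rotated]) (use J in simp)
    then have "sqrt (enn2real (l2sq \<eta>)) \<le> sqrt (M\<^sup>2 * ?J)" by (rule real_sqrt_le_mono)
    also have "\<dots> = M * sqrt ?J" using M by (simp add: real_sqrt_mult)
    finally show ?thesis by (simp only: M_def mult_ac)
  qed
  then show ?thesis using J by (intro exI[of _ "2 ^ ?d * 2 * sqrt ?J"]) auto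
qed

text \<open>Linearity is that of the integral. For continuity, the Cauchy--Schwarz inequality and the embedding above
  show that the intersection of two of the generating seminorm balls is mapped into a given ball.\<close>

lemma regular_dist_tempered:
  fixes u :: "real^'n \<Rightarrow> complex"
  assumes u: "u \<in> Lp_space 2"
  shows "regular_dist u \<in> tempered_distributions"
proof -
  let ?T = "regular_dist u"
  let ?G = "{{\<psi> \<in> schwartz. schwartz_seminorm k \<alpha> (\<lambda>x. \<psi> x - \<phi> x) < \<epsilon>} | \<phi> k \<alpha> \<epsilon>. \<phi> \<in> schwartz \<and> \<epsilon> > 0} :: (real^'n \<Rightarrow> complex) set set"
  have lin: "?T (\<lambda>x. a * \<phi> x + b * \<psi> x) = a * ?T \<phi> + b * ?T \<psi>" if \<phi>: "\<phi> \<in> schwartz" and \<psi>: "\<psi> \<in> schwartz" for \<phi> \<psi> a b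
  proof -
    have i: "integrable lborel (\<lambda>x. u x * \<phi> x)" "integrable lborel (\<lambda>x. u x * \<psi> x)"
      by (intro integrable_mult_L2 u schwartz_Lp_2 \<phi> \<psi>)+
    have "(\<lambda>x. a * \<phi> x + b * \<psi> x) \<in> schwartz"
      by (intro schwartz_add schwartz_cmult \<phi> \<psi>)
    then have "?T (\<lambda>x. a * \<phi> x + b * \<psi> x) = (LINT x|lborel. a * (u x * \<phi> x) + b * (u x * \<psi> x))"
      by (simp add: regular_dist_apply algebra_simps)
    also have "\<dots> = a * (LINT x|lborel. u x * \<phi> x) + b * (LINT x|lborel. u x * \<psi> x)"
      using i by (subst Bochner_Integration.integral_add) auto
    finally show ?thesis by (simp add: regular_dist_apply \<phi> \<psi>)
  qed
  have sem0: "schwartz_seminorm k [] (\<lambda>x::real^'n. 0) = 0" for k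
    by (simp add: schwartz_seminorm_def)
  have top: "topspace schwartz_topology = (schwartz :: (real^'n \<Rightarrow> complex) set)"
  proof -
    have "\<phi> \<in> \<Union> ?G" if "\<phi> \<in> schwartz" for \<phi> :: "real^'n \<Rightarrow> complex"
    proof
      show "\<phi> \<in> {\<psi> \<in> schwartz. schwartz_seminorm 0 [] (\<lambda>x. \<psi> x - \<phi> x) < 1}" using that by (simp add: sem0)
      show "{\<psi> \<in> schwartz. schwartz_seminorm 0 [] (\<lambda>x. \<psi> x - \<phi> x) < 1} \<in> ?G"
        using that zero_less_one by blast
    qed
    then have "\<Union> ?G = schwartz" by blast
    then show ?thesis unfolding schwartz_topology_def topology_generated_by_topspace .
  qed
  obtain I where I: "I \<ge> 0" "\<And>\<eta> \<delta>. \<eta> \<in> schwartz \<Longrightarrow> \<delta> > 0 \<Longrightarrow> schwartz_seminorm 0 [] \<eta> < \<delta> \<Longrightarrow>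
     schwartz_seminorm (Suc CARD('n)) [] \<eta> < \<delta> \<Longrightarrow> sqrt (enn2real (l2sq (\<eta> :: real^'n \<Rightarrow> complex))) \<le> I * \<delta>"
    using schwartz_L2_bound[where 'n='n] by blast
  define A where "A = sqrt (enn2real (l2sq u)) * I"
  have A: "A \<ge> 0" using I by (simp add: A_def)
  have "continuous_map schwartz_topology euclidean ?T"
    unfolding continuous_map_def
  proof (intro conjI allI impI)
    fix U :: "complex set" assume "openin euclidean U"
    then have U: "open U" by simp
    show "openin schwartz_topology {\<phi> \<in> topspace schwartz_topology. ?T \<phi> \<in> U}"
      unfolding top
    proof (subst openin_subopen, intro ballI)
      fix \<phi> assume "\<phi> \<in> {\<phi> \<in> schwartz. ?T \<phi> \<in> U}"
      then have \<phi>: "\<phi> \<in> schwartz" "?T \<phi> \<in> U" by auto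
      obtain \<epsilon> where \<epsilon>: "\<epsilon> > 0" "ball (?T \<phi>) \<epsilon> \<subseteq> U" using U \<phi>(2) by (auto simp: open_contains_ball)
      \<comment> \<open>The summand 1 covers the case \<open>A = 0\<close>.\<close>
      define \<delta> where "\<delta> = \<epsilon> / (A + 1)"
      have \<delta>: "\<delta> > 0" "A * \<delta> < \<epsilon>" using \<epsilon>(1) A by (auto simp: \<delta>_def field_simps)
      let ?W = "\<lambda>k. {\<psi> \<in> schwartz. schwartz_seminorm k [] (\<lambda>x. \<psi> x - \<phi> x) < \<delta>}"
      have W: "openin schwartz_topology (?W k)" for k
        unfolding schwartz_topology_def using \<phi>(1) \<delta>(1) by (intro topology_generated_by_Basis) blast
      have "?W 0 \<inter> ?W (Suc CARD('n)) \<subseteq> {\<phi> \<in> schwartz. ?T \<phi> \<in> U}"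
      proof
        fix \<psi> assume \<psi>: "\<psi> \<in> ?W 0 \<inter> ?W (Suc CARD('n))"
        then have \<psi>s: "\<psi> \<in> schwartz" by simp
        have \<eta>: "(\<lambda>x. \<psi> x - \<phi> x) \<in> schwartz" by (rule schwartz_diff[OF \<psi>s \<phi>(1)])
        have "?T \<psi> - ?T \<phi> = (LINT x|lborel. u x * (\<psi> x - \<phi> x))"
          unfolding regular_dist_apply[OF \<psi>s] regular_dist_apply[OF \<phi>(1)]
          using integral_diff_mult_L2[OF schwartz_Lp_2[OF \<psi>s] schwartz_Lp_2[OF \<phi>(1)] u] by (simp add: mult.commute)
        then have "cmod (?T \<psi> - ?T \<phi>) \<le> sqrt (enn2real (l2sq u)) * sqrt (enn2real (l2sq (\<lambda>x. \<psi> x - \<phi> x)))"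
          using integral_mult_L2_le[OF u schwartz_Lp_2[OF \<eta>]] by simp
        also have "\<dots> \<le> sqrt (enn2real (l2sq u)) * (I * \<delta>)"
          using \<psi> by (intro mult_left_mono I \<eta> \<delta>) auto
        also have "\<dots> < \<epsilon>" using \<delta>(2) by (simp add: A_def mult.assoc)
        finally have "?T \<psi> \<in> ball (?T \<phi>) \<epsilon>" by (simp add: dist_norm norm_minus_commute)
        then show "\<psi> \<in> {\<phi> \<in> schwartz. ?T \<phi> \<in> U}" using \<epsilon>(2) \<psi>s by auto
      qed
      moreover have "\<phi> \<in> ?W 0 \<inter> ?W (Suc CARD('n))" using \<phi>(1) \<delta>(1) by (simp add: sem0)
      ultimately show "\<exists>W. openin schwartz_topology W \<and> \<phi> \<in> W \<and> W \<subseteq> {\<phi> \<in> schwartz. ?T \<phi> \<in> U}"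
        by (intro exI[of _ "?W 0 \<inter> ?W (Suc CARD('n))"] conjI openin_Int W)
    qed
  qed simp
  then show ?thesis
    unfolding tempered_distributions_def using lin regular_dist_extensional by blast
qed

section \<open>Equality of the spaces and equivalence of the norms\<close>

text \<open>The representative chosen by \<open>inv_into\<close> agrees almost everywhere with the one obtained from the weighted
  transform, because Schwartz functions separate square-integrable functions.\<close>

lemma bessel_norm_regular_dist:
  fixes u v :: "real^'n \<Rightarrow> complex"
  assumes uv: "l2_fourier u v" and m: "(\<lambda>\<xi>. bessel_weight (s / 2) \<xi> * v \<xi>) \<in> Lp_space 2"
  shows "regular_dist u \<in> bessel_space s 2"
    and "bessel_norm s 2 (regular_dist u) = sqrt (enn2real (l2sq (\<lambda>\<xi>. bessel_weight (s / 2) \<xi> * v \<xi>)))"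
proof -
  obtain g where g: "l2_fourier g (\<lambda>\<xi>. bessel_weight (s / 2) \<xi> * v \<xi>)" using l2_fourier_surj[OF m] by blast
  have gL: "g \<in> Lp_space 2" using g by (auto simp: l2_fourier_def)
  have J: "bessel_potential (- complex_of_real s) (regular_dist u) = regular_dist g"
    by (rule bessel_potential_regular_dist[OF uv g])
  show "regular_dist u \<in> bessel_space s 2"
    unfolding bessel_space_def using J gL uv regular_dist_tempered by (auto simp: l2_fourier_def)
  let ?g = "inv_into (Lp_space 2) regular_dist (regular_dist g)"
  have "?g \<in> Lp_space 2" by (rule inv_into_into) (rule imageI[OF gL])
  moreover have "regular_dist ?g = regular_dist g" by (rule f_inv_into_f[OF imageI[OF gL]])
  ultimately have "l2sq ?g = l2sq g"
    by (intro l2sq_cong_AE regular_dist_eq_AE gL)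
  then show "bessel_norm s 2 (regular_dist u) = sqrt (enn2real (l2sq (\<lambda>\<xi>. bessel_weight (s / 2) \<xi> * v \<xi>)))"
    unfolding bessel_norm_def J using \<open>?g \<in> Lp_space 2\<close> by (simp add: Lp_norm_2 plancherel[OF g])
qed

theorem theorem3p28:
  fixes s :: real
  assumes "0 < s" and "s < 1"
  shows "regular_dist ` (gagliardo_space s 2 :: (real^'n \<Rightarrow> complex) set) = bessel_space s 2 \<and>
    (\<exists>c>0. \<exists>C>0. \<forall>u \<in> (gagliardo_space s 2 :: (real^'n \<Rightarrow> complex) set).
       c * gagliardo_norm s 2 u \<le> bessel_norm s 2 (regular_dist u) \<and>
       bessel_norm s 2 (regular_dist u) \<le> C * gagliardo_norm s 2 u)"
proof -
  obtain c C where c: "c > 0" "C > 0"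
    and lower: "\<And>(u::real^'n \<Rightarrow> complex) v. l2_fourier u v \<Longrightarrow>
       ennreal c * l2sq (\<lambda>\<xi>. bessel_weight (s / 2) \<xi> * v \<xi>) \<le> l2sq u + gagliardo_energy s 2 u"
    and upper: "\<And>(u::real^'n \<Rightarrow> complex) v. l2_fourier u v \<Longrightarrow>
       l2sq u + gagliardo_energy s 2 u \<le> ennreal C * l2sq (\<lambda>\<xi>. bessel_weight (s / 2) \<xi> * v \<xi>)"
    using bessel_gagliardo_equivalence[OF assms, where 'n='n] by blast
  have weighted: "(\<lambda>\<xi>. bessel_weight (s / 2) \<xi> * v \<xi>) \<in> Lp_space 2 \<longleftrightarrow> u \<in> gagliardo_space s 2"
    if uv: "l2_fourier u v" for u v :: "real^'n \<Rightarrow> complex"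
  proof -
    have uL: "u \<in> Lp_space 2" "l2sq u < \<infinity>" and [measurable]: "v \<in> borel_measurable borel"
      using uv by (auto simp: l2_fourier_def Lp_space_2_iff)
    have "(\<lambda>\<xi>. bessel_weight (s / 2) \<xi> * v \<xi>) \<in> borel_measurable borel" by measurable
    then have "(\<lambda>\<xi>. bessel_weight (s / 2) \<xi> * v \<xi>) \<in> Lp_space 2 \<longleftrightarrow> l2sq (\<lambda>\<xi>. bessel_weight (s / 2) \<xi> * v \<xi>) < \<infinity>"
      by (simp add: Lp_space_2_iff)
    also have "\<dots> \<longleftrightarrow> gagliardo_energy s 2 u < \<infinity>"
    proof
      assume "l2sq (\<lambda>\<xi>. bessel_weight (s / 2) \<xi> * v \<xi>) < \<infinity>"
      then have "ennreal C * l2sq (\<lambda>\<xi>. bessel_weight (s / 2) \<xi> * v \<xi>) < \<infinity>" by (simp add: ennreal_mult_less_top)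
      with upper[OF uv] have "l2sq u + gagliardo_energy s 2 u < \<infinity>" by (rule le_less_trans)
      then show "gagliardo_energy s 2 u < \<infinity>" by simp
    next
      assume "gagliardo_energy s 2 u < \<infinity>"
      then have "l2sq u + gagliardo_energy s 2 u < \<infinity>" using uL(2) by simp
      with lower[OF uv] have "ennreal c * l2sq (\<lambda>\<xi>. bessel_weight (s / 2) \<xi> * v \<xi>) < \<infinity>" by (rule le_less_trans)
      then show "l2sq (\<lambda>\<xi>. bessel_weight (s / 2) \<xi> * v \<xi>) < \<infinity>" using c(1) by (auto simp: ennreal_mult_less_top)
    qed
    finally show ?thesis using uL(1) by (simp add: gagliardo_space_def)
  qed
  have transform: "\<exists>v. l2_fourier u v" if "u \<in> gagliardo_space s 2" for u :: "real^'n \<Rightarrow> complex"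
    using that l2_fourier_exists by (auto simp: gagliardo_space_def)
  have "regular_dist ` (gagliardo_space s 2 :: (real^'n \<Rightarrow> complex) set) = bessel_space s 2"
  proof (intro equalityI subsetI)
    fix T :: "(real^'n \<Rightarrow> complex) \<Rightarrow> complex" assume "T \<in> regular_dist ` gagliardo_space s 2"
    then obtain u where u: "u \<in> gagliardo_space s 2" "T = regular_dist u" by auto
    obtain v where v: "l2_fourier u v" using transform[OF u(1)] by blast
    show "T \<in> bessel_space s 2"
      unfolding u(2) using u(1) weighted[OF v] by (intro bessel_norm_regular_dist(1)[OF v]) simp
  next
    fix T :: "(real^'n \<Rightarrow> complex) \<Rightarrow> complex" assume "T \<in> bessel_space s 2"
    then obtain u v where uv: "l2_fourier u v" "(\<lambda>\<xi>. bessel_weight (s / 2) \<xi> * v \<xi>) \<in> Lp_space 2" "T = regular_dist u"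
      using bessel_space_regular[OF assms(1)] by blast
    then show "T \<in> regular_dist ` gagliardo_space s 2" using weighted[OF uv(1)] by blast
  qed
  moreover have "(1 / sqrt (2 * C)) * gagliardo_norm s 2 u \<le> bessel_norm s 2 (regular_dist u) \<and>
       bessel_norm s 2 (regular_dist u) \<le> (1 / sqrt c) * gagliardo_norm s 2 u"
    if u: "u \<in> gagliardo_space s 2" for u :: "real^'n \<Rightarrow> complex"
  proof -
    obtain v where v: "l2_fourier u v" using transform[OF u] by blast
    let ?N = "l2sq (\<lambda>\<xi>. bessel_weight (s / 2) \<xi> * v \<xi>)"
    have m: "(\<lambda>\<xi>. bessel_weight (s / 2) \<xi> * v \<xi>) \<in> Lp_space 2" using weighted[OF v] u by simp
    have uL: "u \<in> Lp_space 2" using u by (simp add: gagliardo_space_def)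
    define a b N where "a = enn2real (l2sq u)" and "b = enn2real (gagliardo_energy s 2 u)" and "N = enn2real ?N"
    have nn: "a \<ge> 0" "b \<ge> 0" "N \<ge> 0" by (simp_all add: a_def b_def N_def)
    have e: "l2sq u = ennreal a" "gagliardo_energy s 2 u = ennreal b" "?N = ennreal N"
      using u uL m by (simp_all add: a_def b_def N_def gagliardo_space_def Lp_space_2_iff less_top)
    have 1: "c * N \<le> a + b"
      using lower[OF v] c nn unfolding e by (simp add: ennreal_mult[symmetric] ennreal_plus[symmetric] del: ennreal_plus)
    have 2: "a + b \<le> C * N"
      using upper[OF v] c nn unfolding e by (simp add: ennreal_mult[symmetric] ennreal_plus[symmetric] del: ennreal_plus)
    have gn: "gagliardo_norm s 2 u = sqrt a + sqrt b"
      unfolding gagliardo_norm_def gagliardo_seminorm_def Lp_norm_2[OF uL] using nn by (simp add: a_def b_def powr_half_sqrt)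
    have bn: "bessel_norm s 2 (regular_dist u) = sqrt N"
      unfolding bessel_norm_regular_dist(2)[OF v m] N_def ..
    have "(sqrt a + sqrt b)\<^sup>2 \<le> 2 * (a + b)"
      using sum_squares_bound[of "sqrt a" "sqrt b"] nn by (simp add: power2_sum)
    also have "\<dots> \<le> (2 * C) * N" using 2 by simp
    finally have "sqrt a + sqrt b \<le> sqrt ((2 * C) * N)" by (rule real_le_rsqrt)
    then have l: "sqrt a + sqrt b \<le> sqrt (2 * C) * sqrt N" by (simp only: real_sqrt_mult)
    have "a + b \<le> (sqrt a + sqrt b)\<^sup>2" using nn by (simp add: power2_sum)
    then have "c * N \<le> (sqrt a + sqrt b)\<^sup>2" using 1 by simp
    then have "sqrt (c * N) \<le> sqrt a + sqrt b" using nn by (intro real_le_lsqrt) auto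
    then have r: "sqrt c * sqrt N \<le> sqrt a + sqrt b" by (simp only: real_sqrt_mult)
    have "sqrt (2 * C) > 0" "sqrt c > 0" using c by simp_all
    then show ?thesis unfolding gn bn using l r by (simp add: field_simps del: real_sqrt_mult)
  qed
  moreover have "1 / sqrt (2 * C) > 0" "1 / sqrt c > 0" using c by simp_all
  ultimately show ?thesis by blast
qed

end
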